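(* Let $G$ be a finite complex reflection group acting on $\mathbb C^d$, let $\Omega\subseteq\mathbb C^d$ be a bounded $G$-invariant domain, let $\boldsymbol\theta$ be a basic polynomial map associated to $G$, let $\widetilde\omega:\boldsymbol\theta(\Omega)\to(0,\infty)$ be continuous and let $\omega=\widetilde\omega\circ\boldsymbol\theta$. The weighted Bergman kernel $\mathcal B_{\widetilde\omega}$ of $\mathbb A^2_{\widetilde\omega}(\boldsymbol\theta(\Omega))$ is given by $$\mathcal B_{\widetilde\omega}\big(\boldsymbol\theta(\boldsymbol z),\boldsymbol\theta(\boldsymbol w)\big)=\frac{1}{J_{\boldsymbol\theta}(\boldsymbol z)\,\overline{J_{\boldsymbol\theta}(\boldsymbol w)}}\sum_{\sigma\in G}\det(\sigma)\,\mathcal B_\omega(\sigma^{-1}\cdot\boldsymbol z,\boldsymbol w)\qquad\text{for }\boldsymbol z,\boldsymbol w\in\Omega,$$ where $\mathcal B_\omega$ is the reproducing kernel of $\mathbb A^2_\omega(\Omega)$ and $J_{\boldsymbol\theta}$ is the determinant of the complex Jacobian matrix of $\boldsymbol\theta$.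
   Context: A complex reflection on $\mathbb C^d$ is a linear map $\sigma$ of finite order in $GL(d,\mathbb C)$ such that $\mathrm{id}-\sigma$ has rank $1$. A finite complex reflection group is a finite subgroup $G\subset GL(d,\mathbb C)$ generated by complex reflections. $G$ acts on $\mathbb C^d$ by $\sigma\cdot\boldsymbol z=\sigma^{-1}\boldsymbol z$ (so $\sigma^{-1}\cdot\boldsymbol z=\sigma\boldsymbol z$); a domain $\Omega$ is $G$-invariant if it is preserved by this action. A basic polynomial map associated to $G$ is $\boldsymbol\theta=(\theta_1,\dots,\theta_d):\mathbb C^d\to\mathbb C^d$, where $\theta_1,\dots,\theta_d$ are algebraically independent homogeneous polynomials with $\mathbb C[z_1,\dots,z_d]^G=\mathbb C[\theta_1,\dots,\theta_d]$ (these exist by the Chevalley–Shephard–Todd theorem). For a $G$-invariant domain $\Omega$, $\boldsymbol\theta(\Omega)$ is a domain. For a domain $D$ and a continuous weight $\nu:D\to(0,\infty)$, $\mathbb A^2_\nu(D)$ is the Hilbert space of holomorphic $f$ on $D$ with $\int_D|f|^2\nu\,dV<\infty$; its reproducing kernel is the weighted Bergman kernel. $dV$ is Lebesgue measure normalized on $\Omega$; the same multiple of Lebesgue measure is used on $\boldsymbol\theta(\Omega)$. The sum in the formula is divisible by $J_{\boldsymbol\theta}(\boldsymbol z)\overline{J_{\boldsymbol\theta}(\boldsymbol w)}$, and at zeros of $J_{\boldsymbol\theta}$ the quotient is understood as its (holomorphic in $\boldsymbol z$, antiholomorphic in $\boldsymbol w$) extension. *)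

theory Defs
  imports
    "HOL-Analysis.Analysis"
    "HOL-Algebra.Generated_Groups"
    "HOL-Library.Poly_Mapping"
begin

section \<open>Complex reflection groups\<close>

text \<open>
  Linear maps of \<open>complex ^ 'n\<close> are represented by their matrices. Mind that the operations
  \<open>*\<close> and \<open>^\<close> on vectors and matrices act componentwise; the group structure is the one below.
\<close>

definition GL :: "(complex ^ 'n ^ 'n) monoid" where
  "GL = \<lparr>carrier = {A. invertible A}, mult = (**), one = mat 1\<rparr>"

definition complex_reflection :: "complex ^ 'n ^ 'n \<Rightarrow> bool" where
  "complex_reflection s \<longleftrightarrow>
     s \<in> carrier GL \<and> (\<exists>k::nat. 0 < k \<and> s [^]\<^bsub>GL\<^esub> k = \<one>\<^bsub>GL\<^esub>) \<and> rank (mat 1 - s) = 1"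

definition finite_complex_reflection_group :: "(complex ^ 'n ^ 'n) set \<Rightarrow> bool" where
  "finite_complex_reflection_group G \<longleftrightarrow>
     finite G \<and> subgroup G GL \<and> (\<exists>S. (\<forall>s\<in>S. complex_reflection s) \<and> G = generate GL S)"

definition group_act :: "complex ^ 'n ^ 'n \<Rightarrow> complex ^ 'n \<Rightarrow> complex ^ 'n" where
  "group_act s z = matrix_inv s *v z"

definition group_invariant :: "(complex ^ 'n ^ 'n) set \<Rightarrow> (complex ^ 'n) set \<Rightarrow> bool" where
  "group_invariant G D \<longleftrightarrow> (\<forall>s\<in>G. group_act s ` D = D)"


section \<open>Polynomials in the coordinates and basic polynomial maps\<close>

text \<open>
  The ring of complex polynomials in the variables \<open>z\<^sub>i\<close>, \<open>i :: 'n\<close>, as finitely supported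
  functions from exponent vectors to coefficients; its multiplication is convolution.
\<close>

type_synonym 'n cpoly = "('n \<Rightarrow>\<^sub>0 nat) \<Rightarrow>\<^sub>0 complex"

definition cpoly_eval :: "'n cpoly \<Rightarrow> complex ^ 'n \<Rightarrow> complex" where
  "cpoly_eval p z =
     (\<Sum>m\<in>Poly_Mapping.keys p. Poly_Mapping.lookup p m * (\<Prod>i\<in>UNIV. z $ i ^ Poly_Mapping.lookup m i))"

text \<open>\<open>cpoly_subst P q\<close> is the polynomial \<open>q\<close> with \<open>P i\<close> substituted for the variable \<open>z\<^sub>i\<close>.\<close>

definition cpoly_subst :: "('n::finite \<Rightarrow> 'n cpoly) \<Rightarrow> 'n cpoly \<Rightarrow> 'n cpoly" where
  "cpoly_subst P q =
     (\<Sum>m\<in>Poly_Mapping.keys q.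
        Poly_Mapping.single 0 (Poly_Mapping.lookup q m) * (\<Prod>i\<in>UNIV. P i ^ Poly_Mapping.lookup m i))"

definition homogeneous_cpoly :: "'n::finite cpoly \<Rightarrow> bool" where
  "homogeneous_cpoly p \<longleftrightarrow>
     (\<exists>k. \<forall>m\<in>Poly_Mapping.keys p. (\<Sum>i\<in>UNIV. Poly_Mapping.lookup m i) = k)"

definition algebraically_independent :: "('n::finite \<Rightarrow> 'n cpoly) \<Rightarrow> bool" where
  "algebraically_independent P \<longleftrightarrow> (\<forall>q. cpoly_subst P q = 0 \<longrightarrow> q = 0)"

definition invariant_cpolys :: "(complex ^ 'n ^ 'n) set \<Rightarrow> 'n cpoly set" where
  "invariant_cpolys G = {p. \<forall>s\<in>G. \<forall>z. cpoly_eval p (group_act s z) = cpoly_eval p z}"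

definition basic_polynomial_map ::
    "(complex ^ 'n ^ 'n) set \<Rightarrow> (complex ^ 'n \<Rightarrow> complex ^ 'n) \<Rightarrow> bool" where
  "basic_polynomial_map G \<theta> \<longleftrightarrow>
     (\<exists>P. (\<forall>i. homogeneous_cpoly (P i)) \<and> algebraically_independent P \<and>
          invariant_cpolys G = cpoly_subst P ` UNIV \<and>
          \<theta> = (\<lambda>z. \<chi> i. cpoly_eval (P i) z))"

text \<open>The entry in row \<open>i\<close> and column \<open>j\<close> is the complex partial derivative of \<open>\<theta>\<^sub>i\<close> in \<open>z\<^sub>j\<close>.\<close>

definition complex_jacobian :: "(complex ^ 'n \<Rightarrow> complex ^ 'n) \<Rightarrow> complex ^ 'n \<Rightarrow> complex" where
  "complex_jacobian \<theta> z = det (\<chi> i j. deriv (\<lambda>t. \<theta> (z + axis j t) $ i) 0)"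


section \<open>Weighted Bergman spaces and kernels\<close>

text \<open>
  Holomorphy in several variables on an open set: the real derivative exists at every point and is
  complex linear. (The library's \<open>holomorphic_on\<close> covers one variable only.)
\<close>

definition holomorphic_Cn :: "(complex ^ 'n \<Rightarrow> complex) \<Rightarrow> (complex ^ 'n) set \<Rightarrow> bool" where
  "holomorphic_Cn f D \<longleftrightarrow>
     (\<forall>z\<in>D. \<exists>L. (f has_derivative L) (at z) \<and> (\<forall>c v. L (c *s v) = c * L v))"

text \<open>The multiple of Lebesgue measure that gives \<open>D\<close> (bounded, open, nonempty) volume one.\<close>

definition normalized_volume :: "(complex ^ 'n) set \<Rightarrow> (complex ^ 'n) measure" where
  "normalized_volume D = scale_measure (ennreal (1 / measure lborel D)) lborel"

text \<open>
  Elements are represented by functions on all of \<open>complex ^ 'n\<close>; their values outside \<open>D\<close> are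
  irrelevant.
\<close>

definition bergman_space ::
    "(complex ^ 'n) measure \<Rightarrow> (complex ^ 'n) set \<Rightarrow> (complex ^ 'n \<Rightarrow> real) \<Rightarrow>
     (complex ^ 'n \<Rightarrow> complex) set" where
  "bergman_space V D \<nu> =
     {f. holomorphic_Cn f D \<and> set_integrable V D (\<lambda>z. (cmod (f z))\<^sup>2 * \<nu> z)}"

definition bergman_inner ::
    "(complex ^ 'n) measure \<Rightarrow> (complex ^ 'n) set \<Rightarrow> (complex ^ 'n \<Rightarrow> real) \<Rightarrow>
     (complex ^ 'n \<Rightarrow> complex) \<Rightarrow> (complex ^ 'n \<Rightarrow> complex) \<Rightarrow> complex" where
  "bergman_inner V D \<nu> f g = (LINT z:D|V. f z * cnj (g z) * complex_of_real (\<nu> z))"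

definition is_bergman_kernel ::
    "(complex ^ 'n) measure \<Rightarrow> (complex ^ 'n) set \<Rightarrow> (complex ^ 'n \<Rightarrow> real) \<Rightarrow>
     (complex ^ 'n \<Rightarrow> complex ^ 'n \<Rightarrow> complex) \<Rightarrow> bool" where
  "is_bergman_kernel V D \<nu> K \<longleftrightarrow>
     (\<forall>w\<in>D. (\<lambda>z. K z w) \<in> bergman_space V D \<nu>) \<and>
     (\<forall>f\<in>bergman_space V D \<nu>. \<forall>w\<in>D. f w = bergman_inner V D \<nu> f (\<lambda>z. K z w))"

text \<open>Only the values at points of \<open>D\<close> are meaningful; there the choice is unique.\<close>

definition bergman_kernel ::
    "(complex ^ 'n) measure \<Rightarrow> (complex ^ 'n) set \<Rightarrow> (complex ^ 'n \<Rightarrow> real) \<Rightarrow>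
     complex ^ 'n \<Rightarrow> complex ^ 'n \<Rightarrow> complex" where
  "bergman_kernel V D \<nu> = (SOME K. is_bergman_kernel V D \<nu> K)"

lemma is_bergman_kernel_unique:
  assumes K: "is_bergman_kernel V D \<nu> K" and L: "is_bergman_kernel V D \<nu> L"
    and z: "z \<in> D" and w: "w \<in> D"
  shows "K z w = L z w"
proof -
  have rep: "A x y = bergman_inner V D \<nu> (\<lambda>u. A u y) (\<lambda>u. B u x)"
    if A: "is_bergman_kernel V D \<nu> A" and B: "is_bergman_kernel V D \<nu> B"
      and x: "x \<in> D" and y: "y \<in> D" for A B x y
  proof -
    have "(\<lambda>u. A u y) \<in> bergman_space V D \<nu>"
      using A y unfolding is_bergman_kernel_def by blast
    with B x show ?thesis unfolding is_bergman_kernel_def by fast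
  qed
  have herm: "A x y = cnj (B y x)"
    if A: "is_bergman_kernel V D \<nu> A" and B: "is_bergman_kernel V D \<nu> B"
      and x: "x \<in> D" and y: "y \<in> D" for A B x y
  proof -
    have "A x y = bergman_inner V D \<nu> (\<lambda>u. A u y) (\<lambda>u. B u x)"
      by (rule rep[OF A B x y])
    also have "\<dots> = cnj (bergman_inner V D \<nu> (\<lambda>u. B u x) (\<lambda>u. A u y))"
      unfolding bergman_inner_def set_lebesgue_integral_def
      by (subst Bochner_Integration.integral_cnj[symmetric],
          intro Bochner_Integration.integral_cong) (auto simp: mult_ac)
    also have "bergman_inner V D \<nu> (\<lambda>u. B u x) (\<lambda>u. A u y) = B y x"
      by (rule rep[OF B A y x, symmetric])
    finally show ?thesis .
  qed
  have "K z w = cnj (K w z)" by (rule herm[OF K K z w])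
  also have "\<dots> = cnj (cnj (L z w))" using herm[OF K L w z] by simp
  finally show ?thesis by simp
qed


section \<open>Quotients by the Jacobian\<close>

text \<open>
  \<open>Q\<close> is the function on \<open>D \<times> D\<close>, holomorphic in the first and antiholomorphic in the second
  variable, that extends \<open>S z w / (J z * cnj (J w))\<close> across the zeros of \<open>J\<close>.
\<close>

definition sesquiholomorphic_quotient ::
    "(complex ^ 'n) set \<Rightarrow> (complex ^ 'n \<Rightarrow> complex) \<Rightarrow>
     (complex ^ 'n \<Rightarrow> complex ^ 'n \<Rightarrow> complex) \<Rightarrow>
     (complex ^ 'n \<Rightarrow> complex ^ 'n \<Rightarrow> complex) \<Rightarrow> bool" where
  "sesquiholomorphic_quotient D J S Q \<longleftrightarrow>
     (\<forall>w\<in>D. holomorphic_Cn (\<lambda>z. Q z w) D) \<and>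
     (\<forall>z\<in>D. holomorphic_Cn (\<lambda>w. cnj (Q z w)) D) \<and>
     (\<forall>z\<in>D. \<forall>w\<in>D. J z \<noteq> 0 \<longrightarrow> J w \<noteq> 0 \<longrightarrow> Q z w = 1 / (J z * cnj (J w)) * S z w)"

end

theory Submission
  imports Defs "HOL-Complex_Analysis.Conformal_Mappings"
begin

text \<open>
  Write \<open>J\<close> for the Jacobian determinant of \<open>\<theta>\<close>, \<open>D\<close> for \<open>\<theta> ` \<Omega>\<close>, \<open>B\<close> and \<open>C\<close> for the kernels of \<open>\<Omega>\<close> and
  \<open>D\<close>, and let the pullback of a function \<open>f\<close> on \<open>D\<close> be \<open>J \<cdot> (f \<circ> \<theta>)\<close>.

  The fibres of \<open>\<theta>\<close> are the orbits of \<open>G\<close>, and where \<open>J\<close> does not vanish the stabilizers are trivial.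
  Hence \<open>\<theta>\<close> is \<open>card G\<close> to one almost everywhere, its real Jacobian is \<open>|J|\<^sup>2\<close>, and the pullback
  multiplies inner products by \<open>card G\<close> (\<open>pullback_isometry\<close>). Its values are skew: they satisfy
  \<open>det s \<cdot> g (s z) = g z\<close>. Conversely every skew function in the weighted Bergman space of \<open>\<Omega>\<close> is a
  pullback (\<open>skew_imp_pullback\<close>): its quotient by \<open>J\<close> is invariant, so it descends to a holomorphic
  function on \<open>D\<close> minus a polynomial hypersurface; by the same change of variables that function is
  square integrable, and a square integrable holomorphic function extends across the zeros of a
  polynomial (\<open>holomorphic_Cn_L2_extension\<close>).

  Put \<open>S\<^sub>u(z) = \<Sum>s\<in>G. det s \<cdot> B (s z) u\<close>. The kernel \<open>B\<close> is invariant under the diagonal action of \<open>G\<close>,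
  so \<open>S\<^sub>u\<close> is skew and pairing with it is \<open>card G\<close> times evaluation at \<open>u\<close> on skew functions. Now pair
  the pullback of \<open>C(\<cdot>, \<theta> w)\<close> with \<open>S\<^sub>z\<close>. The reproducing property of \<open>S\<^sub>z\<close> gives
  \<open>card G \<cdot> J(z) \<cdot> C(\<theta> z, \<theta> w)\<close>; writing \<open>S\<^sub>z\<close> as the pullback of some \<open>k\<close> and using the reproducing
  property of \<open>C\<close> gives \<open>card G\<close> times the conjugate of \<open>k(\<theta> w)\<close>. Multiplying by the conjugate of
  \<open>J(w)\<close> turns the latter into the conjugate of \<open>S\<^sub>z(w)\<close>, which is \<open>S\<^sub>w(z)\<close>. So
  \<open>J(z) \<cdot> C(\<theta> z, \<theta> w) \<cdot> cnj (J(w)) = S\<^sub>w(z)\<close> on all of \<open>\<Omega> \<times> \<Omega>\<close> (\<open>kernel_transformation\<close>), which says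
  that \<open>C(\<theta> z, \<theta> w)\<close> is the required extension of the quotient; there is only one because the zeros
  of \<open>J\<close> are a null set.

  Two further ingredients are needed. Both kernels exist (\<open>bergman_kernel_exists\<close>), by the Riesz
  argument with an element of minimal norm. And \<open>D\<close> is open (\<open>theta_image_open\<close>): homogeneity makes
  \<open>\<theta>\<close> a closed map; its image is everything, since it is open off a hypersurface and the complement
  of a complex hypersurface is connected; and since fibres are orbits, the complement of \<open>D\<close> is the
  image of the complement of \<open>\<Omega>\<close>.
\<close>


section \<open>Volumes of images under injective holomorphic maps\<close>

text \<open>
  A permutation that moves an index outside the range of \<open>f\<close> meets a zero entry, so only those
  supported in the range contribute. A bijective \<open>f\<close> gives invariance under reindexing; the two
  injections into a sum type give the determinants of matrices with an identity block.
\<close>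

lemma det_identity_rows_outside:
  fixes M :: "'a::comm_ring_1 ^ 'm ^ 'm" and f :: "'n::finite \<Rightarrow> 'm"
  assumes f: "inj f"
    and id: "\<And>k l. k \<notin> range f \<Longrightarrow> M $ k $ l = (if l = k then 1 else 0)"
  shows "det M = det (\<chi> i j. M $ f i $ f j)"
proof -
  define \<Phi> where "\<Phi> = (\<lambda>p. map_permutation UNIV f p)"
  have bij: "bij_betw f UNIV (range f)"
    using f by (simp add: inj_on_imp_bij_betw)
  have bij\<Phi>: "bij_betw \<Phi> {p. p permutes UNIV} {q. q permutes range f}"
  proof -
    have "\<Phi> = (\<lambda>\<pi> x. if x \<in> range f then f (\<pi> (inv_into UNIV f x)) else x)"
      by (auto simp: \<Phi>_def map_permutation_def restrict_id_def fun_eq_iff)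
    with bij_betw_permutations[OF bij] show ?thesis by simp
  qed
  have \<Phi>f: "\<Phi> p (f i) = f (p i)" for p i
    using f by (simp add: \<Phi>_def map_permutation_def restrict_id_def)
  have "det M = (\<Sum>q | q permutes UNIV. of_int (sign q) * (\<Prod>k\<in>UNIV. M $ k $ q k))"
    by (simp add: det_def)
  also have "\<dots> = (\<Sum>q | q permutes range f. of_int (sign q) * (\<Prod>k\<in>UNIV. M $ k $ q k))"
  proof (rule sum.mono_neutral_right)
    show "finite {q. q permutes (UNIV :: 'm set)}" by (simp add: finite_permutations)
    show "{q. q permutes range f} \<subseteq> {q. q permutes UNIV}"
      by (auto intro: permutes_subset)
    show "\<forall>q\<in>{q. q permutes UNIV} - {q. q permutes range f}.
            of_int (sign q) * (\<Prod>k\<in>UNIV. M $ k $ q k) = 0"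
    proof
      fix q assume q: "q \<in> {q. q permutes UNIV} - {q. q permutes range f}"
      then obtain k where k: "k \<notin> range f" "q k \<noteq> k"
        by (metis DiffE mem_Collect_eq permutes_superset UNIV_I DiffD2)
      then have "M $ k $ q k = 0" by (simp add: id)
      then have "(\<Prod>k\<in>UNIV. M $ k $ q k) = 0" by (metis finite UNIV_I prod_zero)
      then show "of_int (sign q) * (\<Prod>k\<in>UNIV. M $ k $ q k) = 0" by simp
    qed
  qed
  also have "\<dots> = (\<Sum>p | p permutes UNIV. of_int (sign (\<Phi> p)) * (\<Prod>k\<in>UNIV. M $ k $ \<Phi> p k))"
    by (rule sum.reindex_bij_betw[OF bij\<Phi>, symmetric])
  also have "\<dots> = (\<Sum>p | p permutes UNIV. of_int (sign p) * (\<Prod>i\<in>UNIV. M $ f i $ f (p i)))"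
  proof (rule sum.cong[OF refl])
    fix p :: "'n \<Rightarrow> 'n" assume "p \<in> {p. p permutes UNIV}"
    then have p: "p permutes UNIV" by simp
    have "(\<Prod>k\<in>UNIV. M $ k $ \<Phi> p k) = (\<Prod>k\<in>range f. M $ k $ \<Phi> p k)"
    proof (rule prod.mono_neutral_right)
      show "\<forall>k\<in>UNIV - range f. M $ k $ \<Phi> p k = 1"
        by (auto simp: id \<Phi>_def map_permutation_def restrict_id_def)
    qed auto
    also have "\<dots> = (\<Prod>i\<in>UNIV. M $ f i $ f (p i))"
      by (simp add: prod.reindex[OF f] \<Phi>f)
    finally show "of_int (sign (\<Phi> p)) * (\<Prod>k\<in>UNIV. M $ k $ \<Phi> p k)
        = of_int (sign p) * (\<Prod>i\<in>UNIV. M $ f i $ f (p i))"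
      using f p by (simp add: \<Phi>_def sign_map_permutation)
  qed
  finally show ?thesis by (simp add: det_def)
qed

definition block_matrix ::
    "'a ^ 'n ^ 'n \<Rightarrow> 'a ^ 'n ^ 'n \<Rightarrow> 'a ^ 'n ^ 'n \<Rightarrow> 'a ^ 'n ^ 'n \<Rightarrow> 'a ^ ('n + 'n) ^ ('n + 'n)" where
  "block_matrix A B C D = (\<chi> k l. case k of
     Inl i \<Rightarrow> (case l of Inl j \<Rightarrow> A $ i $ j | Inr j \<Rightarrow> B $ i $ j)
   | Inr i \<Rightarrow> (case l of Inl j \<Rightarrow> C $ i $ j | Inr j \<Rightarrow> D $ i $ j))"

lemma sum_UNIV_Plus: 
  fixes g :: "'n::finite + 'n \<Rightarrow> 'b::comm_monoid_add"
  shows "(\<Sum>k\<in>UNIV. g k) = (\<Sum>i\<in>UNIV. g (Inl i)) + (\<Sum>i\<in>UNIV. g (Inr i))"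
  by (simp add: UNIV_Plus_UNIV[symmetric] sum.Plus del: UNIV_Plus_UNIV)

lemma block_matrix_mult:
  fixes A :: "'a::comm_ring_1 ^ 'n ^ 'n"
  shows "block_matrix A B C D ** block_matrix A' B' C' D' =
    block_matrix (A ** A' + B ** C') (A ** B' + B ** D') (C ** A' + D ** C') (C ** B' + D ** D')"
  by (auto simp: vec_eq_iff block_matrix_def matrix_matrix_mult_def sum_UNIV_Plus split: sum.split)

text \<open>
  Both factors of the obvious factorization have an identity block among their rows.
\<close>

lemma det_block_lower_triangular:
  fixes A :: "'a::comm_ring_1 ^ 'n ^ 'n"
  shows "det (block_matrix A 0 C D) = det A * det D"
proof -
  have "block_matrix A 0 C D = block_matrix A 0 0 (mat 1) ** block_matrix (mat 1) 0 C D"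
    by (simp add: block_matrix_mult)
  then have "det (block_matrix A 0 C D)
      = det (block_matrix A 0 0 (mat 1)) * det (block_matrix (mat 1) 0 C D)"
    by (simp add: det_mul)
  also have "det (block_matrix A 0 0 (mat 1)) = det A"
    by (subst det_identity_rows_outside[where f = Inl])
       (auto simp: block_matrix_def mat_def image_iff split: sum.split)
  also have "det (block_matrix (mat 1) 0 C D) = det D"
    by (subst det_identity_rows_outside[where f = Inr])
       (auto simp: block_matrix_def mat_def image_iff split: sum.split)
  finally show ?thesis .
qed

lemma of_real_det: "complex_of_real (det M) = det (\<chi> i j. complex_of_real (M $ i $ j))"
  by (simp add: det_def)

lemma cnj_det: "cnj (det M) = det (\<chi> i j. cnj (M $ i $ j))"
  by (simp add: det_def)

text \<open>
  Over the complex numbers the block matrix of a complex linear map becomes triangular: conjugating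
  with \<open>block_matrix 1 \<i> 0 1\<close> leaves \<open>M\<close> and its entrywise conjugate on the diagonal.
\<close>

lemma det_realification:
  fixes M :: "complex ^ 'n ^ 'n"
  defines "A \<equiv> \<chi> i j. complex_of_real (Re (M $ i $ j))" and "B \<equiv> \<chi> i j. complex_of_real (Im (M $ i $ j))"
  shows "det (block_matrix A (-B) B A) = complex_of_real ((cmod (det M))\<^sup>2)"
proof -
  define I where "I = (mat 1 :: complex ^ 'n ^ 'n)"
  define J where "J = (mat \<i> :: complex ^ 'n ^ 'n)"
  have J: "J ** X = (\<chi> i j. \<i> * X $ i $ j)" "X ** J = (\<chi> i j. \<i> * X $ i $ j)"
    "X ** (- J) = (\<chi> i j. - \<i> * X $ i $ j)" for X :: "complex ^ 'n ^ 'n"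
    by (simp_all add: J_def matrix_matrix_mult_def mat_def vec_eq_iff if_distrib[where f="\<lambda>x. x * _"]
          if_distrib[where f="\<lambda>x. _ * x"] sum_negf cong: if_cong) 
  have I: "I ** X = X" "X ** I = X" for X :: "complex ^ 'n ^ 'n" by (simp_all add: I_def)
  (* J is i times the identity, so this is the pair of mutually inverse shears used for conjugation. *)
  have inv: "block_matrix I J 0 I ** block_matrix I (-J) 0 I = mat 1"
    unfolding block_matrix_mult I
    by (auto simp: block_matrix_def I_def mat_def vec_eq_iff split: sum.split)
  have M: "(\<chi> i j. A $ i $ j + \<i> * B $ i $ j) = M" "(\<chi> i j. A $ i $ j - \<i> * B $ i $ j) = (\<chi> i j. cnj (M $ i $ j))"
    by (auto simp: A_def B_def vec_eq_iff complex_eq_iff)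
  have "det (block_matrix A (-B) B A)
      = det (block_matrix A (-B) B A) * det (block_matrix I J 0 I ** block_matrix I (-J) 0 I)"
    by (simp add: inv)
  also have "\<dots> = det (block_matrix I J 0 I ** block_matrix A (-B) B A ** block_matrix I (-J) 0 I)"
    by (simp add: det_mul mult_ac)
  also have "block_matrix I J 0 I ** block_matrix A (-B) B A ** block_matrix I (-J) 0 I
      = block_matrix M 0 B (\<chi> i j. cnj (M $ i $ j))"
  proof -
    have "block_matrix I J 0 I ** block_matrix A (-B) B A ** block_matrix I (-J) 0 I
      = block_matrix (\<chi> i j. A $ i $ j + \<i> * B $ i $ j) 0 B (\<chi> i j. A $ i $ j - \<i> * B $ i $ j)"
      unfolding block_matrix_mult I J by (auto simp: block_matrix_def vec_eq_iff algebra_simps split: sum.split)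
    then show ?thesis by (simp only: M)
  qed
  also have "det \<dots> = det M * cnj (det M)" by (simp add: det_block_lower_triangular cnj_det)
  also have "\<dots> = complex_of_real ((cmod (det M))\<^sup>2)" by (rule complex_norm_square[symmetric])
  finally show ?thesis .
qed

text \<open>
  Volume computations take place in \<open>real ^ 'n bit0\<close>: the index type \<open>'n bit0\<close> has twice as many
  elements as \<open>'n\<close> and is well ordered.
\<close>

definition realification_index :: "'n::finite bit0 \<Rightarrow> 'n + 'n" where
  "realification_index = (SOME e. bij e)"

lemma bij_realification_index: "bij (realification_index :: 'n::finite bit0 \<Rightarrow> 'n + 'n)"
proof -
  have "card (UNIV :: 'n bit0 set) = card (UNIV :: ('n + 'n) set)" by simp
  then have "\<exists>e :: 'n bit0 \<Rightarrow> 'n + 'n. bij e"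
    using finite_same_card_bij[of "UNIV :: 'n bit0 set" "UNIV :: ('n + 'n) set"] by simp
  then show ?thesis unfolding realification_index_def by (rule someI_ex)
qed

definition realification_pos :: "'n::finite + 'n \<Rightarrow> 'n bit0" where
  "realification_pos = inv_into UNIV realification_index"

definition realify :: "complex ^ 'n \<Rightarrow> real ^ ('n bit0)" where
  "realify z = (\<chi> k. case realification_index k of Inl i \<Rightarrow> Re (z $ i) | Inr i \<Rightarrow> Im (z $ i))"

definition unrealify :: "real ^ ('n::finite bit0) \<Rightarrow> complex ^ 'n" where
  "unrealify x = (\<chi> i. Complex (x $ realification_pos (Inl i)) (x $ realification_pos (Inr i)))"

lemma bij_realification_pos: "bij (realification_pos :: 'n::finite + 'n \<Rightarrow> _)"
  by (simp add: realification_pos_def bij_realification_index bij_imp_bij_inv)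

lemma realification_index_inv [simp]: 
  "realification_index (realification_pos s) = s" "realification_pos (realification_index k) = k"
  unfolding realification_pos_def
  by (rule surj_f_inv_f[OF bij_is_surj[OF bij_realification_index]],
      rule inv_f_f[OF bij_is_inj[OF bij_realification_index]])

lemma unrealify_realify [simp]: "unrealify (realify z) = z"
  by (simp add: realify_def unrealify_def vec_eq_iff)

lemma realify_unrealify [simp]: "realify (unrealify x) = x"
proof -
  have "realify (unrealify x) $ k = x $ k" for k
  proof (cases "realification_index k")
    case (Inl i)
    moreover have "realification_pos (Inl i) = k" by (metis Inl realification_index_inv(2))
    ultimately show ?thesis by (simp add: realify_def unrealify_def)
  next
    case (Inr i)
    moreover have "realification_pos (Inr i) = k" by (metis Inr realification_index_inv(2))
    ultimately show ?thesis by (simp add: realify_def unrealify_def)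
  qed
  then show ?thesis by (simp add: vec_eq_iff)
qed

lemma linear_realify: "linear realify"
  by (rule linearI) (auto simp: realify_def vec_eq_iff split: sum.split)

lemma linear_unrealify: "linear unrealify"
  by (rule linearI) (auto simp: unrealify_def vec_eq_iff complex_eq_iff)

lemma continuous_on_realify: "continuous_on S realify" and continuous_on_unrealify: "continuous_on T unrealify"
  using linear_realify linear_unrealify by (auto intro: linear_continuous_on linear_conv_bounded_linear[THEN iffD1])

lemma measurable_realify [measurable]: "realify \<in> borel \<rightarrow>\<^sub>M borel" and measurable_unrealify [measurable]: "unrealify \<in> borel \<rightarrow>\<^sub>M borel"
  by (auto intro: borel_measurable_continuous_onI continuous_on_realify continuous_on_unrealify)

lemma prod_Basis_vec_real: "(\<Prod>b\<in>Basis. x \<bullet> b) = (\<Prod>k\<in>UNIV. x $ k)" for x :: "real ^ 'm"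
proof -
  have "(Basis :: (real ^ 'm) set) = range (\<lambda>k. axis k 1)" by (auto simp: Basis_vec_def)
  moreover have "inj (\<lambda>k :: 'm. axis k (1::real))" by (auto simp: inj_on_def axis_eq_axis)
  ultimately have "(\<Prod>b\<in>Basis. x \<bullet> b) = (\<Prod>k\<in>UNIV. x \<bullet> axis k 1)"
    by (metis (no_types, lifting) prod.reindex_cong)
  then show ?thesis by (simp add: inner_axis)
qed

lemma prod_Basis_vec_complex:
  "(\<Prod>b\<in>Basis. x \<bullet> b) = (\<Prod>i\<in>UNIV. Re (x $ i)) * (\<Prod>i\<in>UNIV. Im (x $ i))" for x :: "complex ^ 'n"
proof -
  have B: "(Basis :: (complex ^ 'n) set) = range (\<lambda>k. axis k 1) \<union> range (\<lambda>k. axis k \<i>)"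
    by (auto simp: Basis_vec_def Basis_complex_def)
  have "range (\<lambda>k :: 'n. axis k (1::complex)) \<inter> range (\<lambda>k. axis k \<i>) = {}"
    by (auto simp: axis_eq_axis)
  moreover have "inj (\<lambda>k :: 'n. axis k (1::complex))" "inj (\<lambda>k :: 'n. axis k \<i>)"
    by (auto simp: inj_on_def axis_eq_axis)
  ultimately show ?thesis
    unfolding B by (subst prod.union_disjoint) (auto simp: prod.reindex inner_axis inner_complex_def)
qed

lemma prod_realify:
  fixes x :: "real ^ ('n::finite bit0)"
  shows "(\<Prod>b\<in>Basis. x \<bullet> b) = (\<Prod>b\<in>Basis. unrealify x \<bullet> b)"
proof -
  have "(\<Prod>k\<in>UNIV. x $ k) = (\<Prod>s\<in>UNIV. x $ realification_pos s)"
    by (rule prod.reindex_bij_betw[symmetric]) (rule bij_realification_pos)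
  also have "\<dots> = (\<Prod>i\<in>UNIV. x $ realification_pos (Inl i)) * (\<Prod>i\<in>UNIV. x $ realification_pos (Inr i))"
    by (simp add: UNIV_Plus_UNIV[symmetric] prod.Plus del: UNIV_Plus_UNIV)
  finally show ?thesis
    by (simp add: prod_Basis_vec_real prod_Basis_vec_complex unrealify_def)
qed

lemma Basis_le_iff_realify:
  fixes l u :: "real ^ ('n::finite bit0)"
  shows "(\<forall>b\<in>Basis. l \<bullet> b \<le> u \<bullet> b) \<longleftrightarrow> (\<forall>b\<in>Basis. unrealify l \<bullet> b \<le> unrealify u \<bullet> b)"
    and "(\<forall>b\<in>Basis. l \<bullet> b < u \<bullet> b) \<longleftrightarrow> (\<forall>b\<in>Basis. unrealify l \<bullet> b < unrealify u \<bullet> b)"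
proof -
  have *: "(\<forall>b\<in>Basis. P (l \<bullet> b) (u \<bullet> b)) \<longleftrightarrow> (\<forall>b\<in>Basis. P (unrealify l \<bullet> b) (unrealify u \<bullet> b))"
    for P :: "real \<Rightarrow> real \<Rightarrow> bool" and l u :: "real ^ ('n::finite bit0)"
  proof -
    have "(\<forall>b\<in>Basis. P (l \<bullet> b) (u \<bullet> b)) \<longleftrightarrow> (\<forall>k. P (l $ k) (u $ k))"
      by (auto simp: Basis_vec_def inner_axis)
    also have "\<dots> \<longleftrightarrow> (\<forall>s. P (l $ realification_pos s) (u $ realification_pos s))"
      by (metis realification_index_inv(2))
    also have "\<dots> \<longleftrightarrow> (\<forall>i. P (Re (unrealify l $ i)) (Re (unrealify u $ i)) \<and> P (Im (unrealify l $ i)) (Im (unrealify u $ i)))"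
      by (simp add: unrealify_def split_sum_all all_conj_distrib)
    also have "\<dots> \<longleftrightarrow> (\<forall>b\<in>Basis. P (unrealify l \<bullet> b) (unrealify u \<bullet> b))"
      by (auto simp: Basis_vec_def Basis_complex_def inner_axis inner_complex_def)
    finally show ?thesis .
  qed
  show "(\<forall>b\<in>Basis. l \<bullet> b \<le> u \<bullet> b) \<longleftrightarrow> (\<forall>b\<in>Basis. unrealify l \<bullet> b \<le> unrealify u \<bullet> b)"
    "(\<forall>b\<in>Basis. l \<bullet> b < u \<bullet> b) \<longleftrightarrow> (\<forall>b\<in>Basis. unrealify l \<bullet> b < unrealify u \<bullet> b)"
    by (rule *)+
qed

text \<open>
  Boxes correspond to boxes of the same volume, because the isomorphism only rearranges real
  coordinates.
\<close>

lemma distr_lborel_realify: "distr lborel borel (realify :: complex ^ 'n \<Rightarrow> _) = lborel"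
proof (rule lborel_eqI[symmetric])
  fix l u :: "real ^ ('n bit0)" assume le: "\<And>b. b \<in> Basis \<Longrightarrow> l \<bullet> b \<le> u \<bullet> b"
  have box: "realify -` box l u = box (unrealify l) (unrealify u)"
  proof -
    have "realify z \<in> box l u \<longleftrightarrow> z \<in> box (unrealify l) (unrealify u)" for z
      using Basis_le_iff_realify(2)[of l "realify z"] Basis_le_iff_realify(2)[of "realify z" u]
      by (simp add: mem_box ball_conj_distrib)
    then show ?thesis by blast
  qed
  have "emeasure (distr lborel borel realify) (box l u) = emeasure lborel (box (unrealify l) (unrealify u))"
    by (subst emeasure_distr) (auto simp: box)
  also have "\<dots> = (\<Prod>b\<in>Basis. (unrealify u - unrealify l) \<bullet> b)"
    using Basis_le_iff_realify(1)[of l u] le by (intro emeasure_lborel_box) auto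
  also have "unrealify u - unrealify l = unrealify (u - l)"
    by (simp add: linear_diff[OF linear_unrealify])
  finally show "emeasure (distr lborel borel realify) (box l u) = ennreal (\<Prod>b\<in>Basis. (u - l) \<bullet> b)"
    by (simp add: prod_realify)
qed simp


lemma nn_integral_realify:
  assumes [measurable]: "f \<in> borel_measurable borel"
  shows "(\<integral>\<^sup>+x. f (unrealify x) \<partial>lborel) = (\<integral>\<^sup>+z. f z \<partial>lborel)"
  by (subst distr_lborel_realify[symmetric], subst nn_integral_distr) auto

lemma emeasure_realify_image:
  assumes "S \<in> sets borel"
  shows "realify ` S \<in> sets borel" "emeasure lborel (realify ` S) = emeasure lborel S"
proof -
  have eq: "realify ` S = unrealify -` S \<inter> space borel" by force
  show *: "realify ` S \<in> sets borel" unfolding eq using assms by measurable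
  have "emeasure lborel (realify ` S) = emeasure lborel (realify -` realify ` S)"
    by (subst distr_lborel_realify[symmetric], subst emeasure_distr) (use * in auto)
  also have "realify -` realify ` S = S" by (auto, metis unrealify_realify)
  finally show "emeasure lborel (realify ` S) = emeasure lborel S" .
qed

lemma det_matrix_realified:
  fixes M :: "complex ^ 'n ^ 'n"
  shows "det (matrix (\<lambda>h. realify (M *v unrealify h))) = (cmod (det M))\<^sup>2"
proof -
  define R where "R = matrix (\<lambda>h. realify (M *v unrealify h))"
  define A where "A = (\<chi> i j. complex_of_real (Re (M $ i $ j)))"
  define B where "B = (\<chi> i j. complex_of_real (Im (M $ i $ j)))"
  have un: "unrealify (axis (realification_pos (Inl j)) 1) = axis j 1" 
       "unrealify (axis (realification_pos (Inr j)) 1) = axis j \<i>" for j :: 'n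
  proof -
    have eq: "realification_pos s = realification_pos t \<longleftrightarrow> s = t" for s t :: "'n + 'n"
      by (metis realification_index_inv(1))
    show "unrealify (axis (realification_pos (Inl j)) 1) = axis j 1" 
       "unrealify (axis (realification_pos (Inr j)) 1) = axis j \<i>"
      by (auto simp: unrealify_def axis_def vec_eq_iff eq complex_eq_iff)
  qed
  have ent: "R $ realification_pos s $ realification_pos t
      = (case s of Inl i \<Rightarrow> (case t of Inl j \<Rightarrow> Re (M $ i $ j) | Inr j \<Rightarrow> - Im (M $ i $ j))
           | Inr i \<Rightarrow> (case t of Inl j \<Rightarrow> Im (M $ i $ j) | Inr j \<Rightarrow> Re (M $ i $ j)))" for s t
  proof -
    have "R $ k $ l = realify (M *v unrealify (axis l 1)) $ k" for k l
      by (simp add: R_def matrix_def)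
    moreover have "M *v axis j \<i> = (\<chi> i. M $ i $ j * \<i>)" "M *v axis j 1 = (\<chi> i. M $ i $ j)" for j
      by (auto simp: matrix_vector_mult_def axis_def vec_eq_iff if_distrib[where f="\<lambda>x. _ * x"] cong: if_cong)
    ultimately show ?thesis by (auto simp: un realify_def split: sum.split)
  qed
  have "complex_of_real (det R) = det (\<chi> k l. complex_of_real (R $ k $ l))" by (rule of_real_det)
  also have "\<dots> = det (\<chi> s t. complex_of_real (R $ realification_pos s $ realification_pos t))"
    by (subst det_identity_rows_outside[where f = realification_pos])
       (use bij_realification_pos[where 'n='n] in \<open>auto simp: bij_is_inj bij_is_surj\<close>)
  also have "(\<chi> s t. complex_of_real (R $ realification_pos s $ realification_pos t)) = block_matrix A (-B) B A"
    by (auto simp: ent block_matrix_def A_def B_def vec_eq_iff split: sum.split)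
  also have "det \<dots> = complex_of_real ((cmod (det M))\<^sup>2)"
    unfolding A_def B_def by (rule det_realification)
  finally show ?thesis unfolding R_def of_real_eq_iff .
qed

text \<open>
  The change of variables formula, with the real Jacobian determinant expressed by the complex one.
  Boundedness of \<open>S\<close> and continuity of the determinant make the right-hand side finite.
\<close>

lemma emeasure_injective_image:
  fixes f :: "complex ^ 'n \<Rightarrow> complex ^ 'n"
  assumes S: "S \<in> sets borel" "bounded S"
    and der: "\<And>z. z \<in> S \<Longrightarrow> (f has_derivative (\<lambda>h. M z *v h)) (at z)"
    and inj: "inj_on f S"
    and fS: "f ` S \<in> sets borel"
    and cont: "continuous_on UNIV (\<lambda>z. det (M z))"
  shows "emeasure lborel (f ` S) = (\<integral>\<^sup>+z\<in>S. ennreal ((cmod (det (M z)))\<^sup>2) \<partial>lborel)"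
proof -
  define T where "T = realify ` S"
  define F where "F = (\<lambda>x. realify (f (unrealify x)))"
  define d where "d = (\<lambda>z. (cmod (det (M z)))\<^sup>2)"
  have T: "T \<in> sets borel" unfolding T_def by (rule emeasure_realify_image) (rule S)
  have FT: "F ` T = realify ` f ` S" by (auto simp: F_def T_def image_image)
  have contd: "continuous_on A d" for A
    unfolding d_def by (intro continuous_intros continuous_on_subset[OF cont]) auto
  have [measurable]: "d \<in> borel_measurable borel" by (intro borel_measurable_continuous_onI contd)
  have [measurable]: "S \<in> sets borel" by (rule S)
  have derF: "(F has_derivative (\<lambda>h. realify (M (unrealify x) *v unrealify h))) (at x within T)" if "x \<in> T" for x
  proof -
    have bl: "bounded_linear realify" "bounded_linear unrealify"
      using linear_realify linear_unrealify by (auto intro: linear_conv_bounded_linear[THEN iffD1])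
    have S': "unrealify x \<in> S" using that by (auto simp: T_def)
    have d1: "(unrealify has_derivative unrealify) (at x within T)"
      by (rule bounded_linear_imp_has_derivative[OF bl(2)])
    have d2: "((\<lambda>x. f (unrealify x)) has_derivative (\<lambda>h. M (unrealify x) *v unrealify h)) (at x within T)"
      by (rule has_derivative_compose[OF d1 der[OF S']])
    show ?thesis unfolding F_def
      by (rule bounded_linear.has_derivative[OF bl(1) d2])
  qed
  have injF: "inj_on F T"
  proof (rule inj_onI)
    fix x y assume xy: "x \<in> T" "y \<in> T" "F x = F y"
    then have "f (unrealify x) = f (unrealify y)" unfolding F_def by (metis unrealify_realify)
    moreover have "unrealify x \<in> S" "unrealify y \<in> S" using xy by (auto simp: T_def)
    ultimately have "unrealify x = unrealify y" using inj by (auto dest: inj_onD)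
    then show "x = y" by (metis realify_unrealify)
  qed
  define I where "I = (\<integral>\<^sup>+z. ennreal (indicator S z * d z) \<partial>lborel)"
  have I_eq: "I = (\<integral>\<^sup>+z\<in>S. ennreal (d z) \<partial>lborel)"
    unfolding I_def by (intro nn_integral_cong) (auto simp: indicator_def)
  have "I < \<infinity>"
  proof -
    have "compact (closure S)" using S(2) by (simp add: compact_closure)
    then have "compact (d ` closure S)" by (intro compact_continuous_image contd)
    then obtain C where C: "\<And>z. z \<in> closure S \<Longrightarrow> norm (d z) \<le> C"
      using compact_imp_bounded bounded_iff by (metis image_eqI)
    have C': "d z \<le> max C 0" if "z \<in> S" for z
      using C[of z] that closure_subset[of S] by auto
    have "I \<le> (\<integral>\<^sup>+z. ennreal (max C 0) * indicator S z \<partial>lborel)"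
      unfolding I_def using C' by (intro nn_integral_mono) (auto simp: indicator_def intro!: ennreal_leI simp del: max.bounded_iff le_max_iff_disj)
    also have "\<dots> = ennreal (max C 0) * emeasure lborel S" by (simp add: nn_integral_cmult_indicator)
    also have "\<dots> < \<infinity>" using emeasure_bounded_finite[OF S(2)] by (simp add: ennreal_mult_less_top)
    finally show ?thesis .
  qed
  then obtain r where r: "I = ennreal r" "0 \<le> r" by (cases I) auto
  have "(\<integral>\<^sup>+x. ennreal (indicator T x * d (unrealify x)) \<partial>lborel) = I"
  proof -
    have "indicator T x = (indicator S (unrealify x) :: real)" for x
      unfolding T_def indicator_def by (auto, metis image_eqI realify_unrealify)
    then show ?thesis unfolding I_def
      using nn_integral_realify[of "\<lambda>z. ennreal (indicator S z * d z)"] by simp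
  qed
  note I_real = this
  have hi_UNIV: "((\<lambda>x. indicator T x * d (unrealify x)) has_integral r) UNIV"
  proof (intro nn_integral_has_integral)
    have [measurable]: "T \<in> sets borel" by (rule T)
    show "(\<lambda>x. indicator T x * d (unrealify x)) \<in> borel_measurable borel" by measurable
  qed (use r I_real in \<open>auto simp: d_def\<close>)
  have hi: "((\<lambda>x. d (unrealify x)) has_integral r) T"
  proof -
    have "(\<lambda>x. indicator T x * d (unrealify x)) = (\<lambda>x. if x \<in> T then d (unrealify x) else 0)"
      by (auto simp: indicator_def)
    with hi_UNIV show ?thesis
      by (simp add: has_integral_restrict_UNIV)
  qed
  have detF: "\<bar>det (matrix (\<lambda>h. realify (M (unrealify x) *v unrealify h)))\<bar> = d (unrealify x)" for x
    unfolding det_matrix_realified d_def by simp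
  have Tl: "T \<in> sets lebesgue" using T by simp
  have int: "(\<lambda>x. \<bar>det (matrix (\<lambda>h. realify (M (unrealify x) *v unrealify h)))\<bar>) integrable_on T"
    unfolding detF using hi by blast
  have lm: "F ` T \<in> lmeasurable"
    using measurable_differentiable_image_eq[OF Tl derF injF] int by blast
  have "measure lebesgue (F ` T) = integral T (\<lambda>x. \<bar>det (matrix (\<lambda>h. realify (M (unrealify x) *v unrealify h)))\<bar>)"
    by (rule measure_differentiable_image_eq[OF Tl derF injF int])
  also have "\<dots> = r" unfolding detF using hi by (rule integral_unique)
  finally have "emeasure lebesgue (F ` T) = ennreal r"
    using emeasure_eq_measure2[OF lm] by simp
  moreover have "emeasure lebesgue (F ` T) = emeasure lborel (f ` S)"
    unfolding FT using emeasure_realify_image[OF fS] by simp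
  ultimately show ?thesis using I_eq r by (simp add: d_def)
qed


section \<open>Polynomial functions\<close>

text \<open>
  A definition by closure properties, so that facts about polynomial functions follow by rule
  induction; \<open>polyfun_cpoly_eval\<close> and \<open>polyfun_imp_cpoly\<close> identify it with evaluation of formal
  polynomials.
\<close>

inductive polyfun :: "(complex ^ 'n \<Rightarrow> complex) \<Rightarrow> bool" where
  polyfun_const: "polyfun (\<lambda>_. c)"
| polyfun_coord: "polyfun (\<lambda>z. z $ i)"
| polyfun_add: "polyfun f \<Longrightarrow> polyfun g \<Longrightarrow> polyfun (\<lambda>z. f z + g z)"
| polyfun_mult: "polyfun f \<Longrightarrow> polyfun g \<Longrightarrow> polyfun (\<lambda>z. f z * g z)"

lemma polyfun_sum: "(\<And>x. x \<in> A \<Longrightarrow> polyfun (f x)) \<Longrightarrow> polyfun (\<lambda>z. \<Sum>x\<in>A. f x z)"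
  by (induction A rule: infinite_finite_induct) (auto intro: polyfun.intros)

lemma polyfun_prod: "(\<And>x. x \<in> A \<Longrightarrow> polyfun (f x)) \<Longrightarrow> polyfun (\<lambda>z. \<Prod>x\<in>A. f x z)"
  by (induction A rule: infinite_finite_induct) (auto intro: polyfun.intros)

lemma polyfun_power: "polyfun f \<Longrightarrow> polyfun (\<lambda>z. f z ^ k)"
  by (induction k) (auto intro: polyfun.intros)

lemma polyfun_diff: "polyfun f \<Longrightarrow> polyfun g \<Longrightarrow> polyfun (\<lambda>z. f z - g z)"
  using polyfun_add[of f "\<lambda>z. -1 * g z"] polyfun_mult[OF polyfun_const[of "-1"], of g] by simp

lemma polyfun_det: "(\<And>i j. polyfun (\<lambda>z. M z i j)) \<Longrightarrow> polyfun (\<lambda>z. det (\<chi> i j. M z i j))"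
  unfolding det_def by (auto intro!: polyfun_sum polyfun_mult polyfun_const polyfun_prod)

lemma polyfun_matrix: "polyfun f \<Longrightarrow> polyfun (\<lambda>z. f (A *v z))" for A :: "complex ^ 'n ^ 'n"
  by (induction rule: polyfun.induct)
     (auto simp: matrix_vector_mult_def intro!: polyfun.intros polyfun_sum)

lemma polyfun_cpoly_eval: "polyfun (cpoly_eval p)"
proof -
  have "polyfun (\<lambda>z. \<Sum>m\<in>Poly_Mapping.keys p.
      Poly_Mapping.lookup p m * (\<Prod>i\<in>UNIV. z $ i ^ Poly_Mapping.lookup m i))"
    by (intro polyfun_sum polyfun_mult polyfun_const polyfun_prod polyfun_power polyfun_coord)
  then show ?thesis by (simp add: cpoly_eval_def[abs_def])
qed

lemma cpoly_eval_superset: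
  assumes "finite A" "Poly_Mapping.keys p \<subseteq> A"
  shows "cpoly_eval p z =
    (\<Sum>m\<in>A. Poly_Mapping.lookup p m * (\<Prod>i\<in>UNIV. z $ i ^ Poly_Mapping.lookup m i))"
  unfolding cpoly_eval_def
  by (rule sum.mono_neutral_left) (use assms in \<open>auto simp: in_keys_iff\<close>)

lemma cpoly_eval_zero [simp]: "cpoly_eval 0 z = 0"
  by (simp add: cpoly_eval_def)

lemma cpoly_eval_add [simp]: "cpoly_eval (p + q) z = cpoly_eval p z + cpoly_eval q z"
proof -
  let ?A = "Poly_Mapping.keys p \<union> Poly_Mapping.keys q"
  have "Poly_Mapping.keys (p + q) \<subseteq> ?A" by (rule Poly_Mapping.keys_add)
  then show ?thesis
    by (simp add: cpoly_eval_superset[of ?A] lookup_add distrib_right sum.distrib)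
qed

lemma cpoly_eval_sum [simp]: "cpoly_eval (\<Sum>x\<in>A. f x) z = (\<Sum>x\<in>A. cpoly_eval (f x) z)"
  by (induction A rule: infinite_finite_induct) auto

lemma cpoly_eval_single [simp]:
  "cpoly_eval (Poly_Mapping.single m c) z = c * (\<Prod>i\<in>UNIV. z $ i ^ Poly_Mapping.lookup m i)"
  by (subst cpoly_eval_superset[of "{m}"]) auto

lemma cpoly_eval_one [simp]: "cpoly_eval 1 z = 1"
  using cpoly_eval_single[of 0 1 z] by simp

lemma cpoly_sum_monomials:
  "p = (\<Sum>m\<in>Poly_Mapping.keys p. Poly_Mapping.single m (Poly_Mapping.lookup p m))"
  for p :: "'n cpoly"
  by (rule poly_mapping_eqI) (auto simp: lookup_sum lookup_single when_def in_keys_iff)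

lemma cpoly_eval_mult [simp]: "cpoly_eval (p * q) z = cpoly_eval p z * cpoly_eval q z"
proof -
  have "p * q = (\<Sum>m\<in>Poly_Mapping.keys p. Poly_Mapping.single m (Poly_Mapping.lookup p m)) *
                (\<Sum>m\<in>Poly_Mapping.keys q. Poly_Mapping.single m (Poly_Mapping.lookup q m))"
    using cpoly_sum_monomials[of p] cpoly_sum_monomials[of q] by simp
  also have "cpoly_eval \<dots> z = cpoly_eval p z * cpoly_eval q z"
    by (simp add: sum_product mult_single cpoly_eval_def[of p] cpoly_eval_def[of q]
        lookup_add power_add prod.distrib mult_ac)
  finally show ?thesis .
qed

lemma cpoly_eval_power [simp]: "cpoly_eval (p ^ k) z = cpoly_eval p z ^ k"
  by (induction k) auto

lemma cpoly_eval_prod [simp]: "cpoly_eval (\<Prod>x\<in>A. f x) z = (\<Prod>x\<in>A. cpoly_eval (f x) z)"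
  by (induction A rule: infinite_finite_induct) auto

lemma cpoly_eval_subst:
  "cpoly_eval (cpoly_subst P q) z = cpoly_eval q (\<chi> i. cpoly_eval (P i) z)"
  by (simp add: cpoly_subst_def cpoly_eval_def[of q])

lemma polyfun_imp_cpoly: "polyfun f \<Longrightarrow> \<exists>p. f = cpoly_eval p"
proof (induction rule: polyfun.induct)
  case (polyfun_const c)
  have "(\<lambda>_. c) = cpoly_eval (Poly_Mapping.single 0 c)" by auto
  then show ?case by blast
next
  case (polyfun_coord i)
  have "(\<lambda>z. z $ i) = cpoly_eval (Poly_Mapping.single (Poly_Mapping.single i 1) 1)"
    by (auto simp: lookup_single when_def if_distrib[where f="\<lambda>n. _ ^ n"] cong: if_cong)
  then show ?case by blast
next
  case (polyfun_add f g)
  then obtain p q where "f = cpoly_eval p" "g = cpoly_eval q" by blast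
  then have "(\<lambda>z. f z + g z) = cpoly_eval (p + q)" by auto
  then show ?case by blast
next
  case (polyfun_mult f g)
  then obtain p q where "f = cpoly_eval p" "g = cpoly_eval q" by blast
  then have "(\<lambda>z. f z * g z) = cpoly_eval (p * q)" by auto
  then show ?case by blast
qed

lemma cpoly_subst_coord:
  fixes P :: "'n::finite \<Rightarrow> 'n cpoly"
  shows "cpoly_subst P (Poly_Mapping.single (Poly_Mapping.single i 1) 1) = P i"
  by (simp add: cpoly_subst_def lookup_single when_def if_distrib[where f="\<lambda>n. _ ^ n"] cong: if_cong)

lemma polyfun_partial_derivative:
  fixes f :: "complex ^ 'n \<Rightarrow> complex"
  assumes "polyfun f"
  obtains g where "polyfun g" "\<And>z. ((\<lambda>t. f (z + axis j t)) has_field_derivative g z) (at 0)"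
proof -
  have ax: "axis j 0 = (0 :: complex ^ 'n)" for j by (simp add: axis_def vec_eq_iff)
  have "\<exists>g. polyfun g \<and> (\<forall>z. ((\<lambda>t. f (z + axis j t)) has_field_derivative g z) (at 0))"
    using assms
  proof (induction rule: polyfun.induct)
    case (polyfun_const c)
    then show ?case by (intro exI[of _ "\<lambda>_. 0"]) (auto intro: polyfun.intros)
  next
    case (polyfun_coord i)
    show ?case
    proof (intro exI[of _ "\<lambda>_. if i = j then 1 else 0"] conjI allI)
      show "((\<lambda>t. (z + axis j t) $ i) has_field_derivative (if i = j then 1 else 0)) (at 0)" for z :: "complex ^ 'n"
        by (cases "i = j") (auto simp: axis_def intro!: derivative_eq_intros)
    qed (rule polyfun.polyfun_const)
  next
    case (polyfun_add f g)
    then obtain f' g' where "polyfun f'" "polyfun g'"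
      "\<And>z. ((\<lambda>t. f (z + axis j t)) has_field_derivative f' z) (at 0)"
      "\<And>z. ((\<lambda>t. g (z + axis j t)) has_field_derivative g' z) (at 0)" by blast
    then show ?case
      by (intro exI[of _ "\<lambda>z. f' z + g' z"] conjI allI polyfun.polyfun_add DERIV_add) auto
  next
    case (polyfun_mult f g)
    then obtain f' g' where d: "polyfun f'" "polyfun g'"
      "\<And>z. ((\<lambda>t. f (z + axis j t)) has_field_derivative f' z) (at 0)"
      "\<And>z. ((\<lambda>t. g (z + axis j t)) has_field_derivative g' z) (at 0)" by blast
    show ?case
    proof (intro exI[of _ "\<lambda>z. f' z * g z + g' z * f z"] conjI allI)
      show "((\<lambda>t. f (z + axis j t) * g (z + axis j t)) has_field_derivative f' z * g z + g' z * f z) (at 0)" for z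
        using DERIV_mult[OF d(3)[of z] d(4)[of z]] by (simp add: ax)
    qed (intro polyfun.intros d polyfun_mult.hyps)
  qed
  then show ?thesis using that by blast
qed

lemma polyfun_line:
  assumes "polyfun f"
  obtains p where "\<And>t. f (a + t *s v) = poly p t"
proof -
  have "\<exists>p. \<forall>t. f (a + t *s v) = poly p t"
    using assms
  proof (induction rule: polyfun.induct)
    case (polyfun_const c)
    show ?case by (intro exI[of _ "[:c:]"]) auto
  next
    case (polyfun_coord i)
    show ?case by (intro exI[of _ "[:a $ i, v $ i:]"]) auto
  next
    case (polyfun_add f g)
    then obtain p q where "\<forall>t. f (a + t *s v) = poly p t" "\<forall>t. g (a + t *s v) = poly q t" by blast
    then show ?case by (intro exI[of _ "p + q"]) auto
  next
    case (polyfun_mult f g)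
    then obtain p q where "\<forall>t. f (a + t *s v) = poly p t" "\<forall>t. g (a + t *s v) = poly q t" by blast
    then show ?case by (intro exI[of _ "p * q"]) auto
  qed
  then show ?thesis using that by blast
qed

lemma polyfun_finite_zeros_on_line:
  assumes "polyfun f" "f (a + s *s v) \<noteq> 0"
  shows "finite {t. f (a + t *s v) = 0}"
proof -
  obtain p where p: "\<And>t. f (a + t *s v) = poly p t" by (rule polyfun_line[OF assms(1)]) blast
  then have "p \<noteq> 0" using assms(2) by auto
  then show ?thesis using poly_roots_finite[of p] by (simp add: p)
qed

lemma has_derivative_vec_nth: "((\<lambda>z :: complex ^ 'n. z $ i) has_derivative (\<lambda>h. h $ i)) (at z)"
  by (rule bounded_linear_imp_has_derivative) (rule bounded_linear_vec_nth)

lemma polyfun_holomorphic: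
  assumes "polyfun f"
  shows "holomorphic_Cn f D"
proof -
  have "\<exists>L. (f has_derivative L) (at z) \<and> (\<forall>c v. L (c *s v) = c * L v)" for z
    using assms
  proof (induction rule: polyfun.induct)
    case (polyfun_const c)
    show ?case by (intro exI[of _ "\<lambda>_. 0"]) auto
  next
    case (polyfun_coord i)
    show ?case by (intro exI[of _ "\<lambda>h. h $ i"]) (auto intro: has_derivative_vec_nth)
  next
    case (polyfun_add f g)
    then obtain L K where "(f has_derivative L) (at z)" "\<forall>c v. L (c *s v) = c * L v"
      "(g has_derivative K) (at z)" "\<forall>c v. K (c *s v) = c * K v" by blast
    then show ?case
      by (intro exI[of _ "\<lambda>h. L h + K h"] conjI has_derivative_add) (auto simp: algebra_simps)
  next
    case (polyfun_mult f g)
    then obtain L K where "(f has_derivative L) (at z)" "\<forall>c v. L (c *s v) = c * L v"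
      "(g has_derivative K) (at z)" "\<forall>c v. K (c *s v) = c * K v" by blast
    then show ?case
      by (intro exI[of _ "\<lambda>h. f z * K h + L h * g z"] conjI has_derivative_mult) (auto simp: algebra_simps)
  qed
  then show ?thesis by (simp add: holomorphic_Cn_def)
qed

lemma polyfun_continuous: "polyfun f \<Longrightarrow> continuous_on S f"
  by (induction rule: polyfun.induct) (auto intro!: continuous_intros)

lemma polyfun_measurable [measurable_dest]: "polyfun f \<Longrightarrow> f \<in> borel_measurable borel"
  by (intro borel_measurable_continuous_onI polyfun_continuous)

text \<open>
  On each real line through \<open>a\<close> the function is a nonzero polynomial in one variable. By Fubini's
  theorem for \<open>(x, t) \<mapsto> q (a + t x)\<close> there is a scale \<open>t \<noteq> 0\<close> such that \<open>q (a + t x)\<close> vanishes for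
  almost no \<open>x\<close>, and \<open>x \<mapsto> a + t x\<close> preserves null sets.
\<close>

lemma polyfun_zeros_null:
  fixes q :: "complex ^ 'n \<Rightarrow> complex"
  assumes q: "polyfun q" and a: "q a \<noteq> 0"
  shows "{z. q z = 0} \<in> null_sets lborel"
proof -
  have [measurable]: "q \<in> borel_measurable borel" using q by measurable
  have fin: "AE t in lborel. q (a + t *\<^sub>R x) \<noteq> 0" for x
  proof (rule AE_I')
    have "finite {t. q (a + t *s x) = 0}"
      using polyfun_finite_zeros_on_line[OF q, of a 0 x] a by simp
    then have "finite (complex_of_real -` {t. q (a + t *s x) = 0})"
      by (rule finite_vimageI) (simp add: inj_on_def)
    moreover have "complex_of_real -` {t. q (a + t *s x) = 0} = {t. q (a + t *\<^sub>R x) = 0}"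
    proof -
      have "complex_of_real t *s x = t *\<^sub>R x" for t
        by (simp add: vec_eq_iff scaleR_conv_of_real[where 'a = complex])
      then show ?thesis by auto
    qed
    ultimately show "{t. q (a + t *\<^sub>R x) = 0} \<in> null_sets lborel" 
      by (simp add: finite_imp_null_set_lborel)
  qed auto
  have "AE x in lborel. AE t :: real in lborel. q (a + t *\<^sub>R x) \<noteq> 0" using fin by simp
  then have "AE t :: real in lborel. AE x in lborel. q (a + t *\<^sub>R x) \<noteq> 0"
  proof (subst (asm) lborel_pair.AE_commute)
    have "open {p :: (complex ^ 'n) \<times> real. q (a + snd p *\<^sub>R fst p) \<noteq> 0}"
      by (intro open_Collect_neq continuous_on_compose2[OF polyfun_continuous[OF q, of UNIV]] continuous_intros) auto
    then show "{p \<in> space (lborel \<Otimes>\<^sub>M lborel). q (a + snd p *\<^sub>R fst p) \<noteq> 0}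
        \<in> sets (lborel \<Otimes>\<^sub>M (lborel :: real measure))"
      by (simp only: lborel_prod) simp
  qed
  moreover have "AE t :: real in lborel. t \<noteq> 0" by (rule AE_lborel_singleton)
  ultimately have "AE t :: real in lborel. t \<noteq> 0 \<and> (AE x in lborel. q (a + t *\<^sub>R x) \<noteq> 0)"
    by eventually_elim auto
  then have "\<exists>t :: real. t \<noteq> 0 \<and> (AE x in lborel. q (a + t *\<^sub>R x) \<noteq> 0)"
    by (rule eventually_happens'[rotated]) (simp add: ae_filter_eq_bot_iff)
  then obtain t where t: "t \<noteq> 0" "AE x in lborel. q (a + t *\<^sub>R x) \<noteq> 0"
    by blast
  have "AE z in lborel. q z \<noteq> 0"
    by (subst lborel_affine[OF t(1), of a]) (use t(2) in \<open>simp add: AE_density AE_distr_iff\<close>)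
  then have "emeasure lborel {z. q z = 0} = 0"
    by (simp add: AE_iff_measurable[OF _ refl])
  then show ?thesis by auto
qed


section \<open>Holomorphic functions of several variables\<close>

lemma norm_vector_smult: "norm (c *s v) = cmod c * norm v" for v :: "complex ^ 'n"
  by (simp add: norm_vec_def L2_set_def norm_mult power_mult_distrib sum_distrib_left[symmetric] real_sqrt_mult)

lemma vector_smult_scaleR: "complex_of_real t *s v = t *\<^sub>R v" for v :: "complex ^ 'n"
  by (simp add: vec_eq_iff scaleR_conv_of_real[where 'a = complex])

lemma continuous_on_vector_smult [continuous_intros]:
  assumes "continuous_on S f" "continuous_on S g"
  shows "continuous_on S (\<lambda>x. f x *s (g x :: complex ^ 'n))"
  unfolding vector_scalar_mult_def by (intro continuous_intros assms)

lemma holomorphic_CnD: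
  assumes "holomorphic_Cn f D" "z \<in> D"
  obtains L where "(f has_derivative L) (at z)" "\<And>c v. L (c *s v) = c * L v"
  using assms unfolding holomorphic_Cn_def by blast

lemma holomorphic_Cn_subset: "holomorphic_Cn f D \<Longrightarrow> E \<subseteq> D \<Longrightarrow> holomorphic_Cn f E"
  unfolding holomorphic_Cn_def by blast

lemma holomorphic_Cn_cong:
  assumes "holomorphic_Cn f D" "open D" "\<And>z. z \<in> D \<Longrightarrow> f z = g z"
  shows "holomorphic_Cn g D"
  unfolding holomorphic_Cn_def
proof
  fix z assume z: "z \<in> D"
  then obtain L where L: "(f has_derivative L) (at z)" "\<And>c v. L (c *s v) = c * L v"
    using assms(1) holomorphic_CnD by blast
  have "(g has_derivative L) (at z)"
    by (rule has_derivative_transform_within_open[OF L(1) assms(2) z]) (use assms(3) in auto)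
  then show "\<exists>L. (g has_derivative L) (at z) \<and> (\<forall>c v. L (c *s v) = c * L v)"
    using L(2) by blast
qed

lemma holomorphic_Cn_continuous: "holomorphic_Cn f D \<Longrightarrow> continuous_on D f"
  unfolding holomorphic_Cn_def
  by (intro continuous_at_imp_continuous_on ballI) (metis has_derivative_continuous)

lemma holomorphic_Cn_const: "holomorphic_Cn (\<lambda>_. c) D"
  by (intro polyfun_holomorphic polyfun_const)

lemma holomorphic_Cn_add:
  assumes "holomorphic_Cn f D" "holomorphic_Cn g D"
  shows "holomorphic_Cn (\<lambda>z. f z + g z) D"
  unfolding holomorphic_Cn_def
proof
  fix z assume z: "z \<in> D"
  obtain L where "(f has_derivative L) (at z)" "\<And>c v. L (c *s v) = c * L v"
    using holomorphic_CnD[OF assms(1) z] by blast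
  moreover obtain K where "(g has_derivative K) (at z)" "\<And>c v. K (c *s v) = c * K v"
    using holomorphic_CnD[OF assms(2) z] by blast
  ultimately show "\<exists>L. ((\<lambda>z. f z + g z) has_derivative L) (at z) \<and> (\<forall>c v. L (c *s v) = c * L v)"
    by (intro exI[of _ "\<lambda>h. L h + K h"] conjI has_derivative_add) (auto simp: algebra_simps)
qed

lemma holomorphic_Cn_mult:
  assumes "holomorphic_Cn f D" "holomorphic_Cn g D"
  shows "holomorphic_Cn (\<lambda>z. f z * g z) D"
  unfolding holomorphic_Cn_def
proof
  fix z assume z: "z \<in> D"
  obtain L where "(f has_derivative L) (at z)" "\<And>c v. L (c *s v) = c * L v"
    using holomorphic_CnD[OF assms(1) z] by blast
  moreover obtain K where "(g has_derivative K) (at z)" "\<And>c v. K (c *s v) = c * K v"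
    using holomorphic_CnD[OF assms(2) z] by blast
  ultimately show "\<exists>L. ((\<lambda>z. f z * g z) has_derivative L) (at z) \<and> (\<forall>c v. L (c *s v) = c * L v)"
    by (intro exI[of _ "\<lambda>h. f z * K h + L h * g z"] conjI has_derivative_mult) (auto simp: algebra_simps)
qed

lemma holomorphic_Cn_cmult: "holomorphic_Cn f D \<Longrightarrow> holomorphic_Cn (\<lambda>z. c * f z) D"
  by (intro holomorphic_Cn_mult holomorphic_Cn_const)

lemma holomorphic_Cn_diff:
  assumes "holomorphic_Cn f D" "holomorphic_Cn g D"
  shows "holomorphic_Cn (\<lambda>z. f z - g z) D"
  using holomorphic_Cn_add[OF assms(1) holomorphic_Cn_cmult[OF assms(2), of "-1"]] by simp

lemma holomorphic_Cn_sum: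
  "(\<And>x. x \<in> A \<Longrightarrow> holomorphic_Cn (f x) D) \<Longrightarrow> holomorphic_Cn (\<lambda>z. \<Sum>x\<in>A. f x z) D"
  by (induction A rule: infinite_finite_induct) (auto intro: holomorphic_Cn_const holomorphic_Cn_add)

lemma holomorphic_Cn_inverse:
  assumes "holomorphic_Cn f D" "\<And>z. z \<in> D \<Longrightarrow> f z \<noteq> 0"
  shows "holomorphic_Cn (\<lambda>z. inverse (f z)) D"
  unfolding holomorphic_Cn_def
proof
  fix z assume z: "z \<in> D"
  obtain L where "(f has_derivative L) (at z)" "\<And>c v. L (c *s v) = c * L v"
    using holomorphic_CnD[OF assms(1) z] by blast
  then show "\<exists>L. ((\<lambda>z. inverse (f z)) has_derivative L) (at z) \<and> (\<forall>c v. L (c *s v) = c * L v)"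
    using assms(2)[OF z]
    by (intro exI[of _ "\<lambda>h. - (inverse (f z) * L h * inverse (f z))"] conjI Deriv.has_derivative_inverse) auto
qed

lemma holomorphic_Cn_divide:
  assumes "holomorphic_Cn f D" "holomorphic_Cn g D" "\<And>z. z \<in> D \<Longrightarrow> g z \<noteq> 0"
  shows "holomorphic_Cn (\<lambda>z. f z / g z) D"
  using holomorphic_Cn_mult[OF assms(1) holomorphic_Cn_inverse[OF assms(2,3)]] by (simp add: divide_inverse)

lemma holomorphic_Cn_compose:
  fixes g :: "complex ^ 'm \<Rightarrow> complex ^ 'n"
  assumes f: "holomorphic_Cn f E"
    and g: "\<And>z. z \<in> D \<Longrightarrow> \<exists>K. (g has_derivative K) (at z) \<and> (\<forall>c v. K (c *s v) = c *s K v)"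
    and gD: "\<And>z. z \<in> D \<Longrightarrow> g z \<in> E"
  shows "holomorphic_Cn (\<lambda>z. f (g z)) D"
  unfolding holomorphic_Cn_def
proof
  fix z assume z: "z \<in> D"
  obtain K where K: "(g has_derivative K) (at z)" "\<And>c v. K (c *s v) = c *s K v"
    using g[OF z] by blast
  obtain L where L: "(f has_derivative L) (at (g z))" "\<And>c v. L (c *s v) = c * L v"
    using holomorphic_CnD[OF f gD[OF z]] by blast
  show "\<exists>L. ((\<lambda>z. f (g z)) has_derivative L) (at z) \<and> (\<forall>c v. L (c *s v) = c * L v)"
    by (intro exI[of _ "\<lambda>h. L (K h)"] conjI has_derivative_compose[OF K(1) L(1)]) (simp add: K L)
qed

lemma holomorphic_Cn_translate:
  assumes "holomorphic_Cn f D" "\<And>z. z \<in> E \<Longrightarrow> z + a \<in> D"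
  shows "holomorphic_Cn (\<lambda>z. f (z + a)) E"
proof (rule holomorphic_Cn_compose[OF assms(1)])
  show "\<exists>K. ((\<lambda>z. z + a) has_derivative K) (at z) \<and> (\<forall>c v. K (c *s v) = c *s K v)" for z
    by (intro exI[of _ "\<lambda>h. h"]) (auto intro!: derivative_eq_intros)
qed (rule assms(2))

lemma has_derivative_line: "((\<lambda>t. z + t *s v) has_derivative (\<lambda>s. s *s v)) (at t)" for v :: "complex ^ 'n"
proof -
  have "bounded_linear (\<lambda>s. s *s v)"
    by (rule bounded_linear_intro[where K = "norm v"])
       (auto simp: vector_sadd_rdistrib norm_vector_smult vec_eq_iff algebra_simps)
  then show ?thesis
    by (auto intro!: derivative_eq_intros bounded_linear_imp_has_derivative)
qed

lemma has_field_derivative_line: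
  fixes f :: "complex ^ 'n \<Rightarrow> complex"
  assumes "(f has_derivative L) (at (z + t *s v))" "\<And>c v. L (c *s v) = c * L v"
  shows "((\<lambda>t. f (z + t *s v)) has_field_derivative L v) (at t)"
  using has_derivative_compose[OF has_derivative_line assms(1)] assms(2)
  by (simp add: has_field_derivative_def mult_commute_abs)

lemma holomorphic_on_line:
  assumes "holomorphic_Cn f D" "\<And>t. t \<in> S \<Longrightarrow> z + t *s v \<in> D"
  shows "(\<lambda>t. f (z + t *s v)) holomorphic_on S"
  unfolding holomorphic_on_def field_differentiable_def
proof
  fix t assume "t \<in> S"
  then obtain L where "(f has_derivative L) (at (z + t *s v))" "\<And>c v. L (c *s v) = c * L v"
    using holomorphic_CnD[OF assms(1) assms(2)] by blast
  from has_field_derivative_line[OF this]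
  show "\<exists>d. ((\<lambda>t. f (z + t *s v)) has_field_derivative d) (at t within S)"
    by (blast intro: has_field_derivative_at_within)
qed

text \<open>
  The one-variable Cauchy estimate on the complex line in direction \<open>v\<close>. The factor 2 comes from
  halving the radius, which keeps the closed disc inside the open ball.
\<close>

lemma Cauchy_estimate_Cn:
  assumes f: "holomorphic_Cn f (ball z R)" and R: "0 < R"
    and B: "\<And>x. x \<in> ball z R \<Longrightarrow> cmod (f x) \<le> B"
    and L: "(f has_derivative L) (at z)" "\<And>c v. L (c *s v) = c * L v"
  shows "cmod (L v) \<le> 2 * B / R * norm v"
proof (cases "v = 0")
  case True
  then show ?thesis using L(2)[of 0 0] by simp
next
  case False
  define r where "r = R / (2 * norm v)"
  have r: "0 < r" using False R by (simp add: r_def)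
  have in_ball: "z + t *s v \<in> ball z R" if "cmod t \<le> r" for t
  proof -
    have "cmod t * norm v \<le> r * norm v" using that by (intro mult_right_mono) auto
    also have "\<dots> < R" using False R by (simp add: r_def)
    finally show ?thesis by (simp add: dist_norm norm_vector_smult)
  qed
  define g where "g = (\<lambda>t. f (z + t *s v))"
  have hol: "g holomorphic_on cball 0 r"
    unfolding g_def by (rule holomorphic_on_line[OF f]) (use in_ball in auto)
  have "cmod ((deriv ^^ 1) g 0) \<le> fact 1 * B / r ^ 1"
  proof (rule Cauchy_inequality)
    show "g holomorphic_on ball 0 r" using hol holomorphic_on_subset by force
    show "continuous_on (cball 0 r) g" using hol by (rule holomorphic_on_imp_continuous_on)
  qed (use r in \<open>auto simp: g_def intro!: B in_ball\<close>)
  moreover have "deriv g 0 = L v"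
    unfolding g_def by (rule DERIV_imp_deriv, rule has_field_derivative_line) (use L in auto)
  ultimately show ?thesis by (simp add: r_def field_simps)
qed

text \<open>
  The theorem of Weierstrass: the derivatives converge uniformly along with the functions, and
  complex linearity passes to the limit.
\<close>

lemma holomorphic_Cn_uniform_limit:
  fixes f :: "nat \<Rightarrow> complex ^ 'n \<Rightarrow> complex"
  assumes f: "\<And>n. holomorphic_Cn (f n) D"
    and lim: "\<And>z. z \<in> D \<Longrightarrow> \<exists>r>0. ball z r \<subseteq> D \<and> uniform_limit (ball z r) f g sequentially"
  shows "holomorphic_Cn g D"
  unfolding holomorphic_Cn_def
proof
  fix z assume "z \<in> D"
  then obtain r where r: "0 < r" "ball z r \<subseteq> D" and ul: "uniform_limit (ball z r) f g sequentially"
    using lim by blast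
  define S where "S = ball z (r/2)"
  have S: "open S" "convex S" "z \<in> S" using r by (auto simp: S_def)
  have SD: "S \<subseteq> D" using r ball_subset_ball_iff[of z "r/2" z r] by (auto simp: S_def)
  have "\<forall>n. \<forall>x\<in>S. \<exists>L. (f n has_derivative L) (at x) \<and> (\<forall>c v. L (c *s v) = c * L v)"
    using f SD unfolding holomorphic_Cn_def by blast
  then obtain f' where f': "\<And>n x. x \<in> S \<Longrightarrow> (f n has_derivative f' n x) (at x)"
    "\<And>n x c v. x \<in> S \<Longrightarrow> f' n x (c *s v) = c * f' n x v"
    by metis
  (* Cauchy's estimate turns uniform closeness of the functions into closeness of the derivatives. *)
  have cauchy: "\<exists>N. \<forall>m\<ge>N. \<forall>n\<ge>N. \<forall>x\<in>S. \<forall>h. cmod (f' n x h - f' m x h) \<le> e * norm h" if e: "0 < e" for e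
  proof -
    define d where "d = e * r / 8"
    have d: "0 < d" using e r by (simp add: d_def)
    obtain N where N: "\<And>n x. n \<ge> N \<Longrightarrow> x \<in> ball z r \<Longrightarrow> dist (f n x) (g x) < d"
      using uniform_limitD[OF ul d] unfolding eventually_sequentially by blast
    have "cmod (f' n x h - f' m x h) \<le> e * norm h" if mn: "m \<ge> N" "n \<ge> N" and x: "x \<in> S" for m n x h
    proof -
      have sub: "ball x (r/2) \<subseteq> ball z r"
      proof
        fix y assume "y \<in> ball x (r/2)"
        then show "y \<in> ball z r" using x dist_triangle[of z y x] by (auto simp: S_def dist_commute)
      qed
      have "cmod (f' n x h - f' m x h) \<le> 2 * (2 * d) / (r/2) * norm h"
      proof (rule Cauchy_estimate_Cn[where f = "\<lambda>y. f n y - f m y" and z = x])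
        show "holomorphic_Cn (\<lambda>y. f n y - f m y) (ball x (r/2))"
          by (intro holomorphic_Cn_diff holomorphic_Cn_subset[OF f]) (use sub r in auto)
        show "cmod (f n y - f m y) \<le> 2 * d" if "y \<in> ball x (r/2)" for y
          using N[OF mn(1), of y] N[OF mn(2), of y] sub that dist_triangle2[of "f n y" "f m y" "g y"]
          by (auto simp: dist_norm)
        show "((\<lambda>y. f n y - f m y) has_derivative (\<lambda>h. f' n x h - f' m x h)) (at x)"
          by (intro has_derivative_diff f' x)
      qed (use r x in \<open>auto simp: f' algebra_simps\<close>)
      also have "\<dots> = e * norm h" using r by (simp add: d_def)
      finally show ?thesis .
    qed
    then show ?thesis by blast
  qed
  have conv: "convergent (\<lambda>n. f' n x h)" if "x \<in> S" for x h
  proof -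
    have "Cauchy (\<lambda>n. f' n x h)"
    proof (rule metric_CauchyI)
      fix e :: real assume e: "0 < e"
      define e' where "e' = e / (norm h + 1)"
      have e': "0 < e'" "e' * norm h < e" using e by (auto simp: e'_def field_simps add_pos_nonneg)
      obtain N where N: "\<forall>m\<ge>N. \<forall>n\<ge>N. \<forall>x\<in>S. \<forall>h. cmod (f' n x h - f' m x h) \<le> e' * norm h"
        using cauchy[OF e'(1)] by blast
      have "dist (f' m x h) (f' n x h) < e" if "m \<ge> N" "n \<ge> N" for m n
      proof -
        have "cmod (f' m x h - f' n x h) \<le> e' * norm h" using N that \<open>x \<in> S\<close> by blast
        then show ?thesis using e'(2) by (simp add: dist_norm)
      qed
      then show "\<exists>N. \<forall>m\<ge>N. \<forall>n\<ge>N. dist (f' m x h) (f' n x h) < e" by blast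
    qed
    then show ?thesis by (simp add: Cauchy_convergent_iff)
  qed
  define g' where "g' = (\<lambda>x h. lim (\<lambda>n. f' n x h))"
  have lim': "(\<lambda>n. f' n x h) \<longlonglongrightarrow> g' x h" if "x \<in> S" for x h
    using conv[OF that] by (simp add: g'_def convergent_LIMSEQ_iff)
  have "\<exists>k. \<forall>x\<in>S. (\<lambda>n. f n x) \<longlonglongrightarrow> k x \<and> (k has_derivative g' x) (at x within S)"
  proof (rule has_derivative_sequence[OF S(2)])
    show "(f n has_derivative f' n x) (at x within S)" if "x \<in> S" for n x
      using f'(1)[OF that] by (rule has_derivative_at_withinI)
    show "\<forall>\<^sub>F n in sequentially. \<forall>x\<in>S. \<forall>h. cmod (f' n x h - g' x h) \<le> e * norm h" if "0 < e" for e
    proof -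
      obtain N where N: "\<forall>m\<ge>N. \<forall>n\<ge>N. \<forall>x\<in>S. \<forall>h. cmod (f' n x h - f' m x h) \<le> e * norm h"
        using cauchy[OF \<open>0 < e\<close>] by blast
      have "cmod (f' n x h - g' x h) \<le> e * norm h" if "n \<ge> N" "x \<in> S" for n x h
      proof (rule tendsto_upperbound)
        show "(\<lambda>m. cmod (f' n x h - f' m x h)) \<longlonglongrightarrow> cmod (f' n x h - g' x h)"
          by (intro tendsto_intros lim' that)
        show "\<forall>\<^sub>F m in sequentially. cmod (f' n x h - f' m x h) \<le> e * norm h"
          using N that unfolding eventually_sequentially by blast
      qed simp
      then show ?thesis by (auto simp: eventually_sequentially)
    qed
    show "z \<in> S" by (rule S)
    show "(\<lambda>n. f n z) \<longlonglongrightarrow> g z" using tendsto_uniform_limitI[OF ul] r by auto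
  qed
  then obtain k where k: "\<And>x. x \<in> S \<Longrightarrow> (\<lambda>n. f n x) \<longlonglongrightarrow> k x"
    "\<And>x. x \<in> S \<Longrightarrow> (k has_derivative g' x) (at x within S)" by blast
  have "k x = g x" if "x \<in> S" for x
  proof -
    have "x \<in> ball z r" using that r by (auto simp: S_def)
    then show ?thesis using tendsto_uniform_limitI[OF ul] k(1)[OF that] LIMSEQ_unique by blast
  qed
  moreover have "(k has_derivative g' z) (at z)"
    using k(2)[OF S(3)] at_within_open[OF S(3) S(1)] by simp
  ultimately have "(g has_derivative g' z) (at z)"
    using has_derivative_transform_within_open S by blast
  moreover have "g' z (c *s v) = c * g' z v" for c v
  proof (rule LIMSEQ_unique)
    show "(\<lambda>n. f' n z (c *s v)) \<longlonglongrightarrow> g' z (c *s v)" by (rule lim'[OF S(3)])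
    show "(\<lambda>n. f' n z (c *s v)) \<longlonglongrightarrow> c * g' z v"
      using tendsto_mult_left[OF lim'[OF S(3)], of c v] f'(2)[OF S(3)] by simp
  qed
  ultimately show "\<exists>L. (g has_derivative L) (at z) \<and> (\<forall>c v. L (c *s v) = c * L v)" by blast
qed

text \<open>
  The hypothesis is a bound for the oscillation on intervals of length \<open>1 / n\<close>; the error is
  accumulated interval by interval.
\<close>

lemma Riemann_sum_error:
  fixes \<phi> :: "real \<Rightarrow> complex" and n :: nat
  assumes cont: "continuous_on {0..1} \<phi>" and n: "0 < n"
    and e: "\<And>x y. x \<in> {0..1} \<Longrightarrow> y \<in> {0..1} \<Longrightarrow> \<bar>x - y\<bar> \<le> 1 / n \<Longrightarrow> cmod (\<phi> x - \<phi> y) \<le> e"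
  shows "cmod ((\<Sum>k<n. \<phi> (real k / n) / n) - integral {0..1} \<phi>) \<le> e"
proof -
  have "cmod ((\<Sum>k<m. \<phi> (real k / n) / n) - integral {0..m / n} \<phi>) \<le> e * (m / n)" if "m \<le> n" for m
    using that
  proof (induction m)
    case 0
    show ?case by simp
  next
    case (Suc m)
    define a b where "a = real m / n" and "b = real (Suc m) / n"
    have ab: "0 \<le> a" "a \<le> b" "b \<le> 1" "b - a = 1 / n"
      using Suc.prems n by (auto simp: a_def b_def field_simps)
    have int: "\<phi> integrable_on {u..v}" if "0 \<le> u" "v \<le> 1" for u v
      by (rule integrable_continuous_real, rule continuous_on_subset[OF cont]) (use that in auto)
    have split: "integral {0..b} \<phi> = integral {0..a} \<phi> + integral {a..b} \<phi>"
      by (rule Henstock_Kurzweil_Integration.integral_combine[symmetric]) (use ab int in auto)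
    have "cmod (integral {a..b} (\<lambda>x. \<phi> x - \<phi> a)) \<le> e * (b - a)"
    proof (rule integral_bound)
      show "continuous_on {a..b} (\<lambda>x. \<phi> x - \<phi> a)"
        by (intro continuous_intros continuous_on_subset[OF cont]) (use ab in auto)
      show "cmod (\<phi> t - \<phi> a) \<le> e" if "t \<in> {a..b}" for t
        using that ab by (intro e) auto
    qed (use ab in auto)
    moreover have "integral {a..b} (\<lambda>x. \<phi> x - \<phi> a) = integral {a..b} \<phi> - \<phi> a / n"
    proof -
      have "integral {a..b} (\<lambda>x. \<phi> x - \<phi> a) = integral {a..b} \<phi> - integral {a..b} (\<lambda>x. \<phi> a)"
        by (rule Henstock_Kurzweil_Integration.integral_diff) (use ab int in auto)
      also have "integral {a..b} (\<lambda>x. \<phi> a) = \<phi> a / n"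
        using ab by (simp add: scaleR_conv_of_real)
      finally show ?thesis .
    qed
    ultimately have 1: "cmod (integral {a..b} \<phi> - \<phi> a / n) \<le> e / n" using ab by simp
    have 2: "cmod ((\<Sum>k<m. \<phi> (real k / n) / n) - integral {0..a} \<phi>) \<le> e * (m / n)"
      using Suc by (simp add: a_def)
    have "(\<Sum>k<Suc m. \<phi> (real k / n) / n) - integral {0..b} \<phi>
        = ((\<Sum>k<m. \<phi> (real k / n) / n) - integral {0..a} \<phi>) - (integral {a..b} \<phi> - \<phi> a / n)"
      by (simp add: split a_def)
    also have "cmod \<dots> \<le> e * (m / n) + e / n"
      using norm_triangle_ineq4 1 2 by (meson add_mono order_trans)
    also have "\<dots> = e * (real (Suc m) / n)" using n by (simp add: field_simps)
    finally show ?case by (simp only: b_def)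
  qed
  from this[of n] show ?thesis using n by simp
qed

text \<open>
  The mean is a uniform limit of Riemann sums, which are finite sums of translates of \<open>f\<close>.
\<close>

lemma holomorphic_Cn_circle_mean:
  fixes f :: "complex ^ 'n \<Rightarrow> complex"
  assumes f: "holomorphic_Cn f D"
    and D: "\<And>y s. y \<in> cball p \<epsilon> \<Longrightarrow> cmod s = r \<Longrightarrow> y + s *s v \<in> D" and "0 \<le> r"
  shows "holomorphic_Cn (\<lambda>y. integral {0..1} (\<lambda>x. f (y + circlepath 0 r x *s v))) (ball p \<epsilon>)"
proof -
  define H where "H = (\<lambda>(y, x). f (y + circlepath 0 r x *s v))"
  have circ: "cmod (circlepath 0 r x) = r" for x
    using \<open>0 \<le> r\<close> by (simp add: circlepath norm_mult)
  have contH: "continuous_on (cball p \<epsilon> \<times> {0..1}) H"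
    unfolding H_def case_prod_beta
  proof (rule continuous_on_compose2[OF holomorphic_Cn_continuous[OF f]])
    show "continuous_on (cball p \<epsilon> \<times> {0..1}) (\<lambda>w. fst w + circlepath 0 r (snd w) *s v)"
      unfolding circlepath by (intro continuous_intros)
  qed (use D circ in auto)
  have unif: "uniformly_continuous_on (cball p \<epsilon> \<times> {0..1}) H"
    by (intro compact_uniformly_continuous contH compact_Times) auto
  define F where "F = (\<lambda>n y. \<Sum>k<n. H (y, real k / n) / n)"
  show ?thesis
  proof (rule holomorphic_Cn_uniform_limit[where f = F])
    show "holomorphic_Cn (F n) (ball p \<epsilon>)" for n
      unfolding F_def divide_inverse
    proof (intro holomorphic_Cn_sum holomorphic_Cn_mult holomorphic_Cn_const)
      show "holomorphic_Cn (\<lambda>y. H (y, real k * inverse (real n))) (ball p \<epsilon>)" for k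
        unfolding H_def prod.case by (rule holomorphic_Cn_translate[OF f]) (use D circ in auto)
    qed
    fix z assume z: "z \<in> ball p \<epsilon>"
    then obtain \<rho> where \<rho>: "0 < \<rho>" "ball z \<rho> \<subseteq> ball p \<epsilon>"
      using open_ball open_contains_ball by metis
    have "uniform_limit (ball p \<epsilon>) F (\<lambda>y. integral {0..1} (\<lambda>x. f (y + circlepath 0 r x *s v))) sequentially"
    proof (rule uniform_limitI)
      fix e :: real assume e: "0 < e"
      obtain d where d: "0 < d" "\<And>a b. a \<in> cball p \<epsilon> \<times> {0..1} \<Longrightarrow> b \<in> cball p \<epsilon> \<times> {0..1} \<Longrightarrow> dist a b < d
          \<Longrightarrow> dist (H a) (H b) < e / 2"
        using uniformly_continuous_onE[OF unif, of "e/2"] e by (metis half_gt_zero)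
      obtain N :: nat where N: "1 / d < N" using reals_Archimedean2 by blast
      have "dist (F n y) (integral {0..1} (\<lambda>x. f (y + circlepath 0 r x *s v))) < e"
        if n: "n \<ge> Suc N" and y: "y \<in> ball p \<epsilon>" for n y
      proof -
        have nd: "1 / n < d"
        proof -
          have "1 / d < real n" using N n by linarith
          then show ?thesis using d(1) n by (simp add: field_simps)
        qed
        have "cmod ((\<Sum>k<n. H (y, real k / n) / n) - integral {0..1} (\<lambda>x. H (y, x))) \<le> e / 2"
        proof (rule Riemann_sum_error)
          show "continuous_on {0..1} (\<lambda>x. H (y, x))"
            by (rule continuous_on_compose2[OF contH]) (use y in \<open>auto intro!: continuous_intros\<close>)
          show "cmod (H (y, a) - H (y, b)) \<le> e / 2"
            if "a \<in> {0..1}" "b \<in> {0..1}" "\<bar>a - b\<bar> \<le> 1 / real n" for a b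
            using d(2)[of "(y, a)" "(y, b)"] that y nd by (auto simp: dist_Pair_Pair dist_norm)
        qed (use n in auto)
        then show ?thesis using e by (simp add: F_def H_def dist_norm)
      qed
      then show "\<forall>\<^sub>F n in sequentially. \<forall>y\<in>ball p \<epsilon>. dist (F n y) (integral {0..1} (\<lambda>x. f (y + circlepath 0 r x *s v))) < e"
        by (intro eventually_sequentiallyI[of "Suc N"] ballI)
    qed
    then show "\<exists>r'>0. ball z r' \<subseteq> ball p \<epsilon> \<and>
        uniform_limit (ball z r') F (\<lambda>y. integral {0..1} (\<lambda>x. f (y + circlepath 0 r x *s v))) sequentially"
      using \<rho> uniform_limit_on_subset by blast
  qed
qed

lemma holomorphic_circle_mean_value:
  assumes "g holomorphic_on cball 0 r" "0 < r"
  shows "((\<lambda>x. g (circlepath 0 r x)) has_integral g 0) {0..1}"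
proof -
  define c where "c = 2 * complex_of_real pi * \<i>"
  have c: "c \<noteq> 0" by (simp add: c_def)
  have "((\<lambda>u. g u / (u - 0)) has_contour_integral (c * g 0)) (circlepath 0 r)"
    unfolding c_def by (rule Cauchy_integral_circlepath_simple) (use assms in auto)
  then have "((\<lambda>x. g (circlepath 0 r x) / (circlepath 0 r x - 0) * vector_derivative (circlepath 0 r) (at x within {0..1}))
      has_integral (c * g 0)) {0..1}"
    unfolding has_contour_integral_def .
  then have "((\<lambda>x. c * g (circlepath 0 r x)) has_integral (c * g 0)) {0..1}"
  proof (rule has_integral_eq[rotated])
    fix x :: real assume x: "x \<in> {0..1}"
    have "vector_derivative (circlepath 0 r) (at x within {0..1}) = c * circlepath 0 r x"
      using x unfolding c_def by (subst vector_derivative_circlepath01) (auto simp: circlepath)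
    moreover have "circlepath 0 r x \<noteq> 0" using assms(2) by (simp add: circlepath)
    ultimately show "g (circlepath 0 r x) / (circlepath 0 r x - 0) * vector_derivative (circlepath 0 r) (at x within {0..1})
        = c * g (circlepath 0 r x)" by simp
  qed
  from has_integral_divide[OF this, of c] show ?thesis using c by simp
qed


section \<open>Mean value inequalities for square integrable functions\<close>

text \<open>
  A complex linear map scales volume by the squared modulus of its determinant. This covers both
  rotations of the coordinates by a common phase and the elements of a finite group.
\<close>

lemma distr_lborel_unimodular:
  fixes A :: "complex ^ 'n ^ 'n"
  assumes A: "cmod (det A) = 1"
  shows "distr lborel borel ((*v) A) = lborel"
proof (rule lborel_eqI[symmetric])
  have "invertible A" using A by (auto simp: invertible_det_nz)
  then obtain B where B: "A ** B = mat 1" "B ** A = mat 1" by (auto simp: invertible_def)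
  have AB: "A *v (B *v z) = z" "B *v (A *v z) = z" for z by (simp_all add: B matrix_vector_mul_assoc)
  have "det A * det B = 1" by (metis B(1) det_I det_mul)
  then have "cmod (det A) * cmod (det B) = 1" by (metis norm_mult norm_one)
  then have detB: "cmod (det B) = 1" using A by simp
  have cont: "continuous_on UNIV ((*v) A)" for A :: "complex ^ 'n ^ 'n"
    by (intro linear_continuous_on matrix_vector_mul_bounded_linear)
  have meas: "(*v) A \<in> borel \<rightarrow>\<^sub>M borel" for A :: "complex ^ 'n ^ 'n"
    by (rule borel_measurable_continuous_onI[OF cont])
  fix l u :: "complex ^ 'n" assume lu: "\<And>b. b \<in> Basis \<Longrightarrow> l \<bullet> b \<le> u \<bullet> b"
  have img: "(*v) A -` box l u = (*v) B ` box l u"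
  proof (rule equalityI; rule subsetI)
    show "z \<in> (*v) B ` box l u" if "z \<in> (*v) A -` box l u" for z
    proof (rule image_eqI)
      show "z = B *v (A *v z)" by (simp only: AB)
      show "A *v z \<in> box l u" using that by (rule vimageD)
    qed
    show "z \<in> (*v) A -` box l u" if "z \<in> (*v) B ` box l u" for z
      using that AB(1) by auto
  qed
  have borel: "(*v) A -` box l u \<in> sets borel" using measurable_sets[OF meas, of "box l u" A] by simp
  have "emeasure (distr lborel borel ((*v) A)) (box l u) = emeasure lborel ((*v) A -` box l u)"
    by (subst emeasure_distr) (auto simp: meas)
  also have "\<dots> = emeasure lborel ((*v) B ` box l u)" by (simp only: img)
  also have "\<dots> = (\<integral>\<^sup>+z\<in>box l u. ennreal ((cmod (det B))\<^sup>2) \<partial>lborel)"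
  proof (rule emeasure_injective_image)
    show "inj_on ((*v) B) (box l u)" by (rule inj_onI) (metis AB(1))
    show "(*v) B ` box l u \<in> sets borel" using borel by (simp only: img)
    show "((*v) B has_derivative (*v) B) (at z)" for z
      by (intro bounded_linear_imp_has_derivative matrix_vector_mul_bounded_linear)
  qed auto
  also have "\<dots> = emeasure lborel (box l u)" by (simp add: detB)
  also have "\<dots> = ennreal (\<Prod>b\<in>Basis. (u - l) \<bullet> b)" using lu by (rule emeasure_lborel_box)
  finally show "emeasure (distr lborel borel ((*v) A)) (box l u) = ennreal (\<Prod>b\<in>Basis. (u - l) \<bullet> b)" .
qed simp

lemma nn_integral_unimodular_smult:
  fixes k :: "complex ^ 'n \<Rightarrow> ennreal"
  assumes [measurable]: "k \<in> borel_measurable borel" and c: "cmod c = 1"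
  shows "(\<integral>\<^sup>+z. k (c *s z) \<partial>lborel) = (\<integral>\<^sup>+z. k z \<partial>lborel)"
proof -
  define A where "A = (mat c :: complex ^ 'n ^ 'n)"
  have "det A = (\<Prod>i\<in>(UNIV :: 'n set). A $ i $ i)" by (rule det_diagonal) (simp add: A_def mat_def)
  then have "cmod (det A) = 1" by (simp add: A_def mat_def c norm_power)
  note dist = distr_lborel_unimodular[OF this]
  have A: "A *v z = c *s z" for z
    by (auto simp: A_def mat_def matrix_vector_mult_def vec_eq_iff if_distrib[where f = "\<lambda>x. x * _"] cong: if_cong)
  have meas [measurable]: "(*v) A \<in> borel \<rightarrow>\<^sub>M borel"
    by (intro borel_measurable_continuous_onI linear_continuous_on matrix_vector_mul_bounded_linear)
  have "(\<integral>\<^sup>+z. k z \<partial>lborel) = (\<integral>\<^sup>+z. k z \<partial>distr lborel borel ((*v) A))" by (simp only: dist)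
  also have "\<dots> = (\<integral>\<^sup>+z. k (A *v z) \<partial>lborel)" by (subst nn_integral_distr) auto
  finally show ?thesis by (simp add: A)
qed

text \<open>
  The mean value property of \<open>f\<^sup>2\<close> on a complex line through \<open>w\<close>.
\<close>

lemma L2_mean_value_on_circles:
  fixes f :: "complex ^ 'n \<Rightarrow> complex"
  assumes f: "holomorphic_Cn f D" and D: "\<And>s. cmod s \<le> 1 \<Longrightarrow> w + s *s y \<in> D"
  shows "ennreal ((cmod (f w))\<^sup>2)
    \<le> (\<integral>\<^sup>+x\<in>{0..1}. ennreal ((cmod (f (w + circlepath 0 1 x *s y)))\<^sup>2) \<partial>lborel)"
proof -
  define g where "g = (\<lambda>s. (f (w + s *s y))\<^sup>2)"
  have hol: "g holomorphic_on cball 0 1"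
    unfolding g_def by (intro holomorphic_intros holomorphic_on_line[OF f]) (use D in auto)
  have int: "((\<lambda>x. g (circlepath 0 1 x)) has_integral g 0) {0..1}"
    by (rule holomorphic_circle_mean_value[OF hol]) simp
  have cont: "continuous_on {0..1} (\<lambda>x. g (circlepath 0 1 x))"
    by (rule continuous_on_compose2[OF holomorphic_on_imp_continuous_on[OF hol]])
       (auto simp: circlepath norm_mult intro!: continuous_intros)
  define I where "I = integral {0..1} (\<lambda>x. cmod (g (circlepath 0 1 x)))"
  have I: "((\<lambda>x. cmod (g (circlepath 0 1 x))) has_integral I) {0..1}"
    unfolding I_def by (intro integrable_integral integrable_continuous_real continuous_intros cont)
  have "cmod (g 0) \<le> I"
    unfolding I_def integral_unique[OF int, symmetric]
    by (rule Henstock_Kurzweil_Integration.integral_norm_bound_integral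
        [OF has_integral_integrable[OF int] has_integral_integrable[OF I]]) (rule order_refl)
  then have "ennreal (cmod (g 0)) \<le> ennreal I" by (rule ennreal_leI)
  also have "\<dots> = (\<integral>\<^sup>+x. ennreal (cmod (g (circlepath 0 1 x))) * indicator {0..1} x \<partial>lborel)"
    by (rule nn_integral_has_integral_lebesgue'[OF _ I, symmetric]) simp
  finally show ?thesis by (simp add: g_def norm_power)
qed

text \<open>
  Integrate the inequality for circles over all \<open>y\<close> in the ball and exchange the integrals: each
  rotation \<open>y \<mapsto> e\<^sup>i\<^sup>\<phi> y\<close> preserves the integral over the ball.
\<close>

lemma L2_mean_value_on_balls:
  fixes f :: "complex ^ 'n \<Rightarrow> complex"
  assumes f: "holomorphic_Cn f D" and D: "ball w R \<subseteq> D"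
  shows "emeasure lborel (ball (0 :: complex ^ 'n) R) * ennreal ((cmod (f w))\<^sup>2)
    \<le> (\<integral>\<^sup>+z\<in>ball w R. ennreal ((cmod (f z))\<^sup>2) \<partial>lborel)"
proof -
  define h where "h = (\<lambda>z. ennreal ((cmod (indicator (ball w R) z *\<^sub>R f z))\<^sup>2))"
  have "continuous_on (ball w R) f"
    using holomorphic_Cn_continuous[OF f] D continuous_on_subset by blast
  then have "(\<lambda>z. indicator (ball w R) z *\<^sub>R f z) \<in> borel_measurable borel"
    by (intro borel_measurable_continuous_on_indicator) auto
  then have [measurable]: "h \<in> borel_measurable borel" unfolding h_def by measurable
  define k where "k = (\<lambda>y. h (w + y))"
  have [measurable]: "k \<in> borel_measurable borel" unfolding k_def by measurable
  have [measurable]: "(\<lambda>p :: (complex ^ 'n) \<times> real. circlepath 0 1 (snd p) *s fst p) \<in> borel \<Otimes>\<^sub>M borel \<rightarrow>\<^sub>M borel"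
  proof -
    have "continuous_on UNIV (\<lambda>p :: (complex ^ 'n) \<times> real. circlepath 0 1 (snd p) *s fst p)"
      unfolding circlepath by (intro continuous_intros)
    from borel_measurable_continuous_onI[OF this] show ?thesis by (simp only: borel_prod)
  qed
  have k: "ennreal ((cmod (f (w + y)))\<^sup>2) = k y" if "norm y < R" for y
    using that by (simp add: k_def h_def dist_norm)
  have "emeasure lborel (ball (0 :: complex ^ 'n) R) * ennreal ((cmod (f w))\<^sup>2)
      = (\<integral>\<^sup>+y. ennreal ((cmod (f w))\<^sup>2) * indicator (ball (0 :: complex ^ 'n) R) y \<partial>lborel)"
    by (subst nn_integral_cmult_indicator) (auto simp: mult.commute)
  also have "\<dots> \<le> (\<integral>\<^sup>+y. \<integral>\<^sup>+x. k (circlepath 0 1 x *s y) * indicator {0..1} x \<partial>lborel \<partial>lborel)"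
  proof (rule nn_integral_mono)
    fix y :: "complex ^ 'n"
    show "ennreal ((cmod (f w))\<^sup>2) * indicator (ball 0 R) y
        \<le> (\<integral>\<^sup>+x. k (circlepath 0 1 x *s y) * indicator {0..1} x \<partial>lborel)"
    proof (cases "norm y < R")
      case True
      have in_ball: "norm (s *s y) < R" if "cmod s \<le> 1" for s
        using that True mult_right_mono[OF that, of "norm y"] by (simp add: norm_vector_smult)
      have "ennreal ((cmod (f w))\<^sup>2)
        \<le> (\<integral>\<^sup>+x\<in>{0..1}. ennreal ((cmod (f (w + circlepath 0 1 x *s y)))\<^sup>2) \<partial>lborel)"
        by (rule L2_mean_value_on_circles[OF f]) (use in_ball D in \<open>auto simp: dist_norm subset_iff\<close>)
      also have "\<dots> = (\<integral>\<^sup>+x. k (circlepath 0 1 x *s y) * indicator {0..1} x \<partial>lborel)"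
        by (intro nn_integral_cong) (auto simp: k in_ball circlepath norm_mult split: split_indicator)
      finally show ?thesis using True by simp
    qed simp
  qed
  also have "\<dots> = (\<integral>\<^sup>+x. \<integral>\<^sup>+y. k (circlepath 0 1 x *s y) * indicator {0..1} x \<partial>lborel \<partial>lborel)"
    by (rule lborel_pair.Fubini'[symmetric]) measurable
  also have "\<dots> = (\<integral>\<^sup>+x. (\<integral>\<^sup>+y. k y \<partial>lborel) * indicator {0..1::real} x \<partial>lborel)"
  proof (rule nn_integral_cong)
    fix x :: real
    have [measurable]: "(\<lambda>y. k (circlepath 0 1 x *s y)) \<in> borel_measurable borel"
    proof -
      have "(\<lambda>y :: complex ^ 'n. circlepath 0 1 x *s y) \<in> borel \<rightarrow>\<^sub>M borel"
        by (intro borel_measurable_continuous_onI continuous_intros)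
      then show ?thesis by measurable
    qed
    have "(\<integral>\<^sup>+y. k (circlepath 0 1 x *s y) * indicator {0..1} x \<partial>lborel)
        = (\<integral>\<^sup>+y. k (circlepath 0 1 x *s y) \<partial>lborel) * indicator {0..1} x"
      by (rule nn_integral_multc) measurable
    also have "(\<integral>\<^sup>+y. k (circlepath 0 1 x *s y) \<partial>lborel) = (\<integral>\<^sup>+y. k y \<partial>lborel)"
      by (rule nn_integral_unimodular_smult) (auto simp: circlepath norm_mult)
    finally show "(\<integral>\<^sup>+y. k (circlepath 0 1 x *s y) * indicator {0..1} x \<partial>lborel)
        = (\<integral>\<^sup>+y. k y \<partial>lborel) * indicator {0..1} x" .
  qed
  also have "\<dots> = (\<integral>\<^sup>+y. k y \<partial>lborel)"
    by (simp add: nn_integral_cmult_indicator)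
  also have "\<dots> = (\<integral>\<^sup>+z. h z \<partial>lborel)"
    unfolding k_def by (subst (2) lborel_distr_plus[symmetric, of w], subst nn_integral_distr) auto
  also have "\<dots> = (\<integral>\<^sup>+z\<in>ball w R. ennreal ((cmod (f z))\<^sup>2) \<partial>lborel)"
    unfolding h_def by (intro nn_integral_cong) (auto split: split_indicator)
  finally show ?thesis .
qed

text \<open>
  Point evaluations are bounded in the weighted \<open>L\<^sup>2\<close> norm, locally uniformly in the point, because
  the weight has a positive minimum on a closed ball. The bound is stated for extended integrals so
  that it can also be used for functions of infinite norm.
\<close>

lemma bergman_local_bound:
  fixes \<nu> :: "complex ^ 'n \<Rightarrow> real"
  assumes D: "open D" "w \<in> D" and \<nu>: "continuous_on D \<nu>" "\<And>z. z \<in> D \<Longrightarrow> 0 < \<nu> z"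
  obtains r c where "0 < r" "0 < c" "ball w r \<subseteq> D"
    "\<And>f z. holomorphic_Cn f D \<Longrightarrow> z \<in> ball w r \<Longrightarrow>
       ennreal (c * (cmod (f z))\<^sup>2) \<le> (\<integral>\<^sup>+z\<in>D. ennreal ((cmod (f z))\<^sup>2 * \<nu> z) \<partial>lborel)"
proof -
  obtain R where R: "0 < R" "cball w R \<subseteq> D" using D open_contains_cball by blast
  define r where "r = R / 2"
  have r: "0 < r" "r + r = R" using R by (auto simp: r_def)
  have "compact (\<nu> ` cball w R)" "\<nu> ` cball w R \<noteq> {}"
    using R by (auto intro!: compact_continuous_image continuous_on_subset[OF \<nu>(1)])
  then have "\<exists>m\<in>\<nu> ` cball w R. \<forall>t\<in>\<nu> ` cball w R. m \<le> t" by (rule compact_attains_inf)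
  then obtain m where m: "m \<in> \<nu> ` cball w R" "\<forall>t\<in>\<nu> ` cball w R. m \<le> t" by blast
  have m0: "0 < m"
  proof -
    obtain x where "x \<in> cball w R" "m = \<nu> x" using m(1) by blast
    then show ?thesis using \<nu>(2)[of x] R(2) by blast
  qed
  define v where "v = measure lborel (ball (0 :: complex ^ 'n) r)"
  have v: "emeasure lborel (ball (0 :: complex ^ 'n) r) = ennreal v"
  proof -
    have "emeasure lborel (ball (0 :: complex ^ 'n) r) < \<infinity>" by (rule emeasure_bounded_finite) simp
    then have "emeasure lborel (ball (0 :: complex ^ 'n) r) \<noteq> \<infinity>" by (rule less_imp_neq)
    then show ?thesis unfolding v_def infinity_ennreal_def by (rule emeasure_eq_ennreal_measure)
  qed
  have v0: "0 < v"
    unfolding v_def by (rule content_ball_pos) (rule r)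
  have bound: "ennreal ((m * v) * (cmod (f z))\<^sup>2) \<le> (\<integral>\<^sup>+z\<in>D. ennreal ((cmod (f z))\<^sup>2 * \<nu> z) \<partial>lborel)"
    if f: "holomorphic_Cn f D" and z: "z \<in> ball w r" for f z
  proof -
    have sub: "ball z r \<subseteq> cball w R"
    proof
      fix y assume "y \<in> ball z r"
      then show "y \<in> cball w R" using z r dist_triangle[of w y z] by auto
    qed
    then have zD: "ball z r \<subseteq> D" using R by blast
    have "continuous_on (ball z r) f"
      using holomorphic_Cn_continuous[OF f] zD continuous_on_subset by blast
    then have "(\<lambda>y. indicator (ball z r) y *\<^sub>R f y) \<in> borel_measurable borel"
      by (intro borel_measurable_continuous_on_indicator) auto
    then have [measurable]: "(\<lambda>y. ennreal ((cmod (indicator (ball z r) y *\<^sub>R f y))\<^sup>2)) \<in> borel_measurable borel"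
      by measurable
    have "(\<lambda>y. ennreal ((cmod (f y))\<^sup>2) * indicator (ball z r) y) = (\<lambda>y. ennreal ((cmod (indicator (ball z r) y *\<^sub>R f y))\<^sup>2))"
      by (auto split: split_indicator)
    then have meas: "(\<lambda>y. ennreal ((cmod (f y))\<^sup>2) * indicator (ball z r) y) \<in> borel_measurable borel"
      by (simp only:) measurable
    have "ennreal ((m * v) * (cmod (f z))\<^sup>2) = ennreal m * (ennreal v * ennreal ((cmod (f z))\<^sup>2))"
      using m0 v0 by (simp add: ennreal_mult mult.assoc)
    also have "\<dots> \<le> ennreal m * (\<integral>\<^sup>+y\<in>ball z r. ennreal ((cmod (f y))\<^sup>2) \<partial>lborel)"
      using L2_mean_value_on_balls[OF f zD] by (intro mult_left_mono) (auto simp: v)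
    also have "\<dots> = (\<integral>\<^sup>+y. ennreal m * (ennreal ((cmod (f y))\<^sup>2) * indicator (ball z r) y) \<partial>lborel)"
      by (rule nn_integral_cmult[symmetric]) (simp add: meas)
    also have "\<dots> \<le> (\<integral>\<^sup>+z\<in>D. ennreal ((cmod (f z))\<^sup>2 * \<nu> z) \<partial>lborel)"
    proof (rule nn_integral_mono)
      fix y
      have "ennreal m * ennreal ((cmod (f y))\<^sup>2) \<le> ennreal ((cmod (f y))\<^sup>2 * \<nu> y)" if "y \<in> ball z r"
      proof -
        have "m \<le> \<nu> y" using m(2) sub that by blast
        then have "(cmod (f y))\<^sup>2 * m \<le> (cmod (f y))\<^sup>2 * \<nu> y" by (intro mult_left_mono) auto
        then show ?thesis using m0 by (simp add: ennreal_mult[symmetric] mult.commute ennreal_leI)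
      qed
      then show "ennreal m * (ennreal ((cmod (f y))\<^sup>2) * indicator (ball z r) y)
          \<le> ennreal ((cmod (f y))\<^sup>2 * \<nu> y) * indicator D y"
        using zD by (auto split: split_indicator)
    qed
    finally show ?thesis .
  qed
  have "ball w r \<subseteq> cball w R" using r by (auto simp: subset_iff)
  then have "ball w r \<subseteq> D" using R by blast
  then show ?thesis by (rule that[OF r(1) mult_pos_pos[OF m0 v0] _ bound])
qed


section \<open>Existence of Bergman kernels\<close>

lemma set_borel_measurable_continuous:
  fixes f :: "'a::euclidean_space \<Rightarrow> 'b::{banach, second_countable_topology}"
  assumes "open D" "continuous_on D f"
  shows "(\<lambda>z. indicator D z *\<^sub>R f z) \<in> borel_measurable borel"
  using assms by (intro borel_measurable_continuous_on_indicator) auto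

lemma bergman_space_iff:
  assumes D: "open D" and \<nu>: "continuous_on D \<nu>" "\<And>z. z \<in> D \<Longrightarrow> 0 < \<nu> z"
  shows "f \<in> bergman_space lborel D \<nu> \<longleftrightarrow>
    holomorphic_Cn f D \<and> (\<integral>\<^sup>+z\<in>D. ennreal ((cmod (f z))\<^sup>2 * \<nu> z) \<partial>lborel) < \<infinity>"
proof -
  have "set_integrable lborel D (\<lambda>z. (cmod (f z))\<^sup>2 * \<nu> z) \<longleftrightarrow>
      (\<integral>\<^sup>+z\<in>D. ennreal ((cmod (f z))\<^sup>2 * \<nu> z) \<partial>lborel) < \<infinity>" if f: "holomorphic_Cn f D"
  proof -
    have "(\<lambda>z. indicator D z *\<^sub>R ((cmod (f z))\<^sup>2 * \<nu> z)) \<in> borel_measurable lborel"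
      unfolding measurable_cong_sets[OF sets_lborel refl]
      by (intro set_borel_measurable_continuous D continuous_intros holomorphic_Cn_continuous[OF f] \<nu>(1))
    moreover have "(\<integral>\<^sup>+z. ennreal (norm (indicator D z *\<^sub>R ((cmod (f z))\<^sup>2 * \<nu> z))) \<partial>lborel)
        = (\<integral>\<^sup>+z\<in>D. ennreal ((cmod (f z))\<^sup>2 * \<nu> z) \<partial>lborel)"
      using \<nu>(2) by (intro nn_integral_cong) (auto split: split_indicator simp: abs_mult less_imp_le)
    ultimately show ?thesis unfolding set_integrable_def integrable_iff_bounded by simp
  qed
  then show ?thesis by (auto simp: bergman_space_def)
qed

definition bergman_norm2 :: "(complex ^ 'n) set \<Rightarrow> (complex ^ 'n \<Rightarrow> real) \<Rightarrow> (complex ^ 'n \<Rightarrow> complex) \<Rightarrow> real" where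
  "bergman_norm2 D \<nu> f = (LINT z:D|lborel. (cmod (f z))\<^sup>2 * \<nu> z)"

lemma cmod_add_square: "(cmod (a + b))\<^sup>2 = (cmod a)\<^sup>2 + 2 * Re (a * cnj b) + (cmod b)\<^sup>2"
  unfolding cmod_power2 by (simp add: power2_eq_square algebra_simps)

lemma bergman_inner_cmult_right:
  "bergman_inner V D \<nu> f (\<lambda>z. c * g z) = cnj c * bergman_inner V D \<nu> f g"
proof -
  have "bergman_inner V D \<nu> f (\<lambda>z. c * g z) = (LINT z:D|V. cnj c * (f z * cnj (g z) * complex_of_real (\<nu> z)))"
    unfolding bergman_inner_def by (simp add: mult_ac)
  then show ?thesis by (simp add: bergman_inner_def)
qed

lemma bergman_inner_cmult_left:
  "bergman_inner V D \<nu> (\<lambda>z. c * f z) g = c * bergman_inner V D \<nu> f g"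
  unfolding bergman_inner_def by (simp add: mult.assoc)

lemma bergman_inner_cnj:
  "cnj (bergman_inner V D \<nu> f g) = bergman_inner V D \<nu> g f"
  unfolding bergman_inner_def set_lebesgue_integral_def
  by (subst Bochner_Integration.integral_cnj[symmetric], intro Bochner_Integration.integral_cong) (auto simp: mult_ac)

lemma bergman_inner_self: "bergman_inner lborel D \<nu> f f = complex_of_real (bergman_norm2 D \<nu> f)"
proof -
  have eq: "f z * cnj (f z) * complex_of_real (\<nu> z) = complex_of_real ((cmod (f z))\<^sup>2 * \<nu> z)" for z
    by (simp only: complex_norm_square of_real_mult)
  show ?thesis unfolding bergman_inner_def bergman_norm2_def eq
    by (rule set_integral_complex_of_real)
qed

lemma bergman_norm2_cmult: "bergman_norm2 D \<nu> (\<lambda>z. c * f z) = (cmod c)\<^sup>2 * bergman_norm2 D \<nu> f"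
  unfolding bergman_norm2_def by (simp add: norm_mult power_mult_distrib mult.assoc)

context
  fixes D :: "(complex ^ 'n) set" and \<nu> :: "complex ^ 'n \<Rightarrow> real"
  assumes D: "open D" and \<nu>: "continuous_on D \<nu>" and \<nu>_pos: "\<And>z. z \<in> D \<Longrightarrow> 0 < \<nu> z"
begin

lemma bergman_spaceD:
  assumes "f \<in> bergman_space lborel D \<nu>"
  shows "holomorphic_Cn f D" "set_integrable lborel D (\<lambda>z. (cmod (f z))\<^sup>2 * \<nu> z)"
  using assms by (auto simp: bergman_space_def)

lemma bergman_product_integrable:
  assumes f: "f \<in> bergman_space lborel D \<nu>" and g: "g \<in> bergman_space lborel D \<nu>"
  shows "set_integrable lborel D (\<lambda>z. f z * cnj (g z) * complex_of_real (\<nu> z))"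
proof -
  have int: "set_integrable lborel D (\<lambda>z. (cmod (f z))\<^sup>2 * \<nu> z + (cmod (g z))\<^sup>2 * \<nu> z)"
    by (intro set_integral_add bergman_spaceD f g)
  show ?thesis
    unfolding set_integrable_def
  proof (rule Bochner_Integration.integrable_bound[OF int[unfolded set_integrable_def]])
    show "(\<lambda>z. indicat_real D z *\<^sub>R (f z * cnj (g z) * complex_of_real (\<nu> z))) \<in> borel_measurable lborel"
      unfolding measurable_cong_sets[OF sets_lborel refl]
      by (intro set_borel_measurable_continuous D continuous_intros holomorphic_Cn_continuous bergman_spaceD(1) f g \<nu>)
    have "cmod (f z * cnj (g z) * complex_of_real (\<nu> z)) \<le> (cmod (f z))\<^sup>2 * \<nu> z + (cmod (g z))\<^sup>2 * \<nu> z"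
      if "z \<in> D" for z
    proof -
      have "2 * (cmod (f z) * cmod (g z)) \<le> (cmod (f z))\<^sup>2 + (cmod (g z))\<^sup>2"
        using sum_squares_bound[of "cmod (f z)" "cmod (g z)"] by simp
      moreover have "0 \<le> cmod (f z) * cmod (g z)" by simp
      ultimately have "cmod (f z) * cmod (g z) \<le> (cmod (f z))\<^sup>2 + (cmod (g z))\<^sup>2" by linarith
      then have "cmod (f z) * cmod (g z) * \<nu> z \<le> ((cmod (f z))\<^sup>2 + (cmod (g z))\<^sup>2) * \<nu> z"
        using \<nu>_pos[OF that] by (intro mult_right_mono) auto
      then show ?thesis using \<nu>_pos[OF that] by (simp add: norm_mult algebra_simps)
    qed
    then show "AE z in lborel. norm (indicat_real D z *\<^sub>R (f z * cnj (g z) * complex_of_real (\<nu> z)))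
        \<le> norm (indicat_real D z *\<^sub>R ((cmod (f z))\<^sup>2 * \<nu> z + (cmod (g z))\<^sup>2 * \<nu> z))"
      by (intro AE_I2) (fastforce split: split_indicator)
  qed
qed

lemma bergman_space_cmult:
  assumes f: "f \<in> bergman_space lborel D \<nu>"
  shows "(\<lambda>z. c * f z) \<in> bergman_space lborel D \<nu>"
proof -
  have "set_integrable lborel D (\<lambda>z. (cmod c)\<^sup>2 * ((cmod (f z))\<^sup>2 * \<nu> z))"
    using bergman_spaceD(2)[OF f] by simp
  then show ?thesis
    using holomorphic_Cn_cmult[OF bergman_spaceD(1)[OF f]]
    by (simp add: bergman_space_def norm_mult power_mult_distrib mult.assoc)
qed

lemma bergman_space_add:
  assumes f: "f \<in> bergman_space lborel D \<nu>" and g: "g \<in> bergman_space lborel D \<nu>"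
  shows "(\<lambda>z. f z + g z) \<in> bergman_space lborel D \<nu>"
    and "bergman_norm2 D \<nu> (\<lambda>z. f z + g z)
      = bergman_norm2 D \<nu> f + 2 * Re (bergman_inner lborel D \<nu> f g) + bergman_norm2 D \<nu> g"
proof -
  have int: "set_integrable lborel D (\<lambda>z. Re (f z * cnj (g z) * complex_of_real (\<nu> z)))"
    using integrable_Re[OF bergman_product_integrable[OF f g, unfolded set_integrable_def]]
    by (simp add: set_integrable_def)
  have Re: "(LINT z:D|lborel. Re (f z * cnj (g z) * complex_of_real (\<nu> z))) = Re (bergman_inner lborel D \<nu> f g)"
    using integral_Re[OF bergman_product_integrable[OF f g, unfolded set_integrable_def]]
    by (simp add: set_lebesgue_integral_def bergman_inner_def)
  have eq: "(cmod (f z + g z))\<^sup>2 * \<nu> z = (cmod (f z))\<^sup>2 * \<nu> z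
      + 2 * Re (f z * cnj (g z) * complex_of_real (\<nu> z)) + (cmod (g z))\<^sup>2 * \<nu> z" for z
    by (simp add: cmod_add_square algebra_simps)
  note ints = bergman_spaceD(2)[OF f] bergman_spaceD(2)[OF g] int
  have i1: "set_integrable lborel D (\<lambda>z. (cmod (f z))\<^sup>2 * \<nu> z
      + 2 * Re (f z * cnj (g z) * complex_of_real (\<nu> z)))"
    by (intro set_integral_add ints set_integrable_mult_right)
  have "set_integrable lborel D (\<lambda>z. (cmod (f z + g z))\<^sup>2 * \<nu> z)"
    unfolding eq by (intro set_integral_add i1 ints)
  then show "(\<lambda>z. f z + g z) \<in> bergman_space lborel D \<nu>"
    using holomorphic_Cn_add[OF bergman_spaceD(1)[OF f] bergman_spaceD(1)[OF g]] by (simp add: bergman_space_def)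
  show "bergman_norm2 D \<nu> (\<lambda>z. f z + g z)
      = bergman_norm2 D \<nu> f + 2 * Re (bergman_inner lborel D \<nu> f g) + bergman_norm2 D \<nu> g"
    unfolding bergman_norm2_def eq
    by (simp only: set_integral_add(2)[OF i1 ints(2)] set_integral_add(2)[OF ints(1) set_integrable_mult_right[OF ints(3)]]
        set_integral_mult_right Re)
qed

lemma bergman_inner_add_left:
  assumes "f \<in> bergman_space lborel D \<nu>" "g \<in> bergman_space lborel D \<nu>" "h \<in> bergman_space lborel D \<nu>"
  shows "bergman_inner lborel D \<nu> (\<lambda>z. f z + g z) h = bergman_inner lborel D \<nu> f h + bergman_inner lborel D \<nu> g h"
  unfolding bergman_inner_def distrib_right
  by (rule set_integral_add) (intro bergman_product_integrable assms)+

lemma bergman_inner_add_right: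
  assumes "f \<in> bergman_space lborel D \<nu>" "g \<in> bergman_space lborel D \<nu>" "h \<in> bergman_space lborel D \<nu>"
  shows "bergman_inner lborel D \<nu> f (\<lambda>z. g z + h z) = bergman_inner lborel D \<nu> f g + bergman_inner lborel D \<nu> f h"
  using arg_cong[OF bergman_inner_add_left[OF assms(2,3,1)], of cnj] by (simp add: bergman_inner_cnj)

lemma bergman_norm2_nonneg: "0 \<le> bergman_norm2 D \<nu> f"
  unfolding bergman_norm2_def set_lebesgue_integral_def
  by (rule Bochner_Integration.integral_nonneg) (auto split: split_indicator simp: less_imp_le[OF \<nu>_pos])

lemma nn_integral_bergman_norm2:
  assumes "f \<in> bergman_space lborel D \<nu>"
  shows "(\<integral>\<^sup>+z\<in>D. ennreal ((cmod (f z))\<^sup>2 * \<nu> z) \<partial>lborel) = ennreal (bergman_norm2 D \<nu> f)"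
proof -
  have "(\<integral>\<^sup>+z. ennreal (indicator D z *\<^sub>R ((cmod (f z))\<^sup>2 * \<nu> z)) \<partial>lborel) = ennreal (bergman_norm2 D \<nu> f)"
    unfolding bergman_norm2_def set_lebesgue_integral_def
    by (rule nn_integral_eq_integral)
       (use bergman_spaceD(2)[OF assms] in \<open>auto simp: set_integrable_def less_imp_le[OF \<nu>_pos] split: split_indicator\<close>)
  moreover have "(\<integral>\<^sup>+z. ennreal (indicator D z *\<^sub>R ((cmod (f z))\<^sup>2 * \<nu> z)) \<partial>lborel)
      = (\<integral>\<^sup>+z\<in>D. ennreal ((cmod (f z))\<^sup>2 * \<nu> z) \<partial>lborel)"
    by (intro nn_integral_cong) (auto split: split_indicator)
  ultimately show ?thesis by simp
qed

lemma bergman_evaluation_bound: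
  assumes "w \<in> D"
  obtains r c where "0 < r" "0 < c" "ball w r \<subseteq> D"
    "\<And>f z. f \<in> bergman_space lborel D \<nu> \<Longrightarrow> z \<in> ball w r \<Longrightarrow> c * (cmod (f z))\<^sup>2 \<le> bergman_norm2 D \<nu> f"
proof (rule bergman_local_bound[OF D assms \<nu> \<nu>_pos])
  fix r c
  assume rc: "0 < r" "0 < c" "ball w r \<subseteq> D"
    and b: "\<And>f z. holomorphic_Cn f D \<Longrightarrow> z \<in> ball w r \<Longrightarrow>
       ennreal (c * (cmod (f z))\<^sup>2) \<le> (\<integral>\<^sup>+z\<in>D. ennreal ((cmod (f z))\<^sup>2 * \<nu> z) \<partial>lborel)"
  show thesis
  proof (rule that[OF rc])
    fix f z assume f: "f \<in> bergman_space lborel D \<nu>" and "z \<in> ball w r"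
    then have "ennreal (c * (cmod (f z))\<^sup>2) \<le> ennreal (bergman_norm2 D \<nu> f)"
      using b[of f z] bergman_spaceD(1)[OF f] by (simp only: nn_integral_bergman_norm2)
    then show "c * (cmod (f z))\<^sup>2 \<le> bergman_norm2 D \<nu> f"
      by (simp add: bergman_norm2_nonneg ennreal_le_iff)
  qed
qed

lemma bergman_norm2_parallelogram:
  assumes f: "f \<in> bergman_space lborel D \<nu>" and g: "g \<in> bergman_space lborel D \<nu>"
  shows "bergman_norm2 D \<nu> (\<lambda>z. f z - g z) + bergman_norm2 D \<nu> (\<lambda>z. f z + g z)
    = 2 * bergman_norm2 D \<nu> f + 2 * bergman_norm2 D \<nu> g"
  using bergman_space_add(2)[OF f g] bergman_space_add(2)[OF f bergman_space_cmult[OF g, of "-1"]]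
    bergman_norm2_cmult[of D \<nu> "-1" g] bergman_inner_cmult_right[of lborel D \<nu> f "-1" g]
  by simp

text \<open>
  By the parallelogram law a sequence whose norms approach the infimum is a Cauchy sequence, hence
  converges locally uniformly by \<open>bergman_evaluation_bound\<close>. The limit is holomorphic, and Fatou's
  lemma shows that its norm is the infimum.
\<close>

lemma bergman_minimal_element:
  assumes w: "w \<in> D" and f: "f \<in> bergman_space lborel D \<nu>" "f w = 1"
  obtains g where "g \<in> bergman_space lborel D \<nu>" "g w = 1"
    "\<And>h. h \<in> bergman_space lborel D \<nu> \<Longrightarrow> h w = 1 \<Longrightarrow> bergman_norm2 D \<nu> g \<le> bergman_norm2 D \<nu> h"
proof -
  define H where "H = bergman_space lborel D \<nu>"
  define N where "N = bergman_norm2 D \<nu>"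
  define S where "S = {h \<in> H. h w = 1}"
  define m where "m = Inf (N ` S)"
  have ne: "N ` S \<noteq> {}" using f by (auto simp: S_def H_def)
  have bdd: "bdd_below (N ` S)" by (rule bdd_belowI[of _ 0]) (auto simp: N_def bergman_norm2_nonneg)
  have m_le: "m \<le> N h" if "h \<in> S" for h
    unfolding m_def by (rule cInf_lower) (use that bdd in auto)
  have "\<exists>h\<in>S. N h < m + inverse (real (Suc n))" for n
  proof -
    have "m < m + inverse (real (Suc n))" by simp
    then show ?thesis unfolding m_def using cInf_lessD[OF ne] by blast
  qed
  then obtain u where u: "\<And>n. u n \<in> S" "\<And>n. N (u n) < m + inverse (real (Suc n))" by metis
  have uH: "u n \<in> H" "u n w = 1" for n using u(1)[of n] by (auto simp: S_def)
  have close: "N (\<lambda>z. u n z - u k z) \<le> 2 * inverse (real (Suc n)) + 2 * inverse (real (Suc k))" for n k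
  proof -
    define a where "a = (\<lambda>z. (1/2) * (u n z + u k z))"
    have sum: "(\<lambda>z. u n z + u k z) \<in> H" using uH unfolding H_def by (intro bergman_space_add) auto
    then have "a \<in> S" using bergman_space_cmult[of _ "1/2"] uH by (auto simp: S_def a_def H_def)
    then have "m \<le> N a" by (rule m_le)
    also have "N a = N (\<lambda>z. u n z + u k z) / 4"
      unfolding N_def a_def bergman_norm2_cmult by (simp add: power2_eq_square)
    finally have "4 * m \<le> N (\<lambda>z. u n z + u k z)" by simp
    moreover have "N (\<lambda>z. u n z - u k z) + N (\<lambda>z. u n z + u k z) = 2 * N (u n) + 2 * N (u k)"
      unfolding N_def using uH by (intro bergman_norm2_parallelogram) (auto simp: H_def)
    ultimately show ?thesis using u(2)[of n] u(2)[of k] by linarith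
  qed
  have diffH: "(\<lambda>z. u n z - u k z) \<in> H" for n k
    using bergman_space_add(1)[of "u n" "\<lambda>z. -1 * u k z"] bergman_space_cmult[of "u k" "-1"] uH
    by (simp add: H_def)
  define g where "g = (\<lambda>z. lim (\<lambda>n. u n z))"
  have ulim: "\<exists>r>0. ball z r \<subseteq> D \<and> uniform_limit (ball z r) u g sequentially" if z: "z \<in> D" for z
  proof -
    obtain r c where rc: "0 < r" "0 < c" "ball z r \<subseteq> D"
      "\<And>f y. f \<in> bergman_space lborel D \<nu> \<Longrightarrow> y \<in> ball z r \<Longrightarrow> c * (cmod (f y))\<^sup>2 \<le> bergman_norm2 D \<nu> f"
      by (rule bergman_evaluation_bound[OF z]) blast
    have "uniformly_Cauchy_on (ball z r) u"
      unfolding uniformly_Cauchy_on_def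
    proof (intro allI impI)
      fix e :: real assume e: "0 < e"
      (* The distance of two late members is below 4 * d in squared norm. *)
      define d where "d = c * e\<^sup>2 / 4"
      have "0 < d" using rc e by (simp add: d_def)
      then obtain M where M: "inverse (real (Suc M)) < d" using reals_Archimedean by blast
      have "dist (u n y) (u k y) < e" if y: "y \<in> ball z r" and nk: "n \<ge> M" "k \<ge> M" for y n k
      proof -
        have "c * (cmod (u n y - u k y))\<^sup>2 \<le> N (\<lambda>z. u n z - u k z)"
          using rc(4)[OF diffH[of n k, unfolded H_def] y] by (simp add: N_def)
        also have "\<dots> \<le> 2 * inverse (real (Suc n)) + 2 * inverse (real (Suc k))" by (rule close)
        also have "\<dots> \<le> 2 * inverse (real (Suc M)) + 2 * inverse (real (Suc M))"
          using nk by (intro add_mono mult_left_mono le_imp_inverse_le) auto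
        also have "\<dots> < 4 * d" using M by simp
        also have "\<dots> = c * e\<^sup>2" by (simp add: d_def)
        finally have "(cmod (u n y - u k y))\<^sup>2 < e\<^sup>2" using rc(2) by simp
        then show ?thesis using e by (simp add: dist_norm power2_less_imp_less)
      qed
      then show "\<exists>M. \<forall>x\<in>ball z r. \<forall>m\<ge>M. \<forall>n\<ge>M. dist (u m x) (u n x) < e" by blast
    qed
    then have "uniformly_convergent_on (ball z r) u" by (rule Cauchy_uniformly_convergent)
    then have "uniform_limit (ball z r) u g sequentially"
      unfolding g_def by (simp only: uniformly_convergent_uniform_limit_iff)
    then show ?thesis using rc by blast
  qed
  have hol: "holomorphic_Cn g D"
    by (rule holomorphic_Cn_uniform_limit[OF _ ulim]) (use uH bergman_spaceD in \<open>auto simp: H_def\<close>)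
  have lim: "(\<lambda>n. u n z) \<longlonglongrightarrow> g z" if "z \<in> D" for z
    using ulim[OF that] tendsto_uniform_limitI by (metis centre_in_ball)
  have gw: "g w = 1" using lim[OF w] uH(2) by (simp add: LIMSEQ_const_iff)
  (* Fatou's lemma bounds the norm of the limit by the infimum. *)
  have Nlim: "(\<lambda>n. ennreal (N (u n))) \<longlonglongrightarrow> ennreal m"
  proof (rule tendsto_ennrealI, rule tendsto_sandwich[OF _ _ tendsto_const])
    show "(\<lambda>n. m + inverse (real (Suc n))) \<longlonglongrightarrow> m"
      using tendsto_add[OF tendsto_const LIMSEQ_inverse_real_of_nat, of m] by simp
    show "\<forall>\<^sub>F n in sequentially. m \<le> N (u n)" using m_le u(1) by simp
    show "\<forall>\<^sub>F n in sequentially. N (u n) \<le> m + inverse (real (Suc n))" using u(2) by (simp add: less_imp_le)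
  qed
  have meas: "(\<lambda>z. ennreal ((cmod (u n z))\<^sup>2 * \<nu> z) * indicator D z) \<in> borel_measurable lborel" for n
  proof -
    have "(\<lambda>z. indicator D z *\<^sub>R ((cmod (u n z))\<^sup>2 * \<nu> z)) \<in> borel_measurable borel"
      by (intro set_borel_measurable_continuous[OF D] continuous_intros \<nu>
          holomorphic_Cn_continuous bergman_spaceD(1)) (use uH in \<open>auto simp: H_def\<close>)
    then have "(\<lambda>z. ennreal (indicator D z *\<^sub>R ((cmod (u n z))\<^sup>2 * \<nu> z))) \<in> borel_measurable lborel" by simp
    moreover have "(\<lambda>z. ennreal (indicator D z *\<^sub>R ((cmod (u n z))\<^sup>2 * \<nu> z)))
        = (\<lambda>z. ennreal ((cmod (u n z))\<^sup>2 * \<nu> z) * indicator D z)"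
      by (auto split: split_indicator)
    ultimately show ?thesis by simp
  qed
  have "(\<integral>\<^sup>+z\<in>D. ennreal ((cmod (g z))\<^sup>2 * \<nu> z) \<partial>lborel)
      = (\<integral>\<^sup>+z. liminf (\<lambda>n. ennreal ((cmod (u n z))\<^sup>2 * \<nu> z) * indicator D z) \<partial>lborel)"
  proof (rule nn_integral_cong)
    fix z
    have "(\<lambda>n. ennreal ((cmod (u n z))\<^sup>2 * \<nu> z) * indicator D z) \<longlonglongrightarrow> ennreal ((cmod (g z))\<^sup>2 * \<nu> z) * indicator D z"
    proof (cases "z \<in> D")
      case True
      have "(\<lambda>n. ennreal ((cmod (u n z))\<^sup>2 * \<nu> z)) \<longlonglongrightarrow> ennreal ((cmod (g z))\<^sup>2 * \<nu> z)"
        by (intro tendsto_ennrealI tendsto_intros lim True)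
      then show ?thesis using True by simp
    qed simp
    then show "ennreal ((cmod (g z))\<^sup>2 * \<nu> z) * indicator D z
        = liminf (\<lambda>n. ennreal ((cmod (u n z))\<^sup>2 * \<nu> z) * indicator D z)"
      by (intro lim_imp_Liminf[symmetric]) auto
  qed
  also have "\<dots> \<le> liminf (\<lambda>n. \<integral>\<^sup>+z\<in>D. ennreal ((cmod (u n z))\<^sup>2 * \<nu> z) \<partial>lborel)"
    by (intro nn_integral_liminf meas)
  also have "\<dots> = liminf (\<lambda>n. ennreal (N (u n)))"
    using uH by (simp add: nn_integral_bergman_norm2 H_def N_def)
  also have "\<dots> = ennreal m" using Nlim by (intro lim_imp_Liminf) auto
  finally have le: "(\<integral>\<^sup>+z\<in>D. ennreal ((cmod (g z))\<^sup>2 * \<nu> z) \<partial>lborel) \<le> ennreal m" .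
  then have "(\<integral>\<^sup>+z\<in>D. ennreal ((cmod (g z))\<^sup>2 * \<nu> z) \<partial>lborel) < \<infinity>"
    using order_le_less_trans by fastforce
  then have gH: "g \<in> bergman_space lborel D \<nu>"
    by (simp add: bergman_space_iff[OF D \<nu> \<nu>_pos] hol)
  have "0 \<le> m" unfolding m_def using ne by (intro cInf_greatest) (auto simp: N_def bergman_norm2_nonneg)
  then have "N g \<le> m" using le by (simp add: nn_integral_bergman_norm2[OF gH] N_def ennreal_le_iff)
  then show ?thesis using that[OF gH gw] m_le by (force simp: S_def H_def N_def)
qed

text \<open>
  The first variation of the squared norm in the direction \<open>c h\<close>, with the phase of \<open>c\<close> opposite to
  that of the inner product.
\<close>

lemma bergman_minimal_orthogonal:
  assumes g: "g \<in> bergman_space lborel D \<nu>" and h: "h \<in> bergman_space lborel D \<nu>"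
    and min: "\<And>c. bergman_norm2 D \<nu> g \<le> bergman_norm2 D \<nu> (\<lambda>z. g z + c * h z)"
  shows "bergman_inner lborel D \<nu> g h = 0"
proof (rule ccontr)
  define a where "a = bergman_inner lborel D \<nu> g h"
  define N where "N = bergman_norm2 D \<nu> h"
  assume "bergman_inner lborel D \<nu> g h \<noteq> 0"
  then have a: "0 < (cmod a)\<^sup>2" by (simp add: a_def)
  have N: "0 \<le> N" by (simp add: N_def bergman_norm2_nonneg)
  (* Any t with t * N < 2 makes the quadratic variation negative. *)
  define t where "t = 1 / (N + 1)"
  define c where "c = - complex_of_real t * a"
  have "bergman_norm2 D \<nu> (\<lambda>z. g z + c * h z) = bergman_norm2 D \<nu> g + 2 * Re (cnj c * a) + (cmod c)\<^sup>2 * N"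
    using bergman_space_add(2)[OF g bergman_space_cmult[OF h, of c]]
    by (simp add: bergman_inner_cmult_right bergman_norm2_cmult a_def N_def)
  moreover have "Re (cnj c * a) = - t * (cmod a)\<^sup>2"
    unfolding cmod_power2 by (simp add: c_def power2_eq_square algebra_simps)
  moreover have "(cmod c)\<^sup>2 = t\<^sup>2 * (cmod a)\<^sup>2" by (simp add: c_def norm_mult power_mult_distrib)
  ultimately have "0 \<le> t * (cmod a)\<^sup>2 * (t * N - 2)"
    using min[of c] by (simp add: algebra_simps power2_eq_square)
  moreover have "0 < t * (cmod a)\<^sup>2" using a N by (simp add: t_def)
  moreover have "t * N - 2 < 0" using N by (simp add: t_def field_simps)
  ultimately show False by (simp add: zero_le_mult_iff)
qed

text \<open>
  If \<open>g\<close> has minimal norm among the functions with value 1 at \<open>w\<close>, then it is orthogonal to the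
  functions vanishing at \<open>w\<close>, in particular to \<open>f - f(w) g\<close>; so \<open>g\<close> divided by its squared norm
  represents the evaluation at \<open>w\<close>.
\<close>

lemma bergman_representer:
  assumes w: "w \<in> D"
  shows "\<exists>k\<in>bergman_space lborel D \<nu>. \<forall>f\<in>bergman_space lborel D \<nu>. f w = bergman_inner lborel D \<nu> f k"
proof (cases "\<exists>f\<in>bergman_space lborel D \<nu>. f w \<noteq> 0")
  case False
  have "(\<lambda>_. 0) \<in> bergman_space lborel D \<nu>"
    by (simp add: bergman_space_def holomorphic_Cn_const set_integrable_def)
  moreover have "bergman_inner lborel D \<nu> f (\<lambda>_. 0) = 0" for f
    by (simp add: bergman_inner_def)
  ultimately show ?thesis using False by metis
next
  case True
  then obtain f where f: "f \<in> bergman_space lborel D \<nu>" "f w \<noteq> 0" by blast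
  have "(\<lambda>z. inverse (f w) * f z) \<in> bergman_space lborel D \<nu>" by (rule bergman_space_cmult[OF f(1)])
  moreover have "inverse (f w) * f w = 1" using f by simp
  ultimately obtain g where g: "g \<in> bergman_space lborel D \<nu>" "g w = 1"
    and min: "\<And>h. h \<in> bergman_space lborel D \<nu> \<Longrightarrow> h w = 1 \<Longrightarrow> bergman_norm2 D \<nu> g \<le> bergman_norm2 D \<nu> h"
    using bergman_minimal_element[OF w, of "\<lambda>z. inverse (f w) * f z"] by metis
  define m where "m = bergman_norm2 D \<nu> g"
  obtain r c where rc: "0 < r" "0 < c" "ball w r \<subseteq> D"
    "\<And>f y. f \<in> bergman_space lborel D \<nu> \<Longrightarrow> y \<in> ball w r \<Longrightarrow> c * (cmod (f y))\<^sup>2 \<le> bergman_norm2 D \<nu> f"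
    by (rule bergman_evaluation_bound[OF w]) blast
  have m: "0 < m" using rc(4)[OF g(1), of w] rc(1,2) g(2) by (simp add: m_def)
  define k where "k = (\<lambda>z. complex_of_real (1 / m) * g z)"
  have "f w = bergman_inner lborel D \<nu> f k" if f: "f \<in> bergman_space lborel D \<nu>" for f
  proof -
    define h where "h = (\<lambda>z. f z + (- f w) * g z)"
    have hH: "h \<in> bergman_space lborel D \<nu>"
      unfolding h_def by (intro bergman_space_add bergman_space_cmult f g)
    have hw: "h w = 0" by (simp add: h_def g)
    have "bergman_inner lborel D \<nu> g h = 0"
    proof (rule bergman_minimal_orthogonal[OF g(1) hH])
      show "bergman_norm2 D \<nu> g \<le> bergman_norm2 D \<nu> (\<lambda>z. g z + c * h z)" for c
        by (rule min) (auto intro!: bergman_space_add bergman_space_cmult g hH simp: g hw)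
    qed
    then have "bergman_inner lborel D \<nu> h g = 0" by (metis bergman_inner_cnj complex_cnj_zero)
    moreover have "bergman_inner lborel D \<nu> h g
        = bergman_inner lborel D \<nu> f g + (- f w) * bergman_inner lborel D \<nu> g g"
      using bergman_inner_add_left[OF f bergman_space_cmult[OF g(1), of "- f w"] g(1)]
      by (simp only: h_def bergman_inner_cmult_left)
    ultimately have "bergman_inner lborel D \<nu> f g = f w * m"
      by (simp add: bergman_inner_self m_def)
    then show ?thesis using m unfolding k_def bergman_inner_cmult_right by simp
  qed
  moreover have "k \<in> bergman_space lborel D \<nu>" unfolding k_def by (intro bergman_space_cmult g)
  ultimately show ?thesis by blast
qed

lemma bergman_kernel_exists: "\<exists>K. is_bergman_kernel lborel D \<nu> K"
proof -
  have "\<forall>w\<in>D. \<exists>k. k \<in> bergman_space lborel D \<nu> \<and>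
      (\<forall>f\<in>bergman_space lborel D \<nu>. f w = bergman_inner lborel D \<nu> f k)"
    using bergman_representer by blast
  then obtain K where "\<forall>w\<in>D. K w \<in> bergman_space lborel D \<nu> \<and>
      (\<forall>f\<in>bergman_space lborel D \<nu>. f w = bergman_inner lborel D \<nu> f (K w))"
    by metis
  then have "is_bergman_kernel lborel D \<nu> (\<lambda>z w. K w z)"
    by (simp add: is_bergman_kernel_def)
  then show ?thesis by blast
qed

end


section \<open>Removable singularities of square integrable functions\<close>

text \<open>
  Nonempty open sets are not null.
\<close>

lemma AE_eq_continuous_imp_eq:
  fixes f g :: "'a::euclidean_space \<Rightarrow> 'b::real_normed_vector"
  assumes U: "open U" and f: "continuous_on U f" and g: "continuous_on U g"
    and ae: "AE y in lborel. y \<in> U \<longrightarrow> f y = g y" and y: "y \<in> U"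
  shows "f y = g y"
proof (rule ccontr)
  assume neq: "f y \<noteq> g y"
  define W where "W = {x \<in> U. f x - g x \<in> - {0}}"
  have "open (U \<inter> (\<lambda>x. f x - g x) -` (- {0}))"
    by (rule continuous_open_preimage[OF continuous_on_diff[OF f g] U]) auto
  moreover have "W = U \<inter> (\<lambda>x. f x - g x) -` (- {0})" by (auto simp: W_def)
  ultimately have "open W" by simp
  moreover have "y \<in> W" using y neq by (simp add: W_def)
  ultimately have "\<not> negligible W" using open_not_negligible by blast
  moreover have "negligible W"
  proof -
    obtain N where N: "{x \<in> space lborel. \<not> (x \<in> U \<longrightarrow> f x = g x)} \<subseteq> N" "N \<in> null_sets lborel"
      using ae by (auto elim!: AE_E simp: null_sets_def)
    then have "negligible N" by (simp add: negligible_iff_null_sets null_sets_completionI)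
    moreover have "W \<subseteq> N" using N(1) by (auto simp: W_def)
    ultimately show ?thesis by (rule negligible_subset)
  qed
  ultimately show False by simp
qed

lemma continuous_eq_off_null_set:
  fixes f g :: "'a::euclidean_space \<Rightarrow> 'b::real_normed_vector"
  assumes "open U" "continuous_on U f" "continuous_on U g" "N \<in> null_sets lborel"
    and eq: "\<And>x. x \<in> U \<Longrightarrow> x \<notin> N \<Longrightarrow> f x = g x" and y: "y \<in> U"
  shows "f y = g y"
proof (rule AE_eq_continuous_imp_eq[OF assms(1-3) _ y])
  have "AE x in lborel. x \<notin> N" using assms(4) by (rule AE_not_in)
  then show "AE x in lborel. x \<in> U \<longrightarrow> f x = g x" by eventually_elim (use eq in auto)
qed

lemma distr_lborel_vec1: "distr lborel borel (\<lambda>x :: complex ^ 1. x $ 1) = lborel"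
proof (rule lborel_eqI[symmetric])
  fix l u :: complex assume lu: "\<And>b. b \<in> Basis \<Longrightarrow> l \<bullet> b \<le> u \<bullet> b"
  have meas: "(\<lambda>x :: complex ^ 1. x $ 1) \<in> borel \<rightarrow>\<^sub>M borel"
    by (intro borel_measurable_continuous_onI continuous_intros)
  have vec: "(vec u - vec l :: complex ^ 1) = vec (u - l)" by (simp add: vec_eq_iff)
  have box: "(\<lambda>x :: complex ^ 1. x $ 1) -` box l u = box (vec l) (vec u)"
    by (auto simp: mem_box Basis_vec_def inner_axis)
  have "emeasure (distr lborel borel (\<lambda>x :: complex ^ 1. x $ 1)) (box l u) = emeasure lborel (box (vec l) (vec u :: complex ^ 1))"
    by (subst emeasure_distr) (simp_all add: meas box)
  also have "\<dots> = ennreal (\<Prod>b\<in>Basis. (vec u - vec l :: complex ^ 1) \<bullet> b)"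
    by (rule emeasure_lborel_box) (use lu in \<open>auto simp: Basis_vec_def inner_axis\<close>)
  also have "(\<Prod>b\<in>Basis. (vec u - vec l :: complex ^ 1) \<bullet> b) = (\<Prod>b\<in>Basis. (u - l) \<bullet> b)"
    unfolding vec prod_Basis_vec_complex by (simp add: UNIV_1 Basis_complex_def inner_complex_def)
  finally show "emeasure (distr lborel borel (\<lambda>x :: complex ^ 1. x $ 1)) (box l u) = ennreal (\<Prod>b\<in>Basis. (u - l) \<bullet> b)" .
qed simp

text \<open>
  The case of dimension one of \<open>L2_mean_value_on_balls\<close>, transported from \<open>complex ^ 1\<close> to
  \<open>complex\<close>.
\<close>

lemma L2_mean_value_on_discs:
  assumes f: "f holomorphic_on ball z \<rho>"
  shows "emeasure lborel (ball (0::complex) \<rho>) * ennreal ((cmod (f z))\<^sup>2)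
    \<le> (\<integral>\<^sup>+t\<in>ball z \<rho>. ennreal ((cmod (f t))\<^sup>2) \<partial>lborel)"
proof -
  have meas [measurable]: "(\<lambda>x :: complex ^ 1. x $ 1) \<in> borel \<rightarrow>\<^sub>M borel"
    by (intro borel_measurable_continuous_onI continuous_intros)
  have ball: "(\<lambda>x :: complex ^ 1. x $ 1) -` ball c r = ball (vec c) r" for c r
    by (auto simp: dist_norm norm_vec_def L2_set_def UNIV_1)
  define F where "F = (\<lambda>x :: complex ^ 1. f (x $ 1))"
  have F: "holomorphic_Cn F (ball (vec z) \<rho>)"
    unfolding holomorphic_Cn_def
  proof
    fix x :: "complex ^ 1" assume "x \<in> ball (vec z) \<rho>"
    then have "x $ 1 \<in> ball z \<rho>" using ball[of z \<rho>] by blast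
    then have "(f has_field_derivative deriv f (x $ 1)) (at (x $ 1))"
      using f holomorphic_derivI by blast
    then have "(f has_derivative (*) (deriv f (x $ 1))) (at (x $ 1))"
      by (simp add: has_field_derivative_def)
    from has_derivative_compose[OF has_derivative_vec_nth this]
    show "\<exists>L. (F has_derivative L) (at x) \<and> (\<forall>c v. L (c *s v) = c * L v)"
      unfolding F_def by (intro exI conjI) (assumption, simp)
  qed
  have "emeasure lborel (ball (0::complex) \<rho>) = emeasure lborel (ball (0 :: complex ^ 1) \<rho>)"
    by (subst distr_lborel_vec1[symmetric], subst emeasure_distr) (simp_all add: meas ball vec_0 [symmetric] del: vec_0)
  then have "emeasure lborel (ball (0::complex) \<rho>) * ennreal ((cmod (f z))\<^sup>2)
      = emeasure lborel (ball (0 :: complex ^ 1) \<rho>) * ennreal ((cmod (F (vec z)))\<^sup>2)"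
    by (simp add: F_def)
  also have "\<dots> \<le> (\<integral>\<^sup>+x\<in>ball (vec z) \<rho>. ennreal ((cmod (F x))\<^sup>2) \<partial>lborel)"
    by (rule L2_mean_value_on_balls[OF F order_refl])
  also have "\<dots> = (\<integral>\<^sup>+t\<in>ball z \<rho>. ennreal ((cmod (f t))\<^sup>2) \<partial>lborel)"
  proof -
    have "(\<lambda>t. indicator (ball z \<rho>) t *\<^sub>R f t) \<in> borel_measurable borel"
      by (intro set_borel_measurable_continuous holomorphic_on_imp_continuous_on f) auto
    then have "(\<lambda>t. ennreal ((cmod (indicator (ball z \<rho>) t *\<^sub>R f t))\<^sup>2)) \<in> borel_measurable borel"
      by measurable
    moreover have "(\<lambda>t. ennreal ((cmod (indicator (ball z \<rho>) t *\<^sub>R f t))\<^sup>2))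
        = (\<lambda>t. ennreal ((cmod (f t))\<^sup>2) * indicator (ball z \<rho>) t)"
      by (auto split: split_indicator)
    ultimately have m: "(\<lambda>t. ennreal ((cmod (f t))\<^sup>2) * indicator (ball z \<rho>) t) \<in> borel_measurable borel"
      by (simp only:)
    have ind: "indicator (ball z \<rho>) (x $ 1) = (indicator (ball (vec z) \<rho>) x :: ennreal)" for x :: "complex ^ 1"
      using ball[of z \<rho>] by (auto simp: indicator_def)
    show ?thesis
      by (subst distr_lborel_vec1[symmetric], subst nn_integral_distr) (simp_all add: meas m ind F_def)
  qed
  finally show ?thesis .
qed

text \<open>
  The mean value inequality on the disc of radius \<open>|z - a|\<close> about \<open>z\<close> bounds \<open>|(z - a) f(z)|\<^sup>2\<close> by a
  constant times the integral of \<open>|f|\<^sup>2\<close> over a disc about \<open>a\<close> that shrinks to \<open>a\<close>. So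
  \<open>(z - a) f(z)\<close> tends to 0, which makes the singularity removable.
\<close>

lemma L2_isolated_singularity:
  assumes S: "open S" "a \<in> S" and f: "f holomorphic_on S - {a}"
    and fin: "(\<integral>\<^sup>+t\<in>S. ennreal ((cmod (f t))\<^sup>2) \<partial>lborel) < \<infinity>"
  shows "\<exists>g. g holomorphic_on S \<and> (\<forall>t\<in>S - {a}. g t = f t)"
proof -
  define h where "h = (\<lambda>t. ennreal ((cmod (indicator (S - {a}) t *\<^sub>R f t))\<^sup>2))"
  define \<mu> where "\<mu> = density lborel h"
  have "(\<lambda>t. indicator (S - {a}) t *\<^sub>R f t) \<in> borel_measurable borel"
    by (intro set_borel_measurable_continuous holomorphic_on_imp_continuous_on f) (use S in auto)
  then have h [measurable]: "h \<in> borel_measurable borel" unfolding h_def by measurable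
  have \<mu>: "emeasure \<mu> E = (\<integral>\<^sup>+t. h t * indicator E t \<partial>lborel)" if "E \<in> sets borel" for E
    unfolding \<mu>_def using that by (simp add: emeasure_density)
  have "emeasure \<mu> UNIV \<le> (\<integral>\<^sup>+t\<in>S. ennreal ((cmod (f t))\<^sup>2) \<partial>lborel)"
    by (subst \<mu>) (auto intro!: nn_integral_mono simp: h_def split: split_indicator)
  then have fin_\<mu>: "emeasure \<mu> E < \<infinity>" for E
    using fin emeasure_space[of \<mu> E] by (simp add: \<mu>_def order.strict_trans1)
  obtain \<delta> where \<delta>: "0 < \<delta>" "ball a \<delta> \<subseteq> S" using S open_contains_ball by blast
  define v where "v = unit_ball_vol 2"
  have v: "0 < v" unfolding v_def by simp
  have bound: "ennreal (v * (cmod ((z - a) * f z))\<^sup>2) \<le> emeasure \<mu> (ball a s)"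
    if z: "z \<noteq> a" and s: "2 * cmod (z - a) \<le> s" "s \<le> \<delta>" for z s
  proof -
    define \<rho> where "\<rho> = cmod (z - a)"
    have \<rho>: "0 < \<rho>" using z by (simp add: \<rho>_def)
    have sub: "ball z \<rho> \<subseteq> ball a s - {a}"
    proof
      fix t assume "t \<in> ball z \<rho>"
      then show "t \<in> ball a s - {a}"
        using dist_triangle[of a t z] s by (auto simp: \<rho>_def dist_norm norm_minus_commute)
    qed
    then have sub': "ball z \<rho> \<subseteq> S - {a}" using \<delta> s by force
    have "emeasure lborel (ball (0::complex) \<rho>) = ennreal (v * \<rho>\<^sup>2)"
      using \<rho> by (subst emeasure_ball) (auto simp: v_def)
    then have "ennreal (v * (cmod ((z - a) * f z))\<^sup>2) = emeasure lborel (ball (0::complex) \<rho>) * ennreal ((cmod (f z))\<^sup>2)"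
      using v \<rho> by (simp add: \<rho>_def norm_mult power_mult_distrib ennreal_mult[symmetric] mult.assoc)
    also have "\<dots> \<le> (\<integral>\<^sup>+t\<in>ball z \<rho>. ennreal ((cmod (f t))\<^sup>2) \<partial>lborel)"
      by (rule L2_mean_value_on_discs) (rule holomorphic_on_subset[OF f sub'])
    also have "\<dots> \<le> emeasure \<mu> (ball a s)"
    proof (subst \<mu>)
      show "(\<integral>\<^sup>+t\<in>ball z \<rho>. ennreal ((cmod (f t))\<^sup>2) \<partial>lborel) \<le> (\<integral>\<^sup>+t. h t * indicator (ball a s) t \<partial>lborel)"
      proof (rule nn_integral_mono)
        show "ennreal ((cmod (f t))\<^sup>2) * indicator (ball z \<rho>) t \<le> h t * indicator (ball a s) t" for t
        proof (cases "t \<in> ball z \<rho>")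
          case True
          then have "t \<in> ball a s" "t \<in> S - {a}" using sub sub' by blast+
          then show ?thesis using True by (simp add: h_def)
        qed simp
      qed
    qed simp
    finally show ?thesis .
  qed
  have "(\<lambda>n. emeasure \<mu> (ball a (\<delta> / real (Suc n)))) \<longlonglongrightarrow> emeasure \<mu> (\<Inter>n. ball a (\<delta> / real (Suc n)))"
  proof (rule Lim_emeasure_decseq)
    show "decseq (\<lambda>n. ball a (\<delta> / real (Suc n)))"
      using \<delta>(1) by (intro decseq_SucI subset_ball divide_left_mono) auto
  qed (use fin_\<mu> in \<open>auto simp: \<mu>_def less_top\<close>)
  moreover have "(\<Inter>n. ball a (\<delta> / real (Suc n))) = {a}"
  proof -
    have "t = a" if t: "\<And>n. t \<in> ball a (\<delta> / real (Suc n))" for t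
    proof (rule ccontr)
      assume "t \<noteq> a"
      then have "0 < dist a t / \<delta>" using \<delta>(1) by simp
      then obtain n where "inverse (real (Suc n)) < dist a t / \<delta>" using reals_Archimedean by blast
      then show False using t[of n] \<delta>(1) by (simp add: field_simps)
    qed
    then show ?thesis using \<delta>(1) by fastforce
  qed
  moreover have "emeasure \<mu> {a} = 0"
    by (subst \<mu>) (auto simp: h_def nn_integral_0_iff_AE split: split_indicator)
  ultimately have lim: "(\<lambda>n. emeasure \<mu> (ball a (\<delta> / real (Suc n)))) \<longlonglongrightarrow> 0" by simp
  have "((\<lambda>z. (z - a) * f z) \<longlongrightarrow> 0) (at a)"
  proof (rule tendstoI)
    fix e :: real assume e: "0 < e"
    then have "0 < ennreal (v * e\<^sup>2)" using v by simp
    then have "\<forall>\<^sub>F n in sequentially. emeasure \<mu> (ball a (\<delta> / real (Suc n))) < ennreal (v * e\<^sup>2)"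
      using lim order_tendstoD(2) by blast
    then obtain n where n: "emeasure \<mu> (ball a (\<delta> / real (Suc n))) < ennreal (v * e\<^sup>2)"
      using eventually_happens'[OF sequentially_bot] by blast
    define s where "s = \<delta> / real (Suc n)"
    have s: "0 < s" "s \<le> \<delta>" using \<delta>(1) by (auto simp: s_def field_simps)
    have "dist ((z - a) * f z) 0 < e" if z: "z \<noteq> a" "dist z a < s / 2" for z
    proof -
      have "ennreal (v * (cmod ((z - a) * f z))\<^sup>2) < ennreal (v * e\<^sup>2)"
      proof (rule order.strict_trans1)
        show "ennreal (v * (cmod ((z - a) * f z))\<^sup>2) \<le> emeasure \<mu> (ball a s)"
          by (rule bound[OF z(1)]) (use z(2) s in \<open>auto simp: dist_norm\<close>)
        show "emeasure \<mu> (ball a s) < ennreal (v * e\<^sup>2)" using n by (simp only: s_def)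
      qed
      then have "v * (cmod ((z - a) * f z))\<^sup>2 < v * e\<^sup>2"
        using v by (subst (asm) ennreal_less_iff) auto
      then have "(cmod ((z - a) * f z))\<^sup>2 < e\<^sup>2" using v by simp
      then show ?thesis using e by (simp add: power2_less_imp_less)
    qed
    then show "\<forall>\<^sub>F z in at a. dist ((z - a) * f z) 0 < e"
      unfolding eventually_at using s(1) by (intro exI[of _ "s / 2"]) auto
  qed
  then show ?thesis
    using holomorphic_on_extend_lim[OF f] S by (simp add: interior_open)
qed

lemma L2_finite_singularities:
  assumes "finite A" "open S" "f holomorphic_on S - A"
    "(\<integral>\<^sup>+t\<in>S. ennreal ((cmod (f t))\<^sup>2) \<partial>lborel) < \<infinity>"
  shows "\<exists>g. g holomorphic_on S \<and> (\<forall>t\<in>S - A. g t = f t)"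
  using assms
proof (induction A arbitrary: f rule: finite_induct)
  case empty
  then show ?case by (intro exI[of _ f]) auto
next
  case (insert a A)
  have open': "open (S - A)" using insert by (intro open_Diff finite_imp_closed)
  have fin: "(\<integral>\<^sup>+t\<in>S - A. ennreal ((cmod (f t))\<^sup>2) \<partial>lborel) < \<infinity>"
    by (rule order.strict_trans1[OF _ insert.prems(3)]) (auto intro!: nn_integral_mono split: split_indicator)
  have "\<exists>g. g holomorphic_on S - A \<and> (\<forall>t\<in>S - A - {a}. g t = f t)"
  proof (cases "a \<in> S - A")
    case True
    have "S - insert a A = S - A - {a}" by blast
    then have "f holomorphic_on S - A - {a}" using insert.prems(2) by simp
    from L2_isolated_singularity[OF open' True this fin] show ?thesis .
  next
    case False
    then have "S - insert a A = S - A" by auto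
    then show ?thesis using insert.prems(2) by (intro exI[of _ f]) auto
  qed
  then obtain g where g: "g holomorphic_on S - A" "\<And>t. t \<in> S - A \<Longrightarrow> t \<noteq> a \<Longrightarrow> g t = f t" by blast
  have "AE t in lborel. t \<notin> insert a A"
    by (intro AE_not_in finite_imp_null_set_lborel finite.insertI insert.hyps)
  then have "(\<integral>\<^sup>+t\<in>S. ennreal ((cmod (g t))\<^sup>2) \<partial>lborel) = (\<integral>\<^sup>+t\<in>S. ennreal ((cmod (f t))\<^sup>2) \<partial>lborel)"
  proof (intro nn_integral_cong_AE, eventually_elim)
    fix t assume "t \<notin> insert a A"
    then have "t \<in> S \<Longrightarrow> g t = f t" using g(2) by blast
    then show "ennreal ((cmod (g t))\<^sup>2) * indicator S t = ennreal ((cmod (f t))\<^sup>2) * indicator S t"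
      by (cases "t \<in> S") simp_all
  qed
  then have "(\<integral>\<^sup>+t\<in>S. ennreal ((cmod (g t))\<^sup>2) \<partial>lborel) < \<infinity>" using insert.prems(3) by (simp only:)
  from insert.IH[OF insert.prems(1) g(1) this]
  obtain k where k: "k holomorphic_on S" "\<forall>t\<in>S - A. k t = g t" by blast
  have "k t = f t" if "t \<in> S - insert a A" for t
    using that k(2) g(2)[of t] by simp
  with k(1) show ?case by blast
qed

text \<open>
  The extension near \<open>p\<close> is given by circle means along a direction \<open>v\<close> in which \<open>q\<close> does not vanish
  identically. The circle avoids the zeros of \<open>q\<close>, also after small shifts, so the means are
  holomorphic in the centre \<open>y\<close>. By Fubini's theorem \<open>f\<close> is square integrable on almost every
  parallel disc; there its finitely many singularities are removable, and the mean equals \<open>f(y)\<close>.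
  Continuity gives equality at every \<open>y\<close> with \<open>q(y) \<noteq> 0\<close>.
\<close>

lemma holomorphic_Cn_L2_local_extension:
  fixes f :: "complex ^ 'n \<Rightarrow> complex"
  assumes D: "open D" "p \<in> D" and q: "polyfun q" "q a \<noteq> 0"
    and f: "holomorphic_Cn f (D - {z. q z = 0})"
    and \<nu>: "continuous_on D \<nu>" "\<And>z. z \<in> D \<Longrightarrow> 0 < \<nu> z"
    and fin: "(\<integral>\<^sup>+z\<in>D - {z. q z = 0}. ennreal ((cmod (f z))\<^sup>2 * \<nu> z) \<partial>lborel) < \<infinity>"
  obtains \<epsilon> F where "0 < \<epsilon>" "ball p \<epsilon> \<subseteq> D" "holomorphic_Cn F (ball p \<epsilon>)"
    "\<And>y. y \<in> ball p \<epsilon> \<Longrightarrow> q y \<noteq> 0 \<Longrightarrow> F y = f y"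
proof -
  define Z where "Z = {z. q z = 0}"
  have closedZ: "closed Z" unfolding Z_def
    by (intro closed_Collect_eq polyfun_continuous q continuous_on_const)
  have openDZ: "open (D - Z)" using D(1) closedZ by (rule open_Diff)
  obtain \<rho> where \<rho>: "0 < \<rho>" "cball p \<rho> \<subseteq> D" using D open_contains_cball by blast
  define v where "v = a - p"
  define R where "R = \<rho> / (2 * (norm v + 1))"
  have R: "0 < R" using \<rho>(1) by (simp add: R_def add_nonneg_pos)
  have Rv: "R * norm v \<le> \<rho> / 2"
  proof -
    have "R * norm v \<le> R * (norm v + 1)" using R by (intro mult_left_mono) auto
    also have "\<dots> = \<rho> / 2"
    proof -
      have "norm v + 1 \<noteq> 0" using norm_ge_zero[of v] by linarith
      then show ?thesis unfolding R_def by (simp del: distrib_left_numeral distrib_right_numeral)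
    qed
    finally show ?thesis .
  qed
  (* Along v only finitely many parameters hit the zero set, so some circle avoids it. *)
  have "finite {t. q (p + t *s v) = 0}"
    by (rule polyfun_finite_zeros_on_line[OF q(1), of p 1]) (simp add: v_def q(2))
  then have "infinite ({0<..<R} - cmod ` {t. q (p + t *s v) = 0})"
    using R by (intro Diff_infinite_finite) auto
  then have "{0<..<R} - cmod ` {t. q (p + t *s v) = 0} \<noteq> {}" by (rule infinite_imp_nonempty)
  then obtain r where r': "r \<in> {0<..<R} - cmod ` {t. q (p + t *s v) = 0}" by blast
  then have r: "0 < r" "r < R" "\<And>t. cmod t = r \<Longrightarrow> q (p + t *s v) \<noteq> 0" by auto
  define K where "K = (\<lambda>t. p + t *s v) ` sphere 0 r"
  have "compact K" unfolding K_def by (intro compact_continuous_image continuous_intros) auto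
  moreover have "open (- Z)" using closedZ by auto
  moreover have "K \<subseteq> - Z" using r(3) by (auto simp: K_def Z_def)
  ultimately obtain \<epsilon>' where \<epsilon>': "0 < \<epsilon>'" "(\<Union>x\<in>K. cball x \<epsilon>') \<subseteq> - Z"
    using compact_subset_open_imp_cball_epsilon_subset by metis
  define \<epsilon> where "\<epsilon> = min \<epsilon>' (\<rho> / 2)"
  have \<epsilon>: "0 < \<epsilon>" using \<epsilon>'(1) \<rho>(1) by (simp add: \<epsilon>_def)
  have in_ball: "y + t *s v \<in> cball p \<rho>" if "y \<in> cball p \<epsilon>" "cmod t < R" for y t
  proof -
    have "cmod t * norm v \<le> R * norm v" using that(2) by (intro mult_right_mono) auto
    then have "norm (t *s v) \<le> \<rho> / 2" using Rv by (simp add: norm_vector_smult)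
    moreover have "norm (p - y) \<le> \<rho> / 2" using that(1) by (simp add: \<epsilon>_def dist_norm)
    ultimately show ?thesis
      using norm_triangle_ineq4[of "p - y" "t *s v"] by (simp add: dist_norm algebra_simps)
  qed
  have on_circle: "q (y + t *s v) \<noteq> 0" if "y \<in> cball p \<epsilon>" "cmod t = r" for y t
  proof -
    have "y + t *s v \<in> cball (p + t *s v) \<epsilon>'" using that(1) by (simp add: \<epsilon>_def dist_norm)
    moreover have "p + t *s v \<in> K" using that(2) by (auto simp: K_def)
    ultimately have "y + t *s v \<in> (\<Union>x\<in>K. cball x \<epsilon>')" by blast
    then show ?thesis using \<epsilon>'(2) by (auto simp only: Z_def)
  qed
  (* At y = p this is the candidate value; shifting y keeps the circle off the zero set. *)
  define F where "F = (\<lambda>y. integral {0..1} (\<lambda>x. f (y + circlepath 0 r x *s v)))"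
  have holF: "holomorphic_Cn F (ball p \<epsilon>)"
    unfolding F_def
  proof (rule holomorphic_Cn_circle_mean[OF f])
    show "y + s *s v \<in> D - {z. q z = 0}" if "y \<in> cball p \<epsilon>" "cmod s = r" for y s
      using in_ball[OF that(1), of s] on_circle[OF that] that(2) r(2) \<rho>(2) by auto
  qed (use r in auto)
  (* Integrability of h over the space gives integrability over almost every disc parallel to v. *)
  define h where "h = (\<lambda>z. ennreal ((cmod (indicator (D - Z) z *\<^sub>R f z))\<^sup>2) * indicator (cball p \<rho>) z)"
  have "(\<lambda>z. indicator (D - Z) z *\<^sub>R f z) \<in> borel_measurable borel"
    using f by (intro set_borel_measurable_continuous openDZ holomorphic_Cn_continuous) (simp add: Z_def)
  note [measurable] = this
  have [measurable]: "cball p \<rho> \<in> sets borel" by (intro borel_closed closed_cball)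
  have [measurable]: "h \<in> borel_measurable borel" unfolding h_def by measurable
  have int_h: "(\<integral>\<^sup>+z. h z \<partial>lborel) < \<infinity>"
  proof -
    have "compact (\<nu> ` cball p \<rho>)" "\<nu> ` cball p \<rho> \<noteq> {}"
      using \<rho> by (auto intro!: compact_continuous_image continuous_on_subset[OF \<nu>(1)])
    then have "\<exists>m\<in>\<nu> ` cball p \<rho>. \<forall>t\<in>\<nu> ` cball p \<rho>. m \<le> t" by (rule compact_attains_inf)
    then obtain m where m: "m \<in> \<nu> ` cball p \<rho>" "\<forall>t\<in>\<nu> ` cball p \<rho>. m \<le> t" by blast
    have m0: "0 < m" using m(1) \<nu>(2) \<rho>(2) by blast
    have le: "h z \<le> ennreal (1/m) * (ennreal ((cmod (f z))\<^sup>2 * \<nu> z) * indicator (D - {z. q z = 0}) z)" for z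
    proof (cases "z \<in> cball p \<rho> \<and> z \<in> D - Z")
      case True
      have "m \<le> \<nu> z" using m(2) True by blast
      then have "(cmod (f z))\<^sup>2 * m \<le> (cmod (f z))\<^sup>2 * \<nu> z" by (intro mult_left_mono) auto
      then have "(cmod (f z))\<^sup>2 \<le> 1 / m * ((cmod (f z))\<^sup>2 * \<nu> z)" using m0 by (simp add: field_simps)
      then have "ennreal ((cmod (f z))\<^sup>2) \<le> ennreal (1 / m * ((cmod (f z))\<^sup>2 * \<nu> z))" by (rule ennreal_leI)
      also have "\<dots> = ennreal (1/m) * ennreal ((cmod (f z))\<^sup>2 * \<nu> z)"
        using m0 \<nu>(2)[of z] True by (intro ennreal_mult) (auto simp: less_imp_le)
      finally show ?thesis using True by (simp add: h_def Z_def)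
    next
      case False
      then show ?thesis by (auto simp: h_def)
    qed
    have meas: "(\<lambda>z. ennreal ((cmod (f z))\<^sup>2 * \<nu> z) * indicator (D - {z. q z = 0}) z) \<in> borel_measurable lborel"
    proof -
      have "(\<lambda>z. indicator (D - Z) z *\<^sub>R ((cmod (f z))\<^sup>2 * \<nu> z)) \<in> borel_measurable borel"
        using f by (intro set_borel_measurable_continuous openDZ continuous_intros holomorphic_Cn_continuous
            continuous_on_subset[OF \<nu>(1)]) (auto simp: Z_def)
      then have "(\<lambda>z. ennreal (indicator (D - Z) z *\<^sub>R ((cmod (f z))\<^sup>2 * \<nu> z))) \<in> borel_measurable lborel" by simp
      moreover have "(\<lambda>z. ennreal (indicator (D - Z) z *\<^sub>R ((cmod (f z))\<^sup>2 * \<nu> z)))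
          = (\<lambda>z. ennreal ((cmod (f z))\<^sup>2 * \<nu> z) * indicator (D - {z. q z = 0}) z)"
        by (auto simp: Z_def split: split_indicator)
      ultimately show ?thesis by (simp only:)
    qed
    have "(\<integral>\<^sup>+z. h z \<partial>lborel) \<le> (\<integral>\<^sup>+z. ennreal (1/m) * (ennreal ((cmod (f z))\<^sup>2 * \<nu> z) * indicator (D - {z. q z = 0}) z) \<partial>lborel)"
      by (intro nn_integral_mono le)
    also have "\<dots> = ennreal (1/m) * (\<integral>\<^sup>+z\<in>D - {z. q z = 0}. ennreal ((cmod (f z))\<^sup>2 * \<nu> z) \<partial>lborel)"
      by (rule nn_integral_cmult[OF meas])
    also have "\<dots> < \<infinity>" using fin by (simp add: ennreal_mult_less_top)
    finally show ?thesis .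
  qed
  have [measurable]: "(\<lambda>t. t *s v) \<in> borel \<rightarrow>\<^sub>M borel"
    by (intro borel_measurable_continuous_onI continuous_intros)
  have [measurable]: "ball (0::complex) R \<in> sets borel" by (intro borel_open open_ball)
  have "(\<integral>\<^sup>+y. \<integral>\<^sup>+t. h (y + t *s v) * indicator (ball 0 R) t \<partial>lborel \<partial>lborel)
      = (\<integral>\<^sup>+t. \<integral>\<^sup>+y. h (y + t *s v) * indicator (ball 0 R) t \<partial>lborel \<partial>lborel)"
    by (rule lborel_pair.Fubini'[symmetric]) measurable
  also have "\<dots> = (\<integral>\<^sup>+t. (\<integral>\<^sup>+z. h z \<partial>lborel) * indicator (ball (0::complex) R) t \<partial>lborel)"
  proof (rule nn_integral_cong)
    fix t :: complex
    have "(\<integral>\<^sup>+y. h (y + t *s v) * indicator (ball 0 R) t \<partial>lborel) = (\<integral>\<^sup>+y. h (y + t *s v) \<partial>lborel) * indicator (ball 0 R) t"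
      by (rule nn_integral_multc) measurable
    also have "(\<integral>\<^sup>+y. h (y + t *s v) \<partial>lborel) = (\<integral>\<^sup>+z. h z \<partial>lborel)"
      by (subst (2) lborel_distr_plus[symmetric, of "t *s v"], subst nn_integral_distr) (auto simp: add.commute)
    finally show "(\<integral>\<^sup>+y. h (y + t *s v) * indicator (ball 0 R) t \<partial>lborel) = (\<integral>\<^sup>+z. h z \<partial>lborel) * indicator (ball 0 R) t" .
  qed
  also have "\<dots> = (\<integral>\<^sup>+z. h z \<partial>lborel) * emeasure lborel (ball (0::complex) R)"
    by (rule nn_integral_cmult_indicator) simp
  also have "\<dots> < \<infinity>"
    using int_h emeasure_bounded_finite[of "ball (0::complex) R"] by (simp add: ennreal_mult_less_top)
  finally have "AE y in lborel. (\<integral>\<^sup>+t. h (y + t *s v) * indicator (ball 0 R) t \<partial>lborel) \<noteq> \<infinity>"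
    by (intro nn_integral_PInf_AE) (auto intro!: lborel.borel_measurable_nn_integral)
  then have ae: "AE y in lborel. y \<in> ball p \<epsilon> - Z \<longrightarrow> F y = f y"
  proof eventually_elim
    fix y assume fin_y: "(\<integral>\<^sup>+t. h (y + t *s v) * indicator (ball 0 R) t \<partial>lborel) \<noteq> \<infinity>"
    show "y \<in> ball p \<epsilon> - Z \<longrightarrow> F y = f y"
    proof
      assume y: "y \<in> ball p \<epsilon> - Z"
      then have yc: "y \<in> cball p \<epsilon>" by auto
      define A where "A = {t. q (y + t *s v) = 0}"
      have fA: "finite A" unfolding A_def
        by (rule polyfun_finite_zeros_on_line[OF q(1), of y "of_real r"]) (use on_circle[OF yc] r in auto)
      have hol: "(\<lambda>t. f (y + t *s v)) holomorphic_on ball 0 R - A"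
        by (rule holomorphic_on_line[OF f]) (use in_ball[OF yc] \<rho>(2) in \<open>auto simp: A_def\<close>)
      have "(\<integral>\<^sup>+t\<in>ball 0 R. ennreal ((cmod (f (y + t *s v)))\<^sup>2) \<partial>lborel) = (\<integral>\<^sup>+t. h (y + t *s v) * indicator (ball 0 R) t \<partial>lborel)"
      proof (rule nn_integral_cong_AE)
        have "AE t in lborel. t \<notin> A" using fA by (intro AE_not_in finite_imp_null_set_lborel)
        then show "AE t in lborel. ennreal ((cmod (f (y + t *s v)))\<^sup>2) * indicator (ball 0 R) t = h (y + t *s v) * indicator (ball 0 R) t"
        proof eventually_elim
          fix t assume "t \<notin> A"
          then show "ennreal ((cmod (f (y + t *s v)))\<^sup>2) * indicator (ball 0 R) t = h (y + t *s v) * indicator (ball 0 R) t"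
            using in_ball[OF yc, of t] \<rho>(2) by (auto simp: h_def A_def Z_def split: split_indicator)
        qed
      qed
      then have "(\<integral>\<^sup>+t\<in>ball 0 R. ennreal ((cmod (f (y + t *s v)))\<^sup>2) \<partial>lborel) < \<infinity>"
        using fin_y by (simp add: less_top)
      then obtain g where g: "g holomorphic_on ball 0 R" "\<And>t. t \<in> ball 0 R - A \<Longrightarrow> g t = f (y + t *s v)"
        using L2_finite_singularities[OF fA open_ball hol] by blast
      have circ: "cmod (circlepath 0 r x) = r" for x using r(1) by (simp add: circlepath norm_mult)
      have "((\<lambda>x. g (circlepath 0 r x)) has_integral g 0) {0..1}"
        by (rule holomorphic_circle_mean_value) (use r in \<open>auto intro: holomorphic_on_subset[OF g(1)]\<close>)
      moreover have "g (circlepath 0 r x) = f (y + circlepath 0 r x *s v)" for x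
        by (rule g(2)) (use circ[of x] r on_circle[OF yc, of "circlepath 0 r x"] in \<open>auto simp: A_def\<close>)
      ultimately have "F y = g 0" unfolding F_def by (simp add: integral_unique)
      also have "g 0 = f y" using g(2)[of 0] R y by (simp add: A_def Z_def)
      finally show "F y = f y" .
    qed
  qed
  have sub: "ball p \<epsilon> \<subseteq> D" using \<rho>(2) \<rho>(1) by (auto simp: \<epsilon>_def)
  have "F y = f y" if y: "y \<in> ball p \<epsilon>" "q y \<noteq> 0" for y
  proof (rule AE_eq_continuous_imp_eq[OF _ _ _ ae])
    show "open (ball p \<epsilon> - Z)" by (intro open_Diff closedZ open_ball)
    show "continuous_on (ball p \<epsilon> - Z) F"
      by (rule continuous_on_subset[OF holomorphic_Cn_continuous[OF holF]]) auto
    show "continuous_on (ball p \<epsilon> - Z) f"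
      by (rule continuous_on_subset[OF holomorphic_Cn_continuous[OF f]]) (use sub in \<open>auto simp: Z_def\<close>)
  qed (use y in \<open>auto simp: Z_def\<close>)
  then show ?thesis using that[OF \<epsilon> sub holF] by blast
qed

text \<open>
  The local extensions agree where they overlap, since they agree off a null set.
\<close>

lemma holomorphic_Cn_L2_extension:
  fixes f :: "complex ^ 'n \<Rightarrow> complex"
  assumes D: "open D" and q: "polyfun q" "q a \<noteq> 0"
    and f: "holomorphic_Cn f (D - {z. q z = 0})"
    and \<nu>: "continuous_on D \<nu>" "\<And>z. z \<in> D \<Longrightarrow> 0 < \<nu> z"
    and fin: "(\<integral>\<^sup>+z\<in>D - {z. q z = 0}. ennreal ((cmod (f z))\<^sup>2 * \<nu> z) \<partial>lborel) < \<infinity>"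
  obtains g where "holomorphic_Cn g D" "\<And>z. z \<in> D \<Longrightarrow> q z \<noteq> 0 \<Longrightarrow> g z = f z"
proof -
  have "\<forall>p\<in>D. \<exists>\<epsilon> F. 0 < \<epsilon> \<and> ball p \<epsilon> \<subseteq> D \<and> holomorphic_Cn F (ball p \<epsilon>) \<and>
      (\<forall>y\<in>ball p \<epsilon>. q y \<noteq> 0 \<longrightarrow> F y = f y)"
  proof
    fix p assume p: "p \<in> D"
    show "\<exists>\<epsilon> F. 0 < \<epsilon> \<and> ball p \<epsilon> \<subseteq> D \<and> holomorphic_Cn F (ball p \<epsilon>) \<and> (\<forall>y\<in>ball p \<epsilon>. q y \<noteq> 0 \<longrightarrow> F y = f y)"
      by (rule holomorphic_Cn_L2_local_extension[OF D p q f \<nu> fin]) blast+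
  qed
  from bchoice[OF this] obtain \<epsilon> where "\<forall>p\<in>D. \<exists>F. 0 < \<epsilon> p \<and> ball p (\<epsilon> p) \<subseteq> D \<and>
      holomorphic_Cn F (ball p (\<epsilon> p)) \<and> (\<forall>y\<in>ball p (\<epsilon> p). q y \<noteq> 0 \<longrightarrow> F y = f y)" ..
  from bchoice[OF this] obtain F where F': "\<forall>p\<in>D. 0 < \<epsilon> p \<and> ball p (\<epsilon> p) \<subseteq> D \<and>
      holomorphic_Cn (F p) (ball p (\<epsilon> p)) \<and> (\<forall>y\<in>ball p (\<epsilon> p). q y \<noteq> 0 \<longrightarrow> F p y = f y)" ..
  then have F: "\<And>p. p \<in> D \<Longrightarrow> 0 < \<epsilon> p" "\<And>p. p \<in> D \<Longrightarrow> ball p (\<epsilon> p) \<subseteq> D"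
    "\<And>p. p \<in> D \<Longrightarrow> holomorphic_Cn (F p) (ball p (\<epsilon> p))"
    "\<And>p y. p \<in> D \<Longrightarrow> y \<in> ball p (\<epsilon> p) \<Longrightarrow> q y \<noteq> 0 \<Longrightarrow> F p y = f y"
    by auto
  have null: "{z. q z = 0} \<in> null_sets lborel" by (rule polyfun_zeros_null[OF q])
  define g where "g = (\<lambda>y. F y y)"
  have eq: "g y = F p y" if p: "p \<in> D" and y: "y \<in> ball p (\<epsilon> p)" for p y
    unfolding g_def
  proof (rule continuous_eq_off_null_set[where f = "F y" and g = "F p" and U = "ball p (\<epsilon> p) \<inter> ball y (\<epsilon> y)", OF _ _ _ null])
    have yD: "y \<in> D" using F(2) p y by blast
    show "continuous_on (ball p (\<epsilon> p) \<inter> ball y (\<epsilon> y)) (F y)" "continuous_on (ball p (\<epsilon> p) \<inter> ball y (\<epsilon> y)) (F p)"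
      using holomorphic_Cn_continuous[OF F(3)[OF p]] holomorphic_Cn_continuous[OF F(3)[OF yD]]
      by (auto elim: continuous_on_subset)
    show "F y x = F p x" if "x \<in> ball p (\<epsilon> p) \<inter> ball y (\<epsilon> y)" "x \<notin> {z. q z = 0}" for x
      using F(4)[OF p, of x] F(4)[OF yD, of x] that by auto
    show "y \<in> ball p (\<epsilon> p) \<inter> ball y (\<epsilon> y)" using y F(1)[OF yD] by auto
  qed auto
  have "holomorphic_Cn g D"
    unfolding holomorphic_Cn_def
  proof
    fix p assume p: "p \<in> D"
    have "holomorphic_Cn g (ball p (\<epsilon> p))"
      by (rule holomorphic_Cn_cong[OF F(3)[OF p] open_ball]) (simp add: eq[OF p])
    then show "\<exists>L. (g has_derivative L) (at p) \<and> (\<forall>c v. L (c *s v) = c * L v)"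
      using F(1)[OF p] by (auto simp: holomorphic_Cn_def)
  qed
  moreover have "g z = f z" if "z \<in> D" "q z \<noteq> 0" for z
    unfolding g_def using F(1,4)[OF that(1)] that by auto
  ultimately show ?thesis using that by blast
qed


section \<open>Geometry of the quotient map\<close>

lemma matrix_inv_mult:
  assumes "invertible (A :: complex ^ 'n ^ 'n)"
  shows "A ** matrix_inv A = mat 1" "matrix_inv A ** A = mat 1"
  using someI_ex[OF assms[unfolded invertible_def]] unfolding matrix_inv_def by auto

lemma matrix_inv_unique:
  fixes A B :: "complex ^ 'n ^ 'n"
  assumes "A ** B = mat 1" "B ** A = mat 1"
  shows "matrix_inv A = B"
proof -
  have A: "invertible A" using assms by (auto simp: invertible_def)
  have "matrix_inv A = matrix_inv A ** (A ** B)" by (simp add: assms)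
  also have "\<dots> = B" by (simp add: matrix_mul_assoc matrix_inv_mult[OF A])
  finally show ?thesis .
qed

lemma matrix_inv_matrix_inv:
  assumes "invertible (A :: complex ^ 'n ^ 'n)"
  shows "matrix_inv (matrix_inv A) = A"
  by (rule matrix_inv_unique) (rule matrix_inv_mult[OF assms])+

lemma norm_axis_complex: "norm (axis i c :: complex ^ 'n) = cmod c"
  by (simp add: norm_vec_def L2_set_def axis_def if_distrib[where f = cmod] if_distrib[where f = "\<lambda>x. x\<^sup>2"]
      cong: if_cong)

lemma has_derivative_componentwise_vec:
  fixes f :: "'a::real_normed_vector \<Rightarrow> complex ^ 'n"
  assumes "\<And>i. ((\<lambda>z. f z $ i) has_derivative (\<lambda>h. L h $ i)) (at z)"
  shows "(f has_derivative L) (at z)"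
proof -
  have bl: "bounded_linear (axis i :: complex \<Rightarrow> complex ^ 'n)" for i
    by (rule bounded_linear_intro[where K = 1]) (auto simp: norm_axis_complex, auto simp: axis_def vec_eq_iff)
  have expand: "(\<Sum>i\<in>UNIV. axis i (x $ i)) = x" for x :: "complex ^ 'n"
    by (simp add: vec_eq_iff axis_def)
  have "((\<lambda>z. \<Sum>i\<in>UNIV. axis i (f z $ i)) has_derivative (\<lambda>h. \<Sum>i\<in>UNIV. axis i (L h $ i))) (at z)"
    by (intro has_derivative_sum bounded_linear.has_derivative[OF bl] assms)
  then show ?thesis by (simp only: expand)
qed

lemma continuous_on_componentwise_vec:
  fixes f :: "'a::topological_space \<Rightarrow> complex ^ 'n"
  assumes "\<And>i. continuous_on S (\<lambda>z. f z $ i)"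
  shows "continuous_on S f"
  using continuous_on_vec_lambda[of S "\<lambda>i z. f z $ i", OF assms] by simp

lemma holomorphic_Cn_matrix_derivative:
  fixes f :: "complex ^ 'n \<Rightarrow> complex"
  assumes "(f has_derivative L) (at z)" "\<And>c v. L (c *s v) = c * L v"
  shows "L h = (\<Sum>j\<in>UNIV. deriv (\<lambda>t. f (z + axis j t)) 0 * h $ j)"
proof -
  have ax: "axis j t = t *s (axis j 1 :: complex ^ 'n)" for j t by (auto simp: vec_eq_iff axis_def)
  have d: "deriv (\<lambda>t. f (z + axis j t)) 0 = L (axis j 1)" for j
  proof -
    have "((\<lambda>t. f (z + t *s axis j 1)) has_field_derivative L (axis j 1)) (at 0)"
      by (rule has_field_derivative_line) (use assms in auto)
    moreover have "(\<lambda>t. f (z + t *s axis j 1)) = (\<lambda>t. f (z + axis j t))"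
      by (intro ext) (metis ax)
    ultimately show ?thesis by (intro DERIV_imp_deriv) simp
  qed
  have "L h = L (\<Sum>j\<in>UNIV. h $ j *s axis j 1)" by (simp only: basis_expansion)
  also have "\<dots> = (\<Sum>j\<in>UNIV. L (h $ j *s axis j 1))"
    by (rule linear_sum[OF has_derivative_linear[OF assms(1)]])
  finally show ?thesis by (simp add: assms(2) d mult.commute)
qed

locale basic_polynomial_quotient =
  fixes G :: "(complex ^ 'n ^ 'n) set" and \<theta> :: "complex ^ 'n \<Rightarrow> complex ^ 'n"
  assumes finite_G: "finite G" and subgroup_G: "subgroup G GL"
    and basic: "basic_polynomial_map G \<theta>"
begin

abbreviation J :: "complex ^ 'n \<Rightarrow> complex" where "J \<equiv> complex_jacobian \<theta>"

definition jacobian_matrix :: "complex ^ 'n \<Rightarrow> complex ^ 'n ^ 'n" where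
  "jacobian_matrix z = (\<chi> i j. deriv (\<lambda>t. \<theta> (z + axis j t) $ i) 0)"

lemma J_eq: "J z = det (jacobian_matrix z)"
  by (simp add: complex_jacobian_def jacobian_matrix_def)

lemma G_invertible: "s \<in> G \<Longrightarrow> invertible s"
  using subgroup.subset[OF subgroup_G] by (auto simp: GL_def)

lemma G_one: "mat 1 \<in> G"
  using subgroup.one_closed[OF subgroup_G] by (simp add: GL_def)

lemma G_mult: "s \<in> G \<Longrightarrow> t \<in> G \<Longrightarrow> s ** t \<in> G"
  using subgroup.m_closed[OF subgroup_G] by (simp add: GL_def)

lemma G_inv: assumes s: "s \<in> G" shows "matrix_inv s \<in> G"
proof -
  have "m_inv GL s \<in> G" using subgroup.m_inv_closed[OF subgroup_G s] .
  moreover have "m_inv GL s = matrix_inv s"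
  proof -
    have i: "invertible s" using G_invertible[OF s] .
    show ?thesis unfolding m_inv_def
    proof (rule the_equality)
      show "matrix_inv s \<in> carrier GL \<and> s \<otimes>\<^bsub>GL\<^esub> matrix_inv s = \<one>\<^bsub>GL\<^esub> \<and> matrix_inv s \<otimes>\<^bsub>GL\<^esub> s = \<one>\<^bsub>GL\<^esub>"
        using matrix_inv_mult[OF i] by (auto simp: GL_def invertible_def)
      show "y = matrix_inv s" if "y \<in> carrier GL \<and> s \<otimes>\<^bsub>GL\<^esub> y = \<one>\<^bsub>GL\<^esub> \<and> y \<otimes>\<^bsub>GL\<^esub> s = \<one>\<^bsub>GL\<^esub>" for y
        using that matrix_inv_unique[of s y] by (simp add: GL_def)
    qed
  qed
  ultimately show ?thesis by simp
qed

lemma G_inv_act [simp]: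
  assumes "s \<in> G" shows "matrix_inv s *v (s *v z) = z" "s *v (matrix_inv s *v z) = z"
  using matrix_inv_mult[OF G_invertible[OF assms]] by (simp_all add: matrix_vector_mul_assoc)

lemma group_act_matrix_inv: "s \<in> G \<Longrightarrow> group_act (matrix_inv s) z = s *v z"
  by (simp add: group_act_def matrix_inv_matrix_inv G_invertible)

lemma bij_betw_G_mult:
  assumes "s \<in> G" shows "bij_betw (\<lambda>t. t ** s) G G"
proof (rule bij_betw_byWitness[where f' = "\<lambda>t. t ** matrix_inv s"])
  show "\<forall>t\<in>G. t ** s ** matrix_inv s = t" "\<forall>t\<in>G. t ** matrix_inv s ** s = t"
    using matrix_inv_mult[OF G_invertible[OF assms]] by (simp_all add: matrix_mul_assoc[symmetric])
  show "(\<lambda>t. t ** s) ` G \<subseteq> G" "(\<lambda>t. t ** matrix_inv s) ` G \<subseteq> G"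
    using assms by (auto intro: G_mult G_inv)
qed

text \<open>
  Right multiplication by \<open>s\<close> permutes \<open>G\<close>, so the product of all determinants absorbs a factor
  \<open>det s ^ card G\<close>.
\<close>

lemma det_power_card: assumes s: "s \<in> G" shows "det s ^ card G = 1"
proof -
  have "(\<Prod>t\<in>G. det t) = (\<Prod>t\<in>G. det (t ** s))"
    by (rule prod.reindex_bij_betw[OF bij_betw_G_mult[OF s], symmetric])
  also have "\<dots> = (\<Prod>t\<in>G. det t) * det s ^ card G"
    by (simp add: det_mul prod.distrib)
  finally have "(\<Prod>t\<in>G. det t) * det s ^ card G = (\<Prod>t\<in>G. det t) * 1" by simp
  moreover have "(\<Prod>t\<in>G. det t) \<noteq> 0"
    using finite_G G_invertible by (simp add: invertible_det_nz)
  ultimately show ?thesis by simp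
qed

lemma card_G_pos: "0 < card G"
  using finite_G G_one by (auto simp: card_gt_0_iff)

lemma cmod_det: assumes "s \<in> G" shows "cmod (det s) = 1"
proof -
  have "cmod (det s) ^ card G = 1" using det_power_card[OF assms] by (metis norm_one norm_power)
  then show ?thesis using card_G_pos power_eq_1_iff by (metis norm_ge_zero abs_of_nonneg power_eq_imp_eq_base zero_le_one power_one)
qed

definition basic_polynomials :: "'n \<Rightarrow> 'n cpoly" where
  "basic_polynomials = (SOME P. (\<forall>i. homogeneous_cpoly (P i)) \<and> algebraically_independent P \<and>
          invariant_cpolys G = cpoly_subst P ` UNIV \<and> \<theta> = (\<lambda>z. \<chi> i. cpoly_eval (P i) z))"

lemma basic_polynomials:
  "homogeneous_cpoly (basic_polynomials i)"
  "invariant_cpolys G = cpoly_subst basic_polynomials ` UNIV"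
  "\<theta> z = (\<chi> i. cpoly_eval (basic_polynomials i) z)"
proof -
  have *: "(\<forall>i. homogeneous_cpoly (basic_polynomials i)) \<and> algebraically_independent basic_polynomials \<and>
      invariant_cpolys G = cpoly_subst basic_polynomials ` UNIV \<and> \<theta> = (\<lambda>z. \<chi> i. cpoly_eval (basic_polynomials i) z)"
    unfolding basic_polynomials_def by (rule someI_ex[OF basic[unfolded basic_polynomial_map_def]])
  then show "homogeneous_cpoly (basic_polynomials i)"
    "invariant_cpolys G = cpoly_subst basic_polynomials ` UNIV" by blast+
  from * have "\<theta> = (\<lambda>z. \<chi> i. cpoly_eval (basic_polynomials i) z)" by blast
  from fun_cong[OF this, of z] show "\<theta> z = (\<chi> i. cpoly_eval (basic_polynomials i) z)" .
qed

lemma theta_nth: "\<theta> z $ i = cpoly_eval (basic_polynomials i) z"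
  by (simp add: basic_polynomials(3))

lemma polyfun_theta: "polyfun (\<lambda>z. \<theta> z $ i)"
  by (simp add: theta_nth polyfun_cpoly_eval)

lemma theta_continuous: "continuous_on S \<theta>"
  by (rule continuous_on_componentwise_vec) (rule polyfun_continuous[OF polyfun_theta])

lemma theta_invariant: assumes s: "s \<in> G" shows "\<theta> (s *v z) = \<theta> z"
proof -
  have "basic_polynomials i \<in> invariant_cpolys G" for i
    unfolding basic_polynomials(2) by (metis cpoly_subst_coord rangeI)
  then have "cpoly_eval (basic_polynomials i) (group_act (matrix_inv s) z) = cpoly_eval (basic_polynomials i) z" for i
    using G_inv[OF s] by (auto simp: invariant_cpolys_def)
  then show ?thesis by (simp add: group_act_matrix_inv[OF s] theta_nth vec_eq_iff)
qed

lemma invariant_polyfun: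
  assumes f: "polyfun f" and inv: "\<And>s z. s \<in> G \<Longrightarrow> f (s *v z) = f z"
  obtains q where "polyfun q" "\<And>z. f z = q (\<theta> z)"
proof -
  obtain p where p: "f = cpoly_eval p" using polyfun_imp_cpoly[OF f] by blast
  have "p \<in> invariant_cpolys G"
    using inv G_inv by (auto simp: invariant_cpolys_def group_act_def p)
  then obtain r where "p = cpoly_subst basic_polynomials r" unfolding basic_polynomials(2) by blast
  then have "f z = cpoly_eval r (\<theta> z)" for z
    by (simp add: p cpoly_eval_subst basic_polynomials(3))
  then show ?thesis using that polyfun_cpoly_eval by blast
qed

text \<open>
  Invariant polynomials separate orbits. If \<open>z'\<close> is not in the orbit of \<open>z\<close>, take a polynomial that
  vanishes on the orbit of \<open>z\<close> and on the orbit of \<open>z'\<close> except at \<open>z'\<close>, and sum it over the group: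
  the sum is invariant, vanishes at \<open>z\<close>, and at \<open>z'\<close> only the stabilizer contributes.
\<close>

lemma theta_fibre:
  assumes eq: "\<theta> z = \<theta> z'"
  obtains s where "s \<in> G" "z' = s *v z"
proof (rule ccontr)
  assume neg: "\<not> thesis"
  then have z'z: "z' \<noteq> s *v z" if "s \<in> G" for s using that \<open>\<And>s. s \<in> G \<Longrightarrow> z' = s *v z \<Longrightarrow> thesis\<close> by blast
  define B where "B = (\<lambda>s. s *v z) ` G \<union> ((\<lambda>s. s *v z') ` G - {z'})"
  have finB: "finite B" using finite_G by (simp add: B_def)
  have "\<forall>b\<in>B. \<exists>i. z' $ i \<noteq> b $ i"
    using z'z by (auto simp: B_def vec_eq_iff)
  then obtain i where i: "\<And>b. b \<in> B \<Longrightarrow> z' $ i b \<noteq> b $ i b" by metis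
  define p where "p = (\<lambda>x. \<Prod>b\<in>B. x $ i b - b $ i b)"
  have polyp: "polyfun p" unfolding p_def by (intro polyfun_prod polyfun_diff polyfun_coord polyfun_const)
  have p0: "p b = 0" if "b \<in> B" for b unfolding p_def using finB that by (simp add: prod_zero_iff) blast
  have p1: "p z' \<noteq> 0" unfolding p_def using finB i by simp
  define f where "f = (\<lambda>x. \<Sum>t\<in>G. p (t *v x))"
  have "polyfun f" unfolding f_def by (intro polyfun_sum polyfun_matrix polyp)
  moreover have "f (s *v x) = f x" if "s \<in> G" for s x
    unfolding f_def matrix_vector_mul_assoc
    by (rule sum.reindex_bij_betw[OF bij_betw_G_mult[OF that], of "\<lambda>t. p (t *v x)"])
  ultimately obtain q where "\<And>x. f x = q (\<theta> x)" using invariant_polyfun by blast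
  then have "f z = f z'" using eq by simp
  moreover have "f z = 0" unfolding f_def by (intro sum.neutral ballI p0) (auto simp: B_def)
  moreover have "f z' = of_nat (card {t \<in> G. t *v z' = z'}) * p z'"
  proof -
    have "f z' = (\<Sum>t\<in>{t \<in> G. t *v z' = z'}. p (t *v z'))"
      unfolding f_def using finite_G by (intro sum.mono_neutral_right) (auto intro!: p0 simp: B_def)
    also have "\<dots> = (\<Sum>t\<in>{t \<in> G. t *v z' = z'}. p z')" by (rule sum.cong) auto
    finally show ?thesis by simp
  qed
  moreover have "card {t \<in> G. t *v z' = z'} \<noteq> 0"
    using finite_G G_one by (auto simp: card_eq_0_iff)
  ultimately show False using p1 by simp
qed

lemma theta_has_derivative: "(\<theta> has_derivative (\<lambda>h. jacobian_matrix z *v h)) (at z)"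
proof (rule has_derivative_componentwise_vec)
  fix i
  obtain L where L: "((\<lambda>z. \<theta> z $ i) has_derivative L) (at z)" "\<And>c v. L (c *s v) = c * L v"
    using holomorphic_CnD[OF polyfun_holomorphic[OF polyfun_theta], of z UNIV] by blast
  have "L = (\<lambda>h. (jacobian_matrix z *v h) $ i)"
    using holomorphic_Cn_matrix_derivative[OF L]
    by (simp add: jacobian_matrix_def matrix_vector_mult_def fun_eq_iff)
  then show "((\<lambda>z. \<theta> z $ i) has_derivative (\<lambda>h. (jacobian_matrix z *v h) $ i)) (at z)" using L(1) by simp
qed

lemma polyfun_J: "polyfun J"
proof -
  have "polyfun (\<lambda>z. deriv (\<lambda>t. \<theta> (z + axis j t) $ i) 0)" for i j
  proof -
    obtain g where g: "polyfun g" "\<And>z. ((\<lambda>t. \<theta> (z + axis j t) $ i) has_field_derivative g z) (at 0)"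
      by (rule polyfun_partial_derivative[OF polyfun_theta[of i], of j]) (rule that)
    have "(\<lambda>z. deriv (\<lambda>t. \<theta> (z + axis j t) $ i) 0) = g"
      using g(2) by (intro ext DERIV_imp_deriv)
    with g(1) show ?thesis by simp
  qed
  then show ?thesis unfolding complex_jacobian_def[abs_def] by (intro polyfun_det)
qed

text \<open>
  The chain rule for \<open>\<theta> \<circ> s = \<theta>\<close>.
\<close>

lemma jacobian_matrix_equivariant:
  assumes s: "s \<in> G" shows "jacobian_matrix (s *v z) ** s = jacobian_matrix z"
proof -
  have "((\<lambda>z. \<theta> (s *v z)) has_derivative (\<lambda>h. jacobian_matrix (s *v z) *v (s *v h))) (at z)"
    by (rule has_derivative_compose[OF bounded_linear_imp_has_derivative theta_has_derivative])
       (rule matrix_vector_mul_bounded_linear)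
  then have "(\<theta> has_derivative (\<lambda>h. jacobian_matrix (s *v z) *v (s *v h))) (at z)"
    by (simp add: theta_invariant[OF s])
  from has_derivative_unique[OF this theta_has_derivative]
  have "(jacobian_matrix (s *v z) ** s) *v h = jacobian_matrix z *v h" for h
    by (simp add: fun_eq_iff matrix_vector_mul_assoc)
  then show ?thesis by (simp add: matrix_eq)
qed

lemma J_equivariant: "s \<in> G \<Longrightarrow> J (s *v z) * det s = J z"
  by (metis J_eq det_mul jacobian_matrix_equivariant)

lemma J_zero_iff: "s \<in> G \<Longrightarrow> J (s *v z) = 0 \<longleftrightarrow> J z = 0"
  using J_equivariant[of s z] cmod_det[of s] by auto

text \<open>
  At a fixed point of \<open>s\<close> the chain rule reads \<open>\<theta>' s = \<theta>'\<close>, and \<open>\<theta>'\<close> can be cancelled.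
\<close>

lemma trivial_stabilizer:
  assumes J: "J z \<noteq> 0" and s: "s \<in> G" "s *v z = z"
  shows "s = mat 1"
proof -
  have "invertible (jacobian_matrix z)" using J by (simp add: J_eq invertible_det_nz)
  then obtain B where B: "B ** jacobian_matrix z = mat 1" by (auto simp: invertible_def)
  have "jacobian_matrix z ** s = jacobian_matrix z" using jacobian_matrix_equivariant[OF s(1), of z] s(2) by simp
  then have "B ** jacobian_matrix z ** s = B ** jacobian_matrix z" by (simp add: matrix_mul_assoc[symmetric])
  then show ?thesis by (simp add: B)
qed

text \<open>
  The finitely many group elements other than the identity move a small ball about a free point off
  itself, while points with equal images differ by a group element.
\<close>

lemma theta_locally_injective:
  assumes free: "\<And>s. s \<in> G \<Longrightarrow> s *v z = z \<Longrightarrow> s = mat 1" and U: "open U" "z \<in> U"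
  obtains \<epsilon> where "0 < \<epsilon>" "ball z \<epsilon> \<subseteq> U" "inj_on \<theta> (ball z \<epsilon>)"
proof -
  have "\<exists>\<epsilon>>0. \<forall>x\<in>ball z \<epsilon>. \<forall>y\<in>ball z \<epsilon>. s *v x \<noteq> y" if s: "s \<in> G - {mat 1}" for s
  proof -
    define d where "d = dist (s *v z) z"
    have "0 < d" using free s by (auto simp: d_def)
    moreover have "isCont ((*v) s) z"
      by (rule linear_continuous_at) (rule matrix_vector_mul_bounded_linear)
    ultimately obtain \<delta> where \<delta>: "0 < \<delta>" "\<And>x. dist x z < \<delta> \<Longrightarrow> dist (s *v x) (s *v z) < d / 2"
      unfolding continuous_at_eps_delta by (meson half_gt_zero)
    have "s *v x \<noteq> y" if "x \<in> ball z (min \<delta> (d / 2))" "y \<in> ball z (min \<delta> (d / 2))" for x y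
    proof
      assume "s *v x = y"
      then have "d \<le> dist (s *v x) (s *v z) + dist y z"
        unfolding d_def by (metis dist_commute dist_triangle)
      moreover have "dist (s *v x) (s *v z) < d / 2" using \<delta>(2)[of x] that by (simp add: dist_commute)
      moreover have "dist y z < d / 2" using that by (simp add: dist_commute)
      ultimately show False by simp
    qed
    then show ?thesis using \<delta>(1) \<open>0 < d\<close> by (intro exI[of _ "min \<delta> (d / 2)"]) auto
  qed
  then obtain \<epsilon> where \<epsilon>: "\<And>s. s \<in> G - {mat 1} \<Longrightarrow> 0 < \<epsilon> s"
    "\<And>s x y. s \<in> G - {mat 1} \<Longrightarrow> x \<in> ball z (\<epsilon> s) \<Longrightarrow> y \<in> ball z (\<epsilon> s) \<Longrightarrow> s *v x \<noteq> y"
    by metis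
  obtain r where r: "0 < r" "ball z r \<subseteq> U" using U open_contains_ball by blast
  define e where "e = Min (insert r (\<epsilon> ` (G - {mat 1})))"
  have e: "0 < e" "e \<le> r" "\<And>s. s \<in> G - {mat 1} \<Longrightarrow> e \<le> \<epsilon> s"
    using finite_G r(1) \<epsilon>(1) by (auto simp: e_def)
  have "inj_on \<theta> (ball z e)"
  proof (rule inj_onI)
    fix x y assume xy: "x \<in> ball z e" "y \<in> ball z e" "\<theta> x = \<theta> y"
    obtain s where s: "s \<in> G" "y = s *v x" using theta_fibre[OF xy(3)] .
    have "s = mat 1"
    proof (rule ccontr)
      assume "s \<noteq> mat 1"
      then have "s \<in> G - {mat 1}" using s by blast
      then show False using \<epsilon>(2)[of s x y] e(3)[of s] xy s(2) by auto
    qed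
    then show "x = y" using s(2) by simp
  qed
  moreover have "ball z e \<subseteq> U" using e(2) r(2) by (auto simp: subset_iff)
  ultimately show ?thesis using that e(1) by blast
qed

text \<open>
  The fixed points of the group elements other than the identity form finitely many proper
  subspaces.
\<close>

lemma exists_free_point: "\<exists>z. \<forall>s\<in>G. s *v z = z \<longrightarrow> s = mat 1"
proof (rule ccontr)
  assume "\<not> ?thesis"
  then have "(\<Union>s\<in>G - {mat 1}. {z. s *v z = z}) = UNIV" by auto
  moreover have "(\<Union>s\<in>G - {mat 1}. {z. s *v z = z}) \<in> null_sets lborel"
  proof (rule null_sets_UN')
    fix s assume s: "s \<in> G - {mat 1}"
    then obtain a where "s *v a \<noteq> a" by (metis DiffE insertI1 matrix_eq matrix_vector_mul_lid)
    then obtain i where i: "(s *v a) $ i - a $ i \<noteq> 0" by (auto simp: vec_eq_iff)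
    have "{z. (s *v z) $ i - z $ i = 0} \<in> null_sets lborel"
      by (rule polyfun_zeros_null[where q = "\<lambda>z. (s *v z) $ i - z $ i" and a = a, OF _ i]) (intro polyfun_diff polyfun_coord polyfun_matrix[OF polyfun_coord])
    moreover have "closed {z. s *v z = z}"
      by (intro closed_Collect_eq linear_continuous_on matrix_vector_mul_bounded_linear continuous_on_id)
    then have "{z. s *v z = z} \<in> sets lborel" by auto
    ultimately show "{z. s *v z = z} \<in> null_sets lborel"
      by (rule null_sets_subset) auto
  qed (use finite_G in \<open>auto intro: countable_finite\<close>)
  ultimately have "(UNIV :: (complex ^ 'n) set) \<in> null_sets lborel"
    by (simp only:)
  then show False by (auto simp: null_sets_def)
qed

text \<open>
  Near a free point \<open>\<theta>\<close> is injective, hence open by invariance of domain; but if \<open>J\<close> vanished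
  identically, the image would be a null set.
\<close>

lemma exists_J_nonzero: "\<exists>z. J z \<noteq> 0"
proof (rule ccontr)
  assume "\<not> ?thesis"
  then have J0: "J z = 0" for z by auto
  obtain z where z: "\<And>s. s \<in> G \<Longrightarrow> s *v z = z \<Longrightarrow> s = mat 1" using exists_free_point by blast
  obtain \<epsilon> where \<epsilon>: "0 < \<epsilon>" "inj_on \<theta> (ball z \<epsilon>)"
    by (rule theta_locally_injective[OF z open_UNIV UNIV_I])
  have op: "open (\<theta> ` ball z \<epsilon>)" by (rule invariance_of_domain[OF theta_continuous open_ball \<epsilon>(2)])
  have "emeasure lborel (\<theta> ` ball z \<epsilon>) = (\<integral>\<^sup>+x\<in>ball z \<epsilon>. ennreal ((cmod (det (jacobian_matrix x)))\<^sup>2) \<partial>lborel)"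
  proof (rule emeasure_injective_image)
    show "continuous_on UNIV (\<lambda>z. det (jacobian_matrix z))"
      using polyfun_continuous[OF polyfun_J] by (simp add: J_eq[abs_def])
  qed (use op \<epsilon> theta_has_derivative in auto)
  also have "\<dots> = 0" using J0 by (simp add: J_eq)
  finally have "\<theta> ` ball z \<epsilon> \<in> null_sets lborel" using op by auto
  then have "negligible (\<theta> ` ball z \<epsilon>)" by (simp add: negligible_iff_null_sets null_sets_completionI)
  moreover have "\<theta> ` ball z \<epsilon> \<noteq> {}" using \<epsilon>(1) by simp
  ultimately show False using op open_not_negligible by blast
qed

lemma J_zeros_null: "{z. J z = 0} \<in> null_sets lborel"
  using exists_J_nonzero polyfun_zeros_null[OF polyfun_J] by blast

lemma discriminant_exists:
  obtains q where "polyfun q" "\<And>z. q (\<theta> z) = J z ^ card G"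
proof -
  have "J (s *v z) ^ card G = J z ^ card G" if "s \<in> G" for s z
    using arg_cong[OF J_equivariant[OF that, of z], of "\<lambda>x. x ^ card G"] det_power_card[OF that]
    by (simp add: power_mult_distrib)
  then show ?thesis
    using invariant_polyfun[OF polyfun_power[OF polyfun_J, of "card G"]] that by metis
qed

text \<open>
  The power \<open>J ^ card G\<close> is an invariant polynomial, hence a polynomial in \<open>\<theta>\<close>. The zero set of this
  polynomial is the set of critical values of \<open>\<theta>\<close>.
\<close>

definition discriminant :: "complex ^ 'n \<Rightarrow> complex" where
  "discriminant = (SOME q. polyfun q \<and> (\<forall>z. q (\<theta> z) = J z ^ card G))"

lemma discriminant: "polyfun discriminant" "discriminant (\<theta> z) = J z ^ card G"
proof -
  have "\<exists>q. polyfun q \<and> (\<forall>z. q (\<theta> z) = J z ^ card G)" using discriminant_exists by blast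
  from someI_ex[OF this] show "polyfun discriminant" "discriminant (\<theta> z) = J z ^ card G"
    unfolding discriminant_def[symmetric] by auto
qed

lemma discriminant_zero_iff: "discriminant (\<theta> z) = 0 \<longleftrightarrow> J z = 0"
  using card_G_pos by (simp add: discriminant)

lemma exists_discriminant_nonzero: "\<exists>x. discriminant x \<noteq> 0"
  using exists_J_nonzero discriminant_zero_iff by blast

lemma discriminant_zeros_null: "{x. discriminant x = 0} \<in> null_sets lborel"
  using exists_discriminant_nonzero polyfun_zeros_null[OF discriminant(1)] by blast

text \<open>
  The degrees are positive: a constant component of \<open>\<theta>\<close> would give \<open>J\<close> a vanishing row.
\<close>

lemma theta_homogeneous:
  obtains k where "\<And>i. 0 < k i" "\<And>t z i. \<theta> (t *s z) $ i = t ^ k i * \<theta> z $ i"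
proof -
  have "\<forall>i. \<exists>k. \<forall>m\<in>Poly_Mapping.keys (basic_polynomials i). (\<Sum>j\<in>UNIV. Poly_Mapping.lookup m j) = k"
    using basic_polynomials(1) unfolding homogeneous_cpoly_def by blast
  then obtain k where k: "\<And>i m. m \<in> Poly_Mapping.keys (basic_polynomials i) \<Longrightarrow> (\<Sum>j\<in>UNIV. Poly_Mapping.lookup m j) = k i"
    by metis
  have hom: "\<theta> (t *s z) $ i = t ^ k i * \<theta> z $ i" for t z i
    unfolding theta_nth cpoly_eval_def sum_distrib_left
  proof (rule sum.cong[OF refl])
    fix m assume m: "m \<in> Poly_Mapping.keys (basic_polynomials i)"
    have "(\<Prod>j\<in>UNIV. (t *s z) $ j ^ Poly_Mapping.lookup m j) = t ^ k i * (\<Prod>j\<in>UNIV. z $ j ^ Poly_Mapping.lookup m j)"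
      by (simp add: power_mult_distrib prod.distrib power_sum[symmetric] k[OF m])
    then show "Poly_Mapping.lookup (basic_polynomials i) m * (\<Prod>j\<in>UNIV. (t *s z) $ j ^ Poly_Mapping.lookup m j)
      = t ^ k i * (Poly_Mapping.lookup (basic_polynomials i) m * (\<Prod>j\<in>UNIV. z $ j ^ Poly_Mapping.lookup m j))"
      by simp
  qed
  have "0 < k i" for i
  proof (rule ccontr)
    assume "\<not> 0 < k i"
    then have "\<theta> z $ i = \<theta> 0 $ i" for z using hom[of 0 z i] by simp
    then have "(\<lambda>t. \<theta> (z + axis j t) $ i) = (\<lambda>t. \<theta> 0 $ i)" for z j by (intro ext)
    then have "jacobian_matrix z $ i = 0" for z
      by (simp add: jacobian_matrix_def vec_eq_iff)
    then have "J z = 0" for z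
      unfolding J_eq by (intro det_zero_row) (auto simp: row_def vec_eq_iff)
    then show False using exists_J_nonzero by blast
  qed
  then show ?thesis using hom that by blast
qed

text \<open>
  On the unit sphere \<open>\<theta>\<close> does not vanish, since the fibre of 0 is the orbit of 0. Homogeneity of
  positive degree propagates the resulting lower bound.
\<close>

lemma theta_growth:
  obtains c where "0 < c" "\<And>z. 1 \<le> norm z \<Longrightarrow> c * norm z \<le> norm (\<theta> z)"
proof -
  obtain k where k: "\<And>i. 0 < k i" "\<And>t z i. \<theta> (t *s z) $ i = t ^ k i * \<theta> z $ i"
    using theta_homogeneous by blast
  have "\<theta> 0 $ i = 0" for i using k(2)[of 0 0 i] k(1)[of i] by (auto simp: zero_power)
  then have \<theta>0: "\<theta> 0 = 0" by (simp add: vec_eq_iff)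
  have nz: "\<theta> u \<noteq> 0" if "norm u = 1" for u
  proof
    assume "\<theta> u = 0"
    then have eq: "\<theta> 0 = \<theta> u" using \<theta>0 by simp
    obtain s where "s \<in> G" "u = s *v 0" by (rule theta_fibre[OF eq])
    then have "u = 0" by simp
    then show False using that by simp
  qed
  have "norm (axis undefined 1 :: complex ^ 'n) = 1" by (simp add: norm_axis_complex)
  then have "sphere (0 :: complex ^ 'n) 1 \<noteq> {}" by auto
  then have "(\<lambda>u. norm (\<theta> u)) ` sphere 0 1 \<noteq> {}" by simp
  moreover have "compact ((\<lambda>u. norm (\<theta> u)) ` sphere 0 1)"
    by (intro compact_continuous_image continuous_on_norm theta_continuous) auto
  ultimately have "\<exists>c\<in>(\<lambda>u. norm (\<theta> u)) ` sphere 0 1. \<forall>t\<in>(\<lambda>u. norm (\<theta> u)) ` sphere 0 1. c \<le> t"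
    by (intro compact_attains_inf)
  then obtain u where u: "norm u = 1" "\<And>x. norm x = 1 \<Longrightarrow> norm (\<theta> u) \<le> norm (\<theta> x)" by auto
  have "norm (\<theta> u) * norm z \<le> norm (\<theta> z)" if z: "1 \<le> norm z" for z
  proof -
    define x where "x = (1 / norm z) *\<^sub>R z"
    have x: "norm x = 1" "z = complex_of_real (norm z) *s x"
      using z by (auto simp: x_def vector_smult_scaleR)
    have "norm (norm z *\<^sub>R \<theta> x) \<le> norm (\<theta> z)"
    proof (rule norm_le_componentwise_cart)
      fix i
      have "norm z ^ 1 \<le> norm z ^ k i" using z k(1)[of i] by (intro power_increasing) auto
      then have "norm z * cmod (\<theta> x $ i) \<le> norm z ^ k i * cmod (\<theta> x $ i)" by (intro mult_right_mono) auto
      also have "\<dots> = cmod (\<theta> z $ i)"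
        using k(2)[of "complex_of_real (norm z)" x i] x(2) by (simp add: norm_mult norm_power)
      finally show "cmod ((norm z *\<^sub>R \<theta> x) $ i) \<le> cmod (\<theta> z $ i)" by simp
    qed
    moreover have "norm (\<theta> u) * norm z \<le> norm (\<theta> x) * norm z" using u(2)[OF x(1)] by (intro mult_right_mono) auto
    ultimately show ?thesis by (simp add: mult.commute)
  qed
  moreover have "0 < norm (\<theta> u)" using nz[OF u(1)] by simp
  ultimately show ?thesis using that by blast
qed

text \<open>
  By \<open>theta_growth\<close> preimages of bounded sets are bounded.
\<close>

lemma theta_closed_map: assumes C: "closed C" shows "closed (\<theta> ` C)"
  unfolding closed_sequential_limits
proof (intro allI impI, elim conjE)
  fix y l assume y: "\<forall>n. y n \<in> \<theta> ` C" and lim: "y \<longlonglongrightarrow> l"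
  then have "\<forall>n. \<exists>x. x \<in> C \<and> y n = \<theta> x" by blast
  then obtain x where x: "\<And>n. x n \<in> C" "\<And>n. y n = \<theta> (x n)" by metis
  obtain c where c: "0 < c" "\<And>z. 1 \<le> norm z \<Longrightarrow> c * norm z \<le> norm (\<theta> z)" using theta_growth by blast
  have "bounded (range y)" using lim by (rule convergent_imp_bounded)
  then obtain B where B: "\<And>n. norm (y n) \<le> B" unfolding bounded_iff by blast
  have "norm (x n) \<le> max 1 (B / c)" for n
  proof (cases "1 \<le> norm (x n)")
    case True
    then have "c * norm (x n) \<le> B" using c(2)[OF True] B[of n] x(2) by simp
    then show ?thesis using c(1) by (simp add: field_simps le_max_iff_disj)
  qed simp
  then have "bounded (range x)" unfolding bounded_iff by blast
  then obtain z r where zr: "strict_mono r" "(x \<circ> r) \<longlonglongrightarrow> z" using bounded_imp_convergent_subsequence by blast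
  have "z \<in> C" using closed_sequentially[OF C _ zr(2)] x(1) by simp
  moreover have "\<theta> z = l"
  proof (rule LIMSEQ_unique)
    have "isCont \<theta> z" using theta_continuous[of UNIV] by (simp add: continuous_on_eq_continuous_at)
    then show "(\<lambda>n. \<theta> ((x \<circ> r) n)) \<longlonglongrightarrow> \<theta> z" using zr(2) isCont_tendsto_compose by blast
    have "(\<lambda>n. \<theta> ((x \<circ> r) n)) = y \<circ> r" using x(2) by (auto simp: fun_eq_iff)
    then show "(\<lambda>n. \<theta> ((x \<circ> r) n)) \<longlonglongrightarrow> l" using LIMSEQ_subseq_LIMSEQ[OF lim zr(1)] by simp
  qed
  ultimately show "l \<in> \<theta> ` C" by blast
qed

lemma regular_values_open: "open (range \<theta> \<inter> {x. discriminant x \<noteq> 0})"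
  unfolding open_subopen[of "range \<theta> \<inter> {x. discriminant x \<noteq> 0}"]
proof
  fix x assume "x \<in> range \<theta> \<inter> {x. discriminant x \<noteq> 0}"
  then obtain z where z: "x = \<theta> z" "J z \<noteq> 0" using discriminant_zero_iff by auto
  have "open {z. J z \<noteq> 0}"
    by (intro open_Collect_neq polyfun_continuous[OF polyfun_J] continuous_on_const)
  then obtain \<epsilon> where \<epsilon>: "0 < \<epsilon>" "ball z \<epsilon> \<subseteq> {z. J z \<noteq> 0}" "inj_on \<theta> (ball z \<epsilon>)"
    using theta_locally_injective[of z "{z. J z \<noteq> 0}"] trivial_stabilizer[OF z(2)] z(2) by blast
  have "open (\<theta> ` ball z \<epsilon>)" by (rule invariance_of_domain[OF theta_continuous open_ball \<epsilon>(3)])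
  moreover have "\<theta> ` ball z \<epsilon> \<subseteq> range \<theta> \<inter> {x. discriminant x \<noteq> 0}"
    using \<epsilon>(2) discriminant_zero_iff by auto
  moreover have "x \<in> \<theta> ` ball z \<epsilon>" using z(1) \<epsilon>(1) by auto
  ultimately show "\<exists>T. open T \<and> x \<in> T \<and> T \<subseteq> range \<theta> \<inter> {x. discriminant x \<noteq> 0}" by blast
qed

text \<open>
  The image is closed, and open away from the zeros of the discriminant. Join a value to a point
  outside the image by a complex line: the discriminant has finitely many zeros on it, so the rest
  of the line is connected and cannot be split into points inside and outside the image.
\<close>

lemma theta_surjective: "range \<theta> = UNIV"
proof (rule ccontr)
  assume "range \<theta> \<noteq> UNIV"
  then have ne: "- range \<theta> \<noteq> {}" by auto
  have cl: "closed (range \<theta>)" by (rule theta_closed_map) simp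
  then have "\<not> negligible (- range \<theta>)" using ne open_not_negligible by blast
  moreover have "negligible {x. discriminant x = 0}"
    using discriminant_zeros_null by (simp add: negligible_iff_null_sets null_sets_completionI)
  ultimately have "\<not> - range \<theta> \<subseteq> {x. discriminant x = 0}" using negligible_subset by blast
  then obtain y where y: "y \<notin> range \<theta>" "discriminant y \<noteq> 0" by blast
  obtain z where z: "J z \<noteq> 0" using exists_J_nonzero by blast
  define x where "x = \<theta> z"
  have x: "discriminant x \<noteq> 0" using z by (simp add: x_def discriminant_zero_iff)
  define \<gamma> where "\<gamma> = (\<lambda>t. x + t *s (y - x))"
  have \<gamma>: "\<gamma> 0 = x" "\<gamma> 1 = y" by (simp_all add: \<gamma>_def)
  have cont: "continuous_on UNIV \<gamma>" unfolding \<gamma>_def by (intro continuous_intros)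
  define A where "A = {t. discriminant (\<gamma> t) = 0}"
  have "finite A" unfolding A_def \<gamma>_def
    by (rule polyfun_finite_zeros_on_line[OF discriminant(1), of x 0]) (simp add: x)
  then have conn: "connected (UNIV - A)"
    by (intro connected_open_delete_finite) auto
  define U where "U = \<gamma> -` (range \<theta> \<inter> {x. discriminant x \<noteq> 0})"
  define V where "V = \<gamma> -` (- range \<theta>)"
  have "open U" unfolding U_def by (rule open_vimage[OF regular_values_open cont])
  moreover have "open V" unfolding V_def by (rule open_vimage[OF open_Compl[OF cl] cont])
  moreover have "U \<inter> V \<inter> (UNIV - A) = {}" by (auto simp: U_def V_def)
  moreover have "UNIV - A \<subseteq> U \<union> V" by (auto simp: U_def V_def A_def)
  ultimately have "U \<inter> (UNIV - A) = {} \<or> V \<inter> (UNIV - A) = {}"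
    by (rule connectedD[OF conn])
  moreover have "0 \<in> U \<inter> (UNIV - A)" using x \<gamma> by (auto simp: U_def A_def x_def)
  moreover have "1 \<in> V \<inter> (UNIV - A)" using y \<gamma> by (auto simp: V_def A_def)
  ultimately show False by blast
qed

lemma theta_image_open:
  assumes "open \<Omega>" and inv: "\<And>s z. s \<in> G \<Longrightarrow> z \<in> \<Omega> \<Longrightarrow> s *v z \<in> \<Omega>"
  shows "open (\<theta> ` \<Omega>)"
proof -
  have "- \<theta> ` \<Omega> = \<theta> ` (- \<Omega>)"
  proof
    show "- \<theta> ` \<Omega> \<subseteq> \<theta> ` (- \<Omega>)"
    proof
      fix x assume x: "x \<in> - \<theta> ` \<Omega>"
      have "x \<in> range \<theta>" by (simp only: theta_surjective UNIV_I)
      then obtain z where z: "x = \<theta> z" by (rule rangeE)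
      then have "z \<in> - \<Omega>" using x by auto
      then show "x \<in> \<theta> ` (- \<Omega>)" using z by (rule rev_image_eqI)
    qed
    show "\<theta> ` (- \<Omega>) \<subseteq> - \<theta> ` \<Omega>"
    proof (rule image_subsetI)
      fix x assume x: "x \<in> - \<Omega>"
      show "\<theta> x \<in> - \<theta> ` \<Omega>"
      proof
        assume "\<theta> x \<in> \<theta> ` \<Omega>"
        then obtain z where z: "z \<in> \<Omega>" "\<theta> z = \<theta> x" by (metis imageE)
        obtain s where "s \<in> G" "x = s *v z" by (rule theta_fibre[OF z(2)])
        then show False using inv z x by blast
      qed
    qed
  qed
  moreover have "closed (\<theta> ` (- \<Omega>))" by (rule theta_closed_map) (use assms(1) in auto)
  ultimately have "closed (- \<theta> ` \<Omega>)" by (simp only:)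
  then show ?thesis unfolding closed_def double_compl .
qed

end


section \<open>Integration along the quotient map\<close>

locale basic_polynomial_domain = basic_polynomial_quotient G \<theta>
  for G :: "(complex ^ 'n ^ 'n) set" and \<theta> +
  fixes \<Omega> :: "(complex ^ 'n) set"
  assumes open_\<Omega>: "open \<Omega>" and bounded_\<Omega>: "bounded \<Omega>"
    and invariant_\<Omega>: "\<And>s z. s \<in> G \<Longrightarrow> z \<in> \<Omega> \<Longrightarrow> s *v z \<in> \<Omega>"
begin

abbreviation D :: "(complex ^ 'n) set" where "D \<equiv> \<theta> ` \<Omega>"

lemma open_D: "open D"
  using open_\<Omega> invariant_\<Omega> by (rule theta_image_open)

definition regular_part :: "(complex ^ 'n) set" where
  "regular_part = \<Omega> - {z. J z = 0}"

lemma open_regular_part: "open regular_part"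
  unfolding regular_part_def
  by (intro open_Diff open_\<Omega> closed_Collect_eq polyfun_continuous[OF polyfun_J] continuous_on_const)

lemma regular_part_invariant: "s \<in> G \<Longrightarrow> z \<in> regular_part \<Longrightarrow> s *v z \<in> regular_part"
  using invariant_\<Omega> by (simp add: regular_part_def J_zero_iff)

lemma theta_regular_part: "\<theta> ` regular_part = D - {x. discriminant x = 0}"
  by (auto simp: regular_part_def discriminant_zero_iff)

lemma regular_part_locally_injective:
  assumes "z \<in> regular_part"
  obtains \<epsilon> where "0 < \<epsilon>" "ball z \<epsilon> \<subseteq> regular_part" "inj_on \<theta> (ball z \<epsilon>)"
proof (rule theta_locally_injective[OF _ open_regular_part assms])
  show "s = mat 1" if "s \<in> G" "s *v z = z" for s
    using trivial_stabilizer[OF _ that] assms by (simp add: regular_part_def)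
qed

lemma G_act_continuous: "continuous_on S ((*v) s)" for s :: "complex ^ 'n ^ 'n"
  by (intro linear_continuous_on matrix_vector_mul_bounded_linear)

lemma G_act_measurable [measurable]: "(*v) s \<in> borel \<rightarrow>\<^sub>M borel" for s :: "complex ^ 'n ^ 'n"
  by (intro borel_measurable_continuous_onI G_act_continuous)

lemma G_act_image: "s \<in> G \<Longrightarrow> (*v) s ` X = (*v) (matrix_inv s) -` X"
  by (auto, metis G_inv_act(2) image_eqI)

text \<open>
  Cover the regular part by countably many open sets on which \<open>\<theta>\<close> is injective, and remove from each
  the orbits of its predecessors. Every orbit then meets the union of what remains in one point.
\<close>

lemma fundamental_domain:
  obtains F where "F \<in> sets borel" "F \<subseteq> regular_part" "inj_on \<theta> F"
    "\<And>z. z \<in> regular_part \<Longrightarrow> \<exists>s\<in>G. \<exists>x\<in>F. z = s *v x"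
proof -
  define \<F> where "\<F> = {U. open U \<and> U \<subseteq> regular_part \<and> inj_on \<theta> U}"
  have cover: "\<Union>\<F> = regular_part"
  proof
    show "regular_part \<subseteq> \<Union>\<F>"
    proof
      fix z assume z: "z \<in> regular_part"
      obtain \<epsilon> where \<epsilon>: "0 < \<epsilon>" "ball z \<epsilon> \<subseteq> regular_part" "inj_on \<theta> (ball z \<epsilon>)"
        by (rule regular_part_locally_injective[OF z])
      then have "ball z \<epsilon> \<in> \<F>" by (simp add: \<F>_def)
      moreover have "z \<in> ball z \<epsilon>" using \<epsilon>(1) by simp
      ultimately show "z \<in> \<Union>\<F>" by blast
    qed
  qed (auto simp: \<F>_def)
  obtain \<F>' where \<F>': "\<F>' \<subseteq> \<F>" "countable \<F>'" "\<Union>\<F>' = \<Union>\<F>"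
    by (rule Lindelof_openin[of \<F> UNIV]) (auto simp: \<F>_def)
  define U where "U = from_nat_into (insert {} \<F>')"
  have rangeU: "range U = insert {} \<F>'"
    unfolding U_def by (rule range_from_nat_into) (use \<F>'(2) in auto)
  have U: "open (U k)" "U k \<subseteq> regular_part" "inj_on \<theta> (U k)" for k
  proof -
    have "U k \<in> insert {} \<F>'" using rangeU by blast
    then have "U k = {} \<or> U k \<in> \<F>" using \<F>'(1) by blast
    then show "open (U k)" "U k \<subseteq> regular_part" "inj_on \<theta> (U k)" by (auto simp: \<F>_def)
  qed
  have coverU: "(\<Union>k. U k) = regular_part" using rangeU \<F>'(3) cover by simp
  (* W k is the saturation of U k; the first k with z in W k decides which piece meets the orbit of z. *)
  define W where "W = (\<lambda>k. \<Union>s\<in>G. (*v) s ` U k)"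
  have openW: "open (W k)" for k
    unfolding W_def by (intro open_UN ballI) (simp add: G_act_image open_vimage[OF U(1) G_act_continuous])
  define V where "V = (\<lambda>k. U k - (\<Union>j<k. W j))"
  define F where "F = (\<Union>k. V k)"
  have "F \<in> sets borel" unfolding F_def V_def
    by (intro sets.countable_UN sets.Diff borel_open U(1) image_subsetI open_UN ballI openW)
  moreover have "F \<subseteq> regular_part" using U(2) by (auto simp: F_def V_def)
  moreover have "inj_on \<theta> F"
  proof (rule inj_onI)
    fix x y assume "x \<in> F" "y \<in> F" and eq: "\<theta> x = \<theta> y"
    then obtain i j where ij: "x \<in> V i" "y \<in> V j" by (auto simp: F_def)
    obtain s where s: "s \<in> G" "y = s *v x" by (rule theta_fibre[OF eq])
    obtain t where t: "t \<in> G" "x = t *v y" by (rule theta_fibre[OF eq[symmetric]])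
    have "\<not> i < j"
    proof
      assume "i < j"
      moreover have "y \<in> W i" using s ij(1) by (auto simp: W_def V_def)
      ultimately show False using ij(2) by (auto simp: V_def)
    qed
    moreover have "\<not> j < i"
    proof
      assume "j < i"
      moreover have "x \<in> W j" using t ij(2) by (auto simp: W_def V_def)
      ultimately show False using ij(1) by (auto simp: V_def)
    qed
    ultimately have "i = j" by simp
    then have "x \<in> U i" "y \<in> U i" using ij by (auto simp: V_def)
    then show "x = y" using U(3) eq by (auto dest: inj_onD)
  qed
  moreover have "\<exists>s\<in>G. \<exists>x\<in>F. z = s *v x" if z: "z \<in> regular_part" for z
  proof -
    define k where "k = (LEAST k. z \<in> W k)"
    have "\<exists>k. z \<in> W k"
    proof -
      obtain k where "z \<in> U k" using z coverU by blast
      then have "z \<in> W k" unfolding W_def by (intro UN_I[OF G_one] image_eqI[of z _ z]) simp_all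
      then show ?thesis ..
    qed
    then have k: "z \<in> W k" unfolding k_def by (rule LeastI_ex)
    have k_min: "z \<notin> W j" if "j < k" for j using not_less_Least that unfolding k_def by blast
    obtain s x where s: "s \<in> G" "x \<in> U k" "z = s *v x" using k by (auto simp: W_def)
    have "x \<notin> W j" if j: "j < k" for j
    proof
      assume "x \<in> W j"
      then obtain t y where "t \<in> G" "y \<in> U j" "x = t *v y" by (auto simp: W_def)
      then have "z = (s ** t) *v y" "s ** t \<in> G" using s by (auto simp: matrix_vector_mul_assoc G_mult)
      then have "z \<in> W j" using \<open>y \<in> U j\<close> by (auto simp: W_def)
      then show False using k_min[OF j] by blast
    qed
    then have "x \<in> F" using s(2) by (auto simp: F_def V_def)
    then show ?thesis using s by blast
  qed
  ultimately show ?thesis by (rule that)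
qed

lemma cmod_J_measurable [measurable]: "(\<lambda>z. (cmod (J z))\<^sup>2) \<in> borel_measurable borel"
  by (intro borel_measurable_continuous_onI continuous_intros polyfun_continuous[OF polyfun_J])

lemma theta_measurable [measurable]: "\<theta> \<in> borel \<rightarrow>\<^sub>M borel"
  by (intro borel_measurable_continuous_onI theta_continuous)

lemma sets_borel_\<Omega>_D [measurable]: "\<Omega> \<in> sets borel" "D \<in> sets borel" "regular_part \<in> sets borel"
  using open_\<Omega> open_D open_regular_part by auto

text \<open>
  The translates of a fundamental domain are disjoint, as stabilizers are trivial, and each is mapped
  injectively onto the regular values in \<open>D\<close>.
\<close>

lemma theta_counting_emeasure:
  assumes E [measurable]: "E \<in> sets borel"
  shows "(\<integral>\<^sup>+z. ennreal ((cmod (J z))\<^sup>2) * indicator (\<Omega> \<inter> \<theta> -` E) z \<partial>lborel)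
    = of_nat (card G) * emeasure lborel (E \<inter> D)"
proof -
  obtain F where F: "F \<in> sets borel" "F \<subseteq> regular_part" "inj_on \<theta> F"
    "\<And>z. z \<in> regular_part \<Longrightarrow> \<exists>s\<in>G. \<exists>x\<in>F. z = s *v x"
    by (rule fundamental_domain) blast
  define S where "S = (\<lambda>s. (*v) s ` F \<inter> \<theta> -` E)"
  have S_sub: "S s \<subseteq> regular_part" if "s \<in> G" for s
    using F(2) regular_part_invariant[OF that] by (auto simp: S_def)
  have borelE: "\<theta> -` E \<in> sets borel" using measurable_sets[OF theta_measurable E] by simp
  have S_borel: "S s \<in> sets borel" if s: "s \<in> G" for s
  proof -
    have "(*v) (matrix_inv s) -` F \<in> sets borel"
      using measurable_sets[OF G_act_measurable F(1), of "matrix_inv s"] by simp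
    then show ?thesis unfolding S_def G_act_image[OF s] using borelE by (rule sets.Int)
  qed
  have S_inj: "inj_on \<theta> (S s)" if s: "s \<in> G" for s
  proof (rule inj_onI)
    fix x y assume "x \<in> S s" "y \<in> S s" and eq: "\<theta> x = \<theta> y"
    then obtain a b where ab: "a \<in> F" "b \<in> F" "x = s *v a" "y = s *v b" by (auto simp: S_def)
    then have "\<theta> a = \<theta> b" using eq by (simp add: theta_invariant[OF s])
    then have "a = b" using F(3) ab by (auto dest: inj_onD)
    then show "x = y" using ab by simp
  qed
  have S_image: "\<theta> ` S s = E \<inter> D - {x. discriminant x = 0}" if s: "s \<in> G" for s
  proof
    show "\<theta> ` S s \<subseteq> E \<inter> D - {x. discriminant x = 0}"
    proof (rule image_subsetI)
      fix z assume z: "z \<in> S s"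
      then have "z \<in> regular_part" using S_sub[OF s] by blast
      then have "\<theta> z \<in> D - {x. discriminant x = 0}" unfolding theta_regular_part[symmetric] by (rule imageI)
      moreover have "\<theta> z \<in> E" using z by (simp add: S_def)
      ultimately show "\<theta> z \<in> E \<inter> D - {x. discriminant x = 0}" by blast
    qed
    show "E \<inter> D - {x. discriminant x = 0} \<subseteq> \<theta> ` S s"
    proof
      fix x assume x: "x \<in> E \<inter> D - {x. discriminant x = 0}"
      then have "x \<in> \<theta> ` regular_part" by (simp add: theta_regular_part)
      then obtain z where z: "z \<in> regular_part" "x = \<theta> z" by auto
      then obtain t a where t: "t \<in> G" "a \<in> F" "z = t *v a" using F(4) by blast
      have "\<theta> (s *v a) = x" using t z(2) by (simp add: theta_invariant[OF s] theta_invariant[OF t(1)])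
      then show "x \<in> \<theta> ` S s" using x t(2) by (auto simp: S_def intro!: image_eqI[of x \<theta> "s *v a"])
    qed
  qed
  have null: "{x. discriminant x = 0} \<in> null_sets lborel" by (rule discriminant_zeros_null)
  have S_meas: "(\<integral>\<^sup>+z. ennreal ((cmod (J z))\<^sup>2) * indicator (S s) z \<partial>lborel) = emeasure lborel (E \<inter> D)" if s: "s \<in> G" for s
  proof -
    have "emeasure lborel (\<theta> ` S s) = (\<integral>\<^sup>+z\<in>S s. ennreal ((cmod (det (jacobian_matrix z)))\<^sup>2) \<partial>lborel)"
    proof (rule emeasure_injective_image[OF S_borel[OF s] _ theta_has_derivative S_inj[OF s]])
      show "bounded (S s)"
        by (rule bounded_subset[OF bounded_\<Omega>]) (use S_sub[OF s] in \<open>auto simp: regular_part_def\<close>)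
      show "continuous_on UNIV (\<lambda>z. det (jacobian_matrix z))"
        using polyfun_continuous[OF polyfun_J] by (simp add: J_eq[abs_def])
      have "E \<inter> D - {x. discriminant x = 0} \<in> sets lborel"
        by (intro sets.Diff null_setsD2[OF null]) simp
      then show "\<theta> ` S s \<in> sets borel" by (simp add: S_image[OF s])
    qed
    moreover have "emeasure lborel (E \<inter> D - {x. discriminant x = 0}) = emeasure lborel (E \<inter> D)"
      by (rule emeasure_Diff_null_set[OF null]) simp
    ultimately show ?thesis by (simp add: S_image[OF s] J_eq)
  qed
  have disj: "disjoint_family_on S G"
    unfolding disjoint_family_on_def
  proof (intro ballI impI)
    fix s t assume st: "s \<in> G" "t \<in> G" "s \<noteq> t"
    show "S s \<inter> S t = {}"
    proof (rule ccontr)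
      assume "S s \<inter> S t \<noteq> {}"
      then obtain a b where ab: "a \<in> F" "b \<in> F" "s *v a = t *v b" by (auto simp: S_def)
      then have "\<theta> a = \<theta> b" using theta_invariant[OF st(1), of a] theta_invariant[OF st(2), of b] by simp
      then have "a = b" using F(3) ab by (auto dest: inj_onD)
      then have "(matrix_inv t ** s) *v a = a"
        using ab(3) st(2) by (simp add: matrix_vector_mul_assoc[symmetric])
      moreover have "matrix_inv t ** s \<in> G" using st by (intro G_mult G_inv)
      moreover have "J a \<noteq> 0" using ab(1) F(2) by (auto simp: regular_part_def)
      ultimately have "matrix_inv t ** s = mat 1" by (intro trivial_stabilizer)
      then have "t ** (matrix_inv t ** s) = t" by simp
      then have "s = t" by (simp add: matrix_mul_assoc matrix_inv_mult[OF G_invertible[OF st(2)]])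
      then show False using st(3) by simp
    qed
  qed
  have union: "(\<Union>s\<in>G. S s) = regular_part \<inter> \<theta> -` E"
  proof
    show "(\<Union>s\<in>G. S s) \<subseteq> regular_part \<inter> \<theta> -` E" using S_sub by (auto simp: S_def)
    show "regular_part \<inter> \<theta> -` E \<subseteq> (\<Union>s\<in>G. S s)"
    proof
      fix z assume z: "z \<in> regular_part \<inter> \<theta> -` E"
      then obtain s x where "s \<in> G" "x \<in> F" "z = s *v x" using F(4) by blast
      then show "z \<in> (\<Union>s\<in>G. S s)" using z by (auto simp: S_def)
    qed
  qed
  have "AE z in lborel. z \<notin> {z. J z = 0}" by (rule AE_not_in[OF J_zeros_null])
  then have "(\<integral>\<^sup>+z. ennreal ((cmod (J z))\<^sup>2) * indicator (\<Omega> \<inter> \<theta> -` E) z \<partial>lborel)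
      = (\<integral>\<^sup>+z. ennreal ((cmod (J z))\<^sup>2) * indicator (\<Union>s\<in>G. S s) z \<partial>lborel)"
    unfolding union
    by (intro nn_integral_cong_AE, elim eventually_mono) (auto simp: regular_part_def indicator_def)
  also have "\<dots> = (\<integral>\<^sup>+z. (\<Sum>s\<in>G. ennreal ((cmod (J z))\<^sup>2) * indicator (S s) z) \<partial>lborel)"
    by (simp add: indicator_UN_disjoint[OF finite_G disj] sum_distrib_left)
  also have "\<dots> = (\<Sum>s\<in>G. \<integral>\<^sup>+z. ennreal ((cmod (J z))\<^sup>2) * indicator (S s) z \<partial>lborel)"
  proof (rule nn_integral_sum)
    fix s assume "s \<in> G"
    then have [measurable]: "S s \<in> sets borel" by (rule S_borel)
    show "(\<lambda>z. ennreal ((cmod (J z))\<^sup>2) * indicator (S s) z) \<in> borel_measurable lborel" by measurable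
  qed
  also have "\<dots> = of_nat (card G) * emeasure lborel (E \<inter> D)" by (simp add: S_meas)
  finally show ?thesis .
qed

lemma theta_pushforward:
  "distr (density lborel (\<lambda>z. ennreal ((cmod (J z))\<^sup>2 * indicator \<Omega> z))) borel \<theta>
    = density lborel (\<lambda>x. ennreal (real (card G) * indicator D x))"
proof (rule measure_eqI)
  fix E assume "E \<in> sets (distr (density lborel (\<lambda>z. ennreal ((cmod (J z))\<^sup>2 * indicator \<Omega> z))) borel \<theta>)"
  then have E [measurable]: "E \<in> sets borel" by simp
  have [measurable]: "\<theta> -` E \<in> sets borel" using measurable_sets[OF theta_measurable E] by simp
  have "emeasure (distr (density lborel (\<lambda>z. ennreal ((cmod (J z))\<^sup>2 * indicator \<Omega> z))) borel \<theta>) E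
      = emeasure (density lborel (\<lambda>z. ennreal ((cmod (J z))\<^sup>2 * indicator \<Omega> z))) (\<theta> -` E)"
    by (subst emeasure_distr) auto
  also have "\<dots> = (\<integral>\<^sup>+z. ennreal ((cmod (J z))\<^sup>2 * indicator \<Omega> z) * indicator (\<theta> -` E) z \<partial>lborel)"
    by (rule emeasure_density) auto
  also have "\<dots> = (\<integral>\<^sup>+z. ennreal ((cmod (J z))\<^sup>2) * indicator (\<Omega> \<inter> \<theta> -` E) z \<partial>lborel)"
    by (intro nn_integral_cong) (auto simp: indicator_def)
  also have "\<dots> = of_nat (card G) * emeasure lborel (E \<inter> D)" by (rule theta_counting_emeasure[OF E])
  also have "\<dots> = (\<integral>\<^sup>+x. of_nat (card G) * indicator (E \<inter> D) x \<partial>lborel)"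
    by (rule nn_integral_cmult_indicator[symmetric]) simp
  also have "\<dots> = (\<integral>\<^sup>+x. ennreal (real (card G) * indicator D x) * indicator E x \<partial>lborel)"
    by (intro nn_integral_cong) (auto simp: indicator_def ennreal_of_nat_eq_real_of_nat)
  also have "\<dots> = emeasure (density lborel (\<lambda>x. ennreal (real (card G) * indicator D x))) E"
    by (rule emeasure_density[symmetric]) auto
  finally show "emeasure (distr (density lborel (\<lambda>z. ennreal ((cmod (J z))\<^sup>2 * indicator \<Omega> z))) borel \<theta>) E
      = emeasure (density lborel (\<lambda>x. ennreal (real (card G) * indicator D x))) E" .
qed simp

lemma nn_integral_theta:
  assumes [measurable]: "\<phi> \<in> borel_measurable borel"
  shows "(\<integral>\<^sup>+z. ennreal ((cmod (J z))\<^sup>2 * indicator \<Omega> z) * \<phi> (\<theta> z) \<partial>lborel)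
    = (\<integral>\<^sup>+x. ennreal (real (card G) * indicator D x) * \<phi> x \<partial>lborel)"
proof -
  have "(\<integral>\<^sup>+x. ennreal (real (card G) * indicator D x) * \<phi> x \<partial>lborel)
      = (\<integral>\<^sup>+x. \<phi> x \<partial>density lborel (\<lambda>x. ennreal (real (card G) * indicator D x)))"
    by (rule nn_integral_density[symmetric]) auto
  also have "\<dots> = (\<integral>\<^sup>+z. \<phi> (\<theta> z) \<partial>density lborel (\<lambda>z. ennreal ((cmod (J z))\<^sup>2 * indicator \<Omega> z)))"
    by (subst theta_pushforward[symmetric], rule nn_integral_distr) auto
  also have "\<dots> = (\<integral>\<^sup>+z. ennreal ((cmod (J z))\<^sup>2 * indicator \<Omega> z) * \<phi> (\<theta> z) \<partial>lborel)"
    by (rule nn_integral_density) auto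
  finally show ?thesis by (rule sym)
qed

lemma integral_theta:
  fixes \<phi> :: "complex ^ 'n \<Rightarrow> complex"
  assumes [measurable]: "\<phi> \<in> borel_measurable borel"
  shows "(LINT z|lborel. ((cmod (J z))\<^sup>2 * indicator \<Omega> z) *\<^sub>R \<phi> (\<theta> z))
    = (LINT x|lborel. (real (card G) * indicator D x) *\<^sub>R \<phi> x)"
proof -
  have "(LINT x|lborel. (real (card G) * indicator D x) *\<^sub>R \<phi> x)
      = (LINT x|density lborel (\<lambda>x. ennreal (real (card G) * indicator D x)). \<phi> x)"
    by (rule integral_density[symmetric]) auto
  also have "\<dots> = (LINT z|density lborel (\<lambda>z. ennreal ((cmod (J z))\<^sup>2 * indicator \<Omega> z)). \<phi> (\<theta> z))"
    by (subst theta_pushforward[symmetric], rule integral_distr) auto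
  also have "\<dots> = (LINT z|lborel. ((cmod (J z))\<^sup>2 * indicator \<Omega> z) *\<^sub>R \<phi> (\<theta> z))"
    by (rule integral_density) auto
  finally show ?thesis by (rule sym)
qed

end


section \<open>Rescaling the measure\<close>

lemma bergman_product_measurable:
  assumes "open D" "continuous_on D \<nu>" "holomorphic_Cn f D" "holomorphic_Cn g D"
  shows "(\<lambda>z. indicator D z *\<^sub>R (f z * cnj (g z) * complex_of_real (\<nu> z))) \<in> borel_measurable borel"
  by (intro set_borel_measurable_continuous continuous_intros holomorphic_Cn_continuous assms)

lemma bergman_norm_measurable:
  assumes "open D" "continuous_on D \<nu>" "holomorphic_Cn f D"
  shows "(\<lambda>z. indicator D z *\<^sub>R ((cmod (f z))\<^sup>2 * \<nu> z)) \<in> borel_measurable borel"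
  by (intro set_borel_measurable_continuous continuous_intros holomorphic_Cn_continuous assms)

lemma scale_measure_eq_density:
  "scale_measure (ennreal c) lborel = density lborel (\<lambda>_. ennreal c)"
  by (rule measure_eqI) (auto simp: emeasure_density_const)

lemma bergman_space_scale:
  assumes "open D" "continuous_on D \<nu>" "0 < c"
  shows "bergman_space (scale_measure (ennreal c) lborel) D \<nu> = bergman_space lborel D \<nu>"
proof -
  have "set_integrable (scale_measure (ennreal c) lborel) D (\<lambda>z. (cmod (f z))\<^sup>2 * \<nu> z)
      \<longleftrightarrow> set_integrable lborel D (\<lambda>z. (cmod (f z))\<^sup>2 * \<nu> z)" if f: "holomorphic_Cn f D" for f
  proof -
    have "(\<lambda>z. indicator D z *\<^sub>R ((cmod (f z))\<^sup>2 * \<nu> z)) \<in> borel_measurable borel"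
      by (rule bergman_norm_measurable[OF assms(1,2) f])
    then have "integrable (density lborel (\<lambda>_. ennreal c)) (\<lambda>z. indicator D z *\<^sub>R ((cmod (f z))\<^sup>2 * \<nu> z))
        \<longleftrightarrow> integrable lborel (\<lambda>z. c *\<^sub>R (indicator D z *\<^sub>R ((cmod (f z))\<^sup>2 * \<nu> z)))"
      using assms(3) by (intro integrable_density) auto
    also have "\<dots> \<longleftrightarrow> integrable lborel (\<lambda>z. indicator D z *\<^sub>R ((cmod (f z))\<^sup>2 * \<nu> z))"
      using assms(3) by simp
    finally show ?thesis unfolding set_integrable_def scale_measure_eq_density .
  qed
  then show ?thesis unfolding bergman_space_def by blast
qed

lemma bergman_inner_scale:
  assumes "open D" "continuous_on D \<nu>" "0 < c" "holomorphic_Cn f D" "holomorphic_Cn g D"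
  shows "bergman_inner (scale_measure (ennreal c) lborel) D \<nu> f g = complex_of_real c * bergman_inner lborel D \<nu> f g"
proof -
  have "(\<lambda>z. indicator D z *\<^sub>R (f z * cnj (g z) * complex_of_real (\<nu> z))) \<in> borel_measurable borel"
    by (rule bergman_product_measurable[OF assms(1,2,4,5)])
  then have "integral\<^sup>L (density lborel (\<lambda>_. ennreal c)) (\<lambda>z. indicator D z *\<^sub>R (f z * cnj (g z) * complex_of_real (\<nu> z)))
      = (LINT z|lborel. c *\<^sub>R (indicator D z *\<^sub>R (f z * cnj (g z) * complex_of_real (\<nu> z))))"
    using assms(3) by (intro integral_density) auto
  also have "\<dots> = complex_of_real c * (LINT z|lborel. indicator D z *\<^sub>R (f z * cnj (g z) * complex_of_real (\<nu> z)))"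
    unfolding integral_scaleR_right by (rule scaleR_conv_of_real)
  finally show ?thesis
    unfolding bergman_inner_def set_lebesgue_integral_def scale_measure_eq_density .
qed

lemma is_bergman_kernel_scale:
  assumes D: "open D" and \<nu>: "continuous_on D \<nu>" "\<And>z. z \<in> D \<Longrightarrow> 0 < \<nu> z" and c: "0 < c"
  shows "is_bergman_kernel (scale_measure (ennreal c) lborel) D \<nu> K
    \<longleftrightarrow> is_bergman_kernel lborel D \<nu> (\<lambda>z w. complex_of_real c * K z w)"
proof -
  have mem: "(\<lambda>z. K z w) \<in> bergman_space lborel D \<nu> \<longleftrightarrow> (\<lambda>z. complex_of_real c * K z w) \<in> bergman_space lborel D \<nu>" for w
  proof
    show "(\<lambda>z. complex_of_real c * K z w) \<in> bergman_space lborel D \<nu>" if "(\<lambda>z. K z w) \<in> bergman_space lborel D \<nu>"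
      using bergman_space_cmult[OF D \<nu> that] .
    show "(\<lambda>z. K z w) \<in> bergman_space lborel D \<nu>" if "(\<lambda>z. complex_of_real c * K z w) \<in> bergman_space lborel D \<nu>"
      using bergman_space_cmult[OF D \<nu> that, of "complex_of_real (1 / c)"] c by simp
  qed
  have inner: "bergman_inner (scale_measure (ennreal c) lborel) D \<nu> f (\<lambda>z. K z w)
      = bergman_inner lborel D \<nu> f (\<lambda>z. complex_of_real c * K z w)"
    if "f \<in> bergman_space lborel D \<nu>" "(\<lambda>z. K z w) \<in> bergman_space lborel D \<nu>" for f w
    using that bergman_inner_scale[OF D \<nu>(1) c]
    by (simp add: bergman_space_def bergman_inner_cmult_right)
  show ?thesis
    unfolding is_bergman_kernel_def bergman_space_scale[OF D \<nu>(1) c]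
  proof (rule iffI; elim conjE; intro conjI ballI)
    assume K: "\<forall>w\<in>D. (\<lambda>z. K z w) \<in> bergman_space lborel D \<nu>"
      and rep: "\<forall>f\<in>bergman_space lborel D \<nu>. \<forall>w\<in>D. f w = bergman_inner (scale_measure (ennreal c) lborel) D \<nu> f (\<lambda>z. K z w)"
    show "(\<lambda>z. complex_of_real c * K z w) \<in> bergman_space lborel D \<nu>" if "w \<in> D" for w
      unfolding mem[symmetric] using K that by (rule bspec)
    show "f w = bergman_inner lborel D \<nu> f (\<lambda>z. complex_of_real c * K z w)" if f: "f \<in> bergman_space lborel D \<nu>" and w: "w \<in> D" for f w
      using bspec[OF bspec[OF rep f] w] unfolding inner[OF f bspec[OF K w]] .
  next
    assume K: "\<forall>w\<in>D. (\<lambda>z. complex_of_real c * K z w) \<in> bergman_space lborel D \<nu>"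
      and rep: "\<forall>f\<in>bergman_space lborel D \<nu>. \<forall>w\<in>D. f w = bergman_inner lborel D \<nu> f (\<lambda>z. complex_of_real c * K z w)"
    show K': "(\<lambda>z. K z w) \<in> bergman_space lborel D \<nu>" if "w \<in> D" for w
      unfolding mem using K that by (rule bspec)
    show "f w = bergman_inner (scale_measure (ennreal c) lborel) D \<nu> f (\<lambda>z. K z w)" if f: "f \<in> bergman_space lborel D \<nu>" and w: "w \<in> D" for f w
      unfolding inner[OF f K'[OF w]] by (rule bspec[OF bspec[OF rep f] w])
  qed
qed

text \<open>
  The kernel for a multiple of Lebesgue measure is chosen by an epsilon operator. It becomes a kernel
  for Lebesgue measure after multiplication with the constant, so the remaining arguments may use
  Lebesgue measure throughout.
\<close>

lemma bergman_kernel_scale: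
  assumes D: "open D" and \<nu>: "continuous_on D \<nu>" "\<And>z. z \<in> D \<Longrightarrow> 0 < \<nu> z" and c: "0 < c"
  shows "is_bergman_kernel lborel D \<nu> (\<lambda>z w. complex_of_real c * bergman_kernel (scale_measure (ennreal c) lborel) D \<nu> z w)"
proof -
  obtain K where "is_bergman_kernel lborel D \<nu> K" using bergman_kernel_exists[OF D \<nu>] by blast
  then have "is_bergman_kernel (scale_measure (ennreal c) lborel) D \<nu> (\<lambda>z w. complex_of_real (1 / c) * K z w)"
    using c by (simp add: is_bergman_kernel_scale[OF D \<nu> c])
  then have "is_bergman_kernel (scale_measure (ennreal c) lborel) D \<nu> (bergman_kernel (scale_measure (ennreal c) lborel) D \<nu>)"
    unfolding bergman_kernel_def
    by (rule someI[where P = "is_bergman_kernel (scale_measure (ennreal c) lborel) D \<nu>"])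
  then show ?thesis by (simp add: is_bergman_kernel_scale[OF D \<nu> c])
qed

lemma bergman_kernel_hermitian:
  assumes K: "is_bergman_kernel V D \<nu> K" and z: "z \<in> D" and w: "w \<in> D"
  shows "K z w = cnj (K w z)"
proof -
  have mem: "(\<lambda>u. K u y) \<in> bergman_space V D \<nu>" if "y \<in> D" for y
    using K that unfolding is_bergman_kernel_def by blast
  have rep: "f x = bergman_inner V D \<nu> f (\<lambda>u. K u x)" if "f \<in> bergman_space V D \<nu>" "x \<in> D" for f x
    using K that unfolding is_bergman_kernel_def by blast
  have "bergman_inner V D \<nu> (\<lambda>u. K u w) (\<lambda>u. K u z) = cnj (bergman_inner V D \<nu> (\<lambda>u. K u z) (\<lambda>u. K u w))"
    unfolding bergman_inner_def set_lebesgue_integral_def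
    by (subst Bochner_Integration.integral_cnj[symmetric], intro Bochner_Integration.integral_cong) (auto simp: mult_ac)
  then show ?thesis using rep[OF mem[OF w] z] rep[OF mem[OF z] w] by simp
qed

lemma bergman_inner_cong:
  assumes "open D" "\<And>z. z \<in> D \<Longrightarrow> f z = f' z" "\<And>z. z \<in> D \<Longrightarrow> g z = g' z"
  shows "bergman_inner lborel D \<nu> f g = bergman_inner lborel D \<nu> f' g'"
  unfolding bergman_inner_def set_lebesgue_integral_def
  by (intro Bochner_Integration.integral_cong) (auto simp: assms indicator_def)


section \<open>Pullback and the transformation of kernels\<close>

locale weighted_basic_polynomial_domain = basic_polynomial_domain G \<theta> \<Omega>
  for G :: "(complex ^ 'n ^ 'n) set" and \<theta> \<Omega> +
  fixes \<omega>' :: "complex ^ 'n \<Rightarrow> real"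
  assumes weight_continuous: "continuous_on (\<theta> ` \<Omega>) \<omega>'"
    and weight_pos: "\<And>x. x \<in> \<theta> ` \<Omega> \<Longrightarrow> 0 < \<omega>' x"
begin

abbreviation \<omega> :: "complex ^ 'n \<Rightarrow> real" where "\<omega> \<equiv> \<omega>' \<circ> \<theta>"
abbreviation A2\<Omega> :: "(complex ^ 'n \<Rightarrow> complex) set" where "A2\<Omega> \<equiv> bergman_space lborel \<Omega> \<omega>"
abbreviation A2D :: "(complex ^ 'n \<Rightarrow> complex) set" where "A2D \<equiv> bergman_space lborel D \<omega>'"
abbreviation inner\<Omega> :: "(complex ^ 'n \<Rightarrow> complex) \<Rightarrow> (complex ^ 'n \<Rightarrow> complex) \<Rightarrow> complex" where
  "inner\<Omega> \<equiv> bergman_inner lborel \<Omega> \<omega>"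
abbreviation innerD :: "(complex ^ 'n \<Rightarrow> complex) \<Rightarrow> (complex ^ 'n \<Rightarrow> complex) \<Rightarrow> complex" where
  "innerD \<equiv> bergman_inner lborel D \<omega>'"

lemma \<omega>_continuous: "continuous_on \<Omega> \<omega>"
  using continuous_on_compose[OF theta_continuous weight_continuous] .

lemma \<omega>_pos: "z \<in> \<Omega> \<Longrightarrow> 0 < \<omega> z"
  by (simp add: weight_pos)

lemmas A2\<Omega>_rules = open_\<Omega> \<omega>_continuous \<omega>_pos
lemmas A2D_rules = open_D weight_continuous weight_pos

lemma A2\<Omega>_iff: "f \<in> A2\<Omega> \<longleftrightarrow>
    holomorphic_Cn f \<Omega> \<and> (\<integral>\<^sup>+z\<in>\<Omega>. ennreal ((cmod (f z))\<^sup>2 * \<omega> z) \<partial>lborel) < \<infinity>"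
  by (rule bergman_space_iff[OF A2\<Omega>_rules])

lemma A2D_iff: "f \<in> A2D \<longleftrightarrow>
    holomorphic_Cn f D \<and> (\<integral>\<^sup>+x\<in>D. ennreal ((cmod (f x))\<^sup>2 * \<omega>' x) \<partial>lborel) < \<infinity>"
  by (rule bergman_space_iff[OF A2D_rules])

definition pullback :: "(complex ^ 'n \<Rightarrow> complex) \<Rightarrow> complex ^ 'n \<Rightarrow> complex" where
  "pullback f z = J z * f (\<theta> z)"

lemma holomorphic_compose_theta:
  assumes "holomorphic_Cn f D" shows "holomorphic_Cn (\<lambda>z. f (\<theta> z)) \<Omega>"
proof (rule holomorphic_Cn_compose[OF assms])
  show "\<exists>K. (\<theta> has_derivative K) (at z) \<and> (\<forall>c v. K (c *s v) = c *s K v)" for z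
    by (intro exI[of _ "(*v) (jacobian_matrix z)"] conjI theta_has_derivative) (simp add: vector_scalar_commute)
qed simp

lemma pullback_isometry:
  assumes f: "f \<in> A2D" and g: "g \<in> A2D"
  shows "pullback f \<in> A2\<Omega>" and "inner\<Omega> (pullback f) (pullback g) = of_nat (card G) * innerD f g"
proof -
  have hol: "holomorphic_Cn f D" "holomorphic_Cn g D" using f g by (auto simp: bergman_space_def)
  have "(\<lambda>x. indicator D x *\<^sub>R ((cmod (f x))\<^sup>2 * \<omega>' x)) \<in> borel_measurable borel"
    by (rule bergman_norm_measurable[OF open_D weight_continuous hol(1)])
  then have m: "(\<lambda>x. ennreal (indicator D x *\<^sub>R ((cmod (f x))\<^sup>2 * \<omega>' x))) \<in> borel_measurable borel" by measurable
  have "(\<integral>\<^sup>+z\<in>\<Omega>. ennreal ((cmod (pullback f z))\<^sup>2 * \<omega> z) \<partial>lborel)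
      = (\<integral>\<^sup>+z. ennreal ((cmod (J z))\<^sup>2 * indicator \<Omega> z) * ennreal (indicator D (\<theta> z) *\<^sub>R ((cmod (f (\<theta> z)))\<^sup>2 * \<omega>' (\<theta> z))) \<partial>lborel)"
    by (intro nn_integral_cong)
       (auto simp: pullback_def norm_mult power_mult_distrib ennreal_mult'[symmetric] mult.assoc split: split_indicator)
  also have "\<dots> = (\<integral>\<^sup>+x. ennreal (real (card G) * indicator D x) * ennreal (indicator D x *\<^sub>R ((cmod (f x))\<^sup>2 * \<omega>' x)) \<partial>lborel)"
    by (rule nn_integral_theta[OF m])
  also have "\<dots> = (\<integral>\<^sup>+x. ennreal (real (card G)) * ennreal (indicator D x *\<^sub>R ((cmod (f x))\<^sup>2 * \<omega>' x)) \<partial>lborel)"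
    by (intro nn_integral_cong) (auto split: split_indicator)
  also have "\<dots> = ennreal (real (card G)) * (\<integral>\<^sup>+x. ennreal (indicator D x *\<^sub>R ((cmod (f x))\<^sup>2 * \<omega>' x)) \<partial>lborel)"
    using m by (intro nn_integral_cmult) simp
  also have "(\<integral>\<^sup>+x. ennreal (indicator D x *\<^sub>R ((cmod (f x))\<^sup>2 * \<omega>' x)) \<partial>lborel)
      = (\<integral>\<^sup>+x\<in>D. ennreal ((cmod (f x))\<^sup>2 * \<omega>' x) \<partial>lborel)"
    by (intro nn_integral_cong) (auto split: split_indicator)
  also have "ennreal (real (card G)) * \<dots> < \<infinity>"
    using f by (simp add: A2D_iff ennreal_mult_less_top)
  finally have fin: "(\<integral>\<^sup>+z\<in>\<Omega>. ennreal ((cmod (pullback f z))\<^sup>2 * \<omega> z) \<partial>lborel) < \<infinity>" .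
  have "holomorphic_Cn (pullback f) \<Omega>"
    unfolding pullback_def[abs_def]
    by (intro holomorphic_Cn_mult polyfun_holomorphic[OF polyfun_J] holomorphic_compose_theta[OF hol(1)])
  with fin show "pullback f \<in> A2\<Omega>" unfolding A2\<Omega>_iff by blast
  define \<phi> where "\<phi> = (\<lambda>x. indicator D x *\<^sub>R (f x * cnj (g x) * complex_of_real (\<omega>' x)))"
  have m: "\<phi> \<in> borel_measurable borel"
    unfolding \<phi>_def by (rule bergman_product_measurable[OF open_D weight_continuous hol])
  have "inner\<Omega> (pullback f) (pullback g) = (LINT z|lborel. ((cmod (J z))\<^sup>2 * indicator \<Omega> z) *\<^sub>R \<phi> (\<theta> z))"
    unfolding bergman_inner_def set_lebesgue_integral_def
  proof (intro Bochner_Integration.integral_cong refl)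
    fix z
    show "indicat_real \<Omega> z *\<^sub>R (pullback f z * cnj (pullback g z) * complex_of_real (\<omega> z))
        = ((cmod (J z))\<^sup>2 * indicat_real \<Omega> z) *\<^sub>R \<phi> (\<theta> z)"
    proof (cases "z \<in> \<Omega>")
      case True
      have "pullback f z * cnj (pullback g z) * complex_of_real (\<omega> z)
          = (J z * cnj (J z)) * (f (\<theta> z) * cnj (g (\<theta> z)) * complex_of_real (\<omega>' (\<theta> z)))"
        by (simp add: pullback_def)
      also have "J z * cnj (J z) = complex_of_real ((cmod (J z))\<^sup>2)" by (rule complex_norm_square[symmetric])
      finally show ?thesis using True by (simp add: \<phi>_def scaleR_conv_of_real[where 'a = complex])
    qed simp
  qed
  also have "\<dots> = (LINT x|lborel. (real (card G) * indicator D x) *\<^sub>R \<phi> x)" by (rule integral_theta[OF m])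
  also have "\<dots> = (LINT x|lborel. of_nat (card G) * \<phi> x)"
    by (intro Bochner_Integration.integral_cong) (auto simp: \<phi>_def scaleR_conv_of_real[where 'a = complex] indicator_def)
  also have "\<dots> = of_nat (card G) * innerD f g"
    unfolding bergman_inner_def set_lebesgue_integral_def \<phi>_def by (rule integral_mult_right_zero)
  finally show "inner\<Omega> (pullback f) (pullback g) = of_nat (card G) * innerD f g" .
qed

text \<open>
  Relative invariance under \<open>G\<close> for the inverse of the determinant, the character by which \<open>J\<close>
  transforms.
\<close>

definition skew :: "(complex ^ 'n \<Rightarrow> complex) \<Rightarrow> bool" where
  "skew g \<longleftrightarrow> (\<forall>s\<in>G. \<forall>z\<in>\<Omega>. det s * g (s *v z) = g z)"

lemma pullback_skew: "skew (pullback f)"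
  unfolding skew_def pullback_def
proof (intro ballI)
  fix s z assume s: "s \<in> G"
  have "det s * (J (s *v z) * f (\<theta> (s *v z))) = (J (s *v z) * det s) * f (\<theta> z)"
    by (simp add: theta_invariant[OF s])
  then show "det s * (J (s *v z) * f (\<theta> (s *v z))) = J z * f (\<theta> z)"
    by (simp only: J_equivariant[OF s])
qed

text \<open>
  The quotient of \<open>g\<close> by \<open>J\<close> is constant on fibres and descends to a holomorphic function off the
  discriminant. Its squared norm is that of \<open>g\<close> divided by \<open>card G\<close>, so it extends to \<open>D\<close>.
\<close>

lemma skew_imp_pullback:
  assumes g: "g \<in> A2\<Omega>" and skew: "skew g"
  obtains k where "k \<in> A2D" "\<And>z. z \<in> \<Omega> \<Longrightarrow> g z = pullback k z"
proof -
  have hol: "holomorphic_Cn g \<Omega>" using g by (simp add: bergman_space_def)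
  define Z where "Z = {x. discriminant x = 0}"
  define k0 where "k0 = (\<lambda>x. let z = (SOME z. z \<in> \<Omega> \<and> \<theta> z = x) in g z / J z)"
  have k0: "k0 (\<theta> z) = g z / J z" if z: "z \<in> \<Omega>" for z
  proof -
    define y where "y = (SOME y. y \<in> \<Omega> \<and> \<theta> y = \<theta> z)"
    have "y \<in> \<Omega> \<and> \<theta> y = \<theta> z" unfolding y_def by (rule someI[of _ z]) (use z in simp)
    then have y: "y \<in> \<Omega>" "\<theta> z = \<theta> y" by auto
    obtain s where s: "s \<in> G" "y = s *v z" by (rule theta_fibre[OF y(2)])
    have "det s \<noteq> 0" using cmod_det[OF s(1)] by auto
    moreover have "det s * g y = g z" using skew s z by (simp add: skew_def)
    moreover have "det s * J y = J z" using J_equivariant[OF s(1), of z] s(2) by (simp add: mult.commute)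
    ultimately have "g y / J y = g z / J z" by (metis mult_divide_mult_cancel_left)
    then show ?thesis by (simp add: k0_def y_def[symmetric])
  qed
  (* Off the discriminant, k0 is g / J composed with a local inverse of the quotient map. *)
  have holk0: "holomorphic_Cn k0 (D - Z)"
    unfolding holomorphic_Cn_def
  proof
    fix x assume "x \<in> D - Z"
    then obtain z where z: "z \<in> regular_part" "x = \<theta> z"
      unfolding Z_def theta_regular_part[symmetric] by auto
    then have J: "J z \<noteq> 0" by (simp add: regular_part_def)
    obtain \<epsilon> where \<epsilon>: "0 < \<epsilon>" "ball z \<epsilon> \<subseteq> regular_part" "inj_on \<theta> (ball z \<epsilon>)"
      by (rule regular_part_locally_injective[OF z(1)])
    define B where "B = ball z \<epsilon>"
    define \<psi> where "\<psi> = inv_into B \<theta>"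
    have \<psi>: "\<psi> (\<theta> y) = y" if "y \<in> B" for y
      unfolding \<psi>_def by (rule inv_into_f_f) (use \<epsilon>(3) that in \<open>auto simp: B_def\<close>)
    have zB: "z \<in> B" using \<epsilon>(1) by (simp add: B_def)
    have inv: "invertible (jacobian_matrix z)" using J by (simp add: J_eq invertible_det_nz)
    have d\<psi>: "(\<psi> has_derivative (*v) (matrix_inv (jacobian_matrix z))) (at (\<theta> z))"
    proof (rule has_derivative_inverse_strong[where S = B and f = \<theta>])
      show "(\<theta> has_derivative (*v) (jacobian_matrix z)) (at z)" by (rule theta_has_derivative)
      show "(*v) (jacobian_matrix z) \<circ> (*v) (matrix_inv (jacobian_matrix z)) = id"
        by (auto simp: fun_eq_iff matrix_vector_mul_assoc matrix_inv_mult[OF inv])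
    qed (use zB \<psi> in \<open>auto simp: B_def theta_continuous\<close>)
    have "holomorphic_Cn (\<lambda>y. g y / J y) regular_part"
      by (intro holomorphic_Cn_divide holomorphic_Cn_subset[OF hol] polyfun_holomorphic polyfun_J)
         (auto simp: regular_part_def)
    then obtain L where L: "((\<lambda>y. g y / J y) has_derivative L) (at z)" "\<And>c v. L (c *s v) = c * L v"
      using holomorphic_CnD z(1) by blast
    have "((\<lambda>y. g y / J y) has_derivative L) (at (\<psi> (\<theta> z)))" using L(1) by (simp add: \<psi>[OF zB])
    from has_derivative_compose[OF d\<psi> this]
    have d: "((\<lambda>y. g (\<psi> y) / J (\<psi> y)) has_derivative (\<lambda>h. L (matrix_inv (jacobian_matrix z) *v h))) (at (\<theta> z))" .
    have openB: "open (\<theta> ` B)"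
      unfolding B_def by (rule invariance_of_domain[OF theta_continuous open_ball \<epsilon>(3)])
    have "(k0 has_derivative (\<lambda>h. L (matrix_inv (jacobian_matrix z) *v h))) (at (\<theta> z))"
    proof (rule has_derivative_transform_within_open[OF d openB])
      show "g (\<psi> y) / J (\<psi> y) = k0 y" if y: "y \<in> \<theta> ` B" for y
      proof -
        obtain u where u: "u \<in> B" "y = \<theta> u" using y by blast
        then have "u \<in> \<Omega>" using \<epsilon>(2) by (auto simp: B_def regular_part_def)
        then show ?thesis by (simp add: u \<psi> k0)
      qed
    qed (use zB in blast)
    then show "\<exists>L. (k0 has_derivative L) (at x) \<and> (\<forall>c v. L (c *s v) = c * L v)"
      unfolding z(2) using L(2)
      by (intro exI[of _ "\<lambda>h. L (matrix_inv (jacobian_matrix z) *v h)"]) (simp add: vector_scalar_commute)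
  qed
  have openDZ: "open (D - Z)"
    unfolding Z_def
    by (intro open_Diff open_D closed_Collect_eq polyfun_continuous[OF discriminant(1)] continuous_on_const)
  define \<phi> where "\<phi> = (\<lambda>x. ennreal (indicator (D - Z) x *\<^sub>R ((cmod (k0 x))\<^sup>2 * \<omega>' x)))"
  have "(\<lambda>x. indicator (D - Z) x *\<^sub>R ((cmod (k0 x))\<^sup>2 * \<omega>' x)) \<in> borel_measurable borel"
    by (rule bergman_norm_measurable[OF openDZ continuous_on_subset[OF weight_continuous] holk0]) blast
  then have m: "\<phi> \<in> borel_measurable borel" unfolding \<phi>_def by measurable
  have "(\<integral>\<^sup>+x. \<phi> x \<partial>lborel) \<le> (\<integral>\<^sup>+x. ennreal (real (card G) * indicator D x) * \<phi> x \<partial>lborel)"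
  proof (rule nn_integral_mono)
    fix x
    have "1 * \<phi> x \<le> ennreal (real (card G)) * \<phi> x"
      using card_G_pos by (intro mult_right_mono) (auto simp: Suc_le_eq)
    then show "\<phi> x \<le> ennreal (real (card G) * indicator D x) * \<phi> x"
      by (cases "x \<in> D") (auto simp: \<phi>_def)
  qed
  also have "\<dots> = (\<integral>\<^sup>+z. ennreal ((cmod (J z))\<^sup>2 * indicator \<Omega> z) * \<phi> (\<theta> z) \<partial>lborel)"
    by (rule nn_integral_theta[OF m, symmetric])
  also have "\<dots> \<le> (\<integral>\<^sup>+z\<in>\<Omega>. ennreal ((cmod (g z))\<^sup>2 * \<omega> z) \<partial>lborel)"
  proof (rule nn_integral_mono)
    fix z
    show "ennreal ((cmod (J z))\<^sup>2 * indicator \<Omega> z) * \<phi> (\<theta> z) \<le> ennreal ((cmod (g z))\<^sup>2 * \<omega> z) * indicator \<Omega> z"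
    proof (cases "z \<in> \<Omega> \<and> J z \<noteq> 0")
      case True
      then have "\<phi> (\<theta> z) = ennreal ((cmod (g z))\<^sup>2 / (cmod (J z))\<^sup>2 * \<omega>' (\<theta> z))"
        by (simp add: \<phi>_def Z_def discriminant_zero_iff k0 norm_divide power_divide)
      then show ?thesis using True by (simp add: ennreal_mult'[symmetric])
    next
      case False
      then show ?thesis by (auto simp: indicator_def)
    qed
  qed
  also have "\<dots> < \<infinity>" using g by (simp add: A2\<Omega>_iff)
  finally have fin\<phi>: "(\<integral>\<^sup>+x. \<phi> x \<partial>lborel) < \<infinity>" .
  have "(\<integral>\<^sup>+x. \<phi> x \<partial>lborel) = (\<integral>\<^sup>+x\<in>D - Z. ennreal ((cmod (k0 x))\<^sup>2 * \<omega>' x) \<partial>lborel)"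
    unfolding \<phi>_def by (intro nn_integral_cong) (auto split: split_indicator)
  with fin\<phi> have fin: "(\<integral>\<^sup>+x\<in>D - Z. ennreal ((cmod (k0 x))\<^sup>2 * \<omega>' x) \<partial>lborel) < \<infinity>" by simp
  obtain a where a: "discriminant a \<noteq> 0" using exists_discriminant_nonzero by blast
  obtain k where k: "holomorphic_Cn k D" "\<And>x. x \<in> D \<Longrightarrow> discriminant x \<noteq> 0 \<Longrightarrow> k x = k0 x"
    by (rule holomorphic_Cn_L2_extension[OF open_D discriminant(1) a holk0[unfolded Z_def] weight_continuous weight_pos fin[unfolded Z_def]])
       (assumption, rule that)
  have "AE x in lborel. x \<notin> Z" unfolding Z_def by (rule AE_not_in[OF discriminant_zeros_null])
  then have "(\<integral>\<^sup>+x\<in>D. ennreal ((cmod (k x))\<^sup>2 * \<omega>' x) \<partial>lborel) = (\<integral>\<^sup>+x\<in>D - Z. ennreal ((cmod (k0 x))\<^sup>2 * \<omega>' x) \<partial>lborel)"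
  proof (intro nn_integral_cong_AE, elim eventually_mono)
    fix x assume "x \<notin> Z"
    then show "ennreal ((cmod (k x))\<^sup>2 * \<omega>' x) * indicator D x = ennreal ((cmod (k0 x))\<^sup>2 * \<omega>' x) * indicator (D - Z) x"
      using k(2)[of x] by (auto simp: indicator_def Z_def)
  qed
  then have "k \<in> A2D" using fin k(1) by (simp add: A2D_iff)
  moreover have "g z = pullback k z" if z: "z \<in> \<Omega>" for z
  proof (rule continuous_eq_off_null_set[OF open_\<Omega> _ _ J_zeros_null _ z])
    show "continuous_on \<Omega> g" by (rule holomorphic_Cn_continuous[OF hol])
    show "continuous_on \<Omega> (pullback k)"
      unfolding pullback_def[abs_def]
      by (intro continuous_on_mult polyfun_continuous[OF polyfun_J] holomorphic_Cn_continuous[OF holomorphic_compose_theta[OF k(1)]])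
    show "g x = pullback k x" if "x \<in> \<Omega>" "x \<notin> {z. J z = 0}" for x
      using that k(2)[of "\<theta> x"] by (simp add: discriminant_zero_iff pullback_def k0)
  qed
  ultimately show ?thesis by (rule that)
qed

lemma G_act_isometry:
  assumes s: "s \<in> G" and f: "f \<in> A2\<Omega>" and g: "g \<in> A2\<Omega>"
  shows "(\<lambda>z. f (s *v z)) \<in> A2\<Omega>" "inner\<Omega> (\<lambda>z. f (s *v z)) (\<lambda>z. g (s *v z)) = inner\<Omega> f g"
proof -
  have ind: "indicator \<Omega> (s *v z) = indicator \<Omega> z" for z
  proof -
    have "s *v z \<in> \<Omega> \<longleftrightarrow> z \<in> \<Omega>"
      using invariant_\<Omega>[OF s] invariant_\<Omega>[OF G_inv[OF s], of "s *v z"] G_inv_act(1)[OF s] by metis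
    then show ?thesis by (simp add: indicator_def)
  qed
  note dist = distr_lborel_unimodular[OF cmod_det[OF s]]
  have hol: "holomorphic_Cn f \<Omega>" "holomorphic_Cn g \<Omega>" using f g by (auto simp: bergman_space_def)
  have hols: "holomorphic_Cn (\<lambda>z. f (s *v z)) \<Omega>"
  proof (rule holomorphic_Cn_compose[OF hol(1)])
    show "\<exists>K. ((*v) s has_derivative K) (at z) \<and> (\<forall>c v. K (c *s v) = c *s K v)" for z
      by (intro exI[of _ "(*v) s"] conjI bounded_linear_imp_has_derivative matrix_vector_mul_bounded_linear)
         (simp add: vector_scalar_commute)
  qed (rule invariant_\<Omega>[OF s])
  have "(\<lambda>z. indicator \<Omega> z *\<^sub>R ((cmod (f z))\<^sup>2 * \<omega> z)) \<in> borel_measurable borel"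
    by (rule bergman_norm_measurable[OF open_\<Omega> \<omega>_continuous hol(1)])
  then have m: "(\<lambda>z. ennreal (indicator \<Omega> z *\<^sub>R ((cmod (f z))\<^sup>2 * \<omega> z))) \<in> borel_measurable borel" by measurable
  have eq: "(\<integral>\<^sup>+z\<in>\<Omega>. ennreal ((cmod (h z))\<^sup>2 * \<omega> z) \<partial>lborel) = (\<integral>\<^sup>+z. ennreal (indicator \<Omega> z *\<^sub>R ((cmod (h z))\<^sup>2 * \<omega> z)) \<partial>lborel)" for h
    by (intro nn_integral_cong) (auto simp: indicator_def)
  have "(\<integral>\<^sup>+z. ennreal (indicator \<Omega> z *\<^sub>R ((cmod (f z))\<^sup>2 * \<omega> z)) \<partial>lborel)
      = (\<integral>\<^sup>+z. ennreal (indicator \<Omega> z *\<^sub>R ((cmod (f z))\<^sup>2 * \<omega> z)) \<partial>distr lborel borel ((*v) s))" by (simp only: dist)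
  also have "\<dots> = (\<integral>\<^sup>+z. ennreal (indicator \<Omega> z *\<^sub>R ((cmod (f (s *v z)))\<^sup>2 * \<omega> z)) \<partial>lborel)"
    by (subst nn_integral_distr) (use m in \<open>auto simp: ind theta_invariant[OF s]\<close>)
  finally show "(\<lambda>z. f (s *v z)) \<in> A2\<Omega>"
    using f hols unfolding A2\<Omega>_iff eq by (simp only:)
  have m: "(\<lambda>z. indicator \<Omega> z *\<^sub>R (f z * cnj (g z) * complex_of_real (\<omega> z))) \<in> borel_measurable borel"
    by (rule bergman_product_measurable[OF open_\<Omega> \<omega>_continuous hol])
  have "inner\<Omega> f g = (LINT z|distr lborel borel ((*v) s). indicator \<Omega> z *\<^sub>R (f z * cnj (g z) * complex_of_real (\<omega> z)))"
    unfolding bergman_inner_def set_lebesgue_integral_def dist ..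
  also have "\<dots> = inner\<Omega> (\<lambda>z. f (s *v z)) (\<lambda>z. g (s *v z))"
    unfolding bergman_inner_def set_lebesgue_integral_def
    by (subst integral_distr) (use m in \<open>auto simp: ind theta_invariant[OF s]\<close>)
  finally show "inner\<Omega> (\<lambda>z. f (s *v z)) (\<lambda>z. g (s *v z)) = inner\<Omega> f g" by simp
qed

text \<open>
  The transformed kernel is again a reproducing kernel, because \<open>f \<mapsto> f \<circ> s\<close> is unitary, and
  reproducing kernels are unique.
\<close>

lemma kernel_invariant:
  assumes B: "is_bergman_kernel lborel \<Omega> \<omega> B" and s: "s \<in> G" and z: "z \<in> \<Omega>" and w: "w \<in> \<Omega>"
  shows "B (s *v z) (s *v w) = B z w"
proof (rule is_bergman_kernel_unique[OF _ B z w])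
  have mem: "(\<lambda>z. B z (s *v w)) \<in> A2\<Omega>" if "w \<in> \<Omega>" for w
    using B invariant_\<Omega>[OF s that] unfolding is_bergman_kernel_def by blast
  show "is_bergman_kernel lborel \<Omega> \<omega> (\<lambda>z w. B (s *v z) (s *v w))"
    unfolding is_bergman_kernel_def
  proof (intro conjI ballI)
    show "(\<lambda>z. B (s *v z) (s *v w)) \<in> A2\<Omega>" if w: "w \<in> \<Omega>" for w
      by (rule G_act_isometry(1)[OF s mem[OF w] mem[OF w]])
    fix f w assume f: "f \<in> A2\<Omega>" and w: "w \<in> \<Omega>"
    define h where "h = (\<lambda>z. f (matrix_inv s *v z))"
    have h: "h \<in> A2\<Omega>" unfolding h_def by (rule G_act_isometry(1)[OF G_inv[OF s] f f])
    have "f w = h (s *v w)" by (simp add: h_def s)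
    also have "\<dots> = inner\<Omega> h (\<lambda>z. B z (s *v w))"
      using B h invariant_\<Omega>[OF s w] unfolding is_bergman_kernel_def by blast
    also have "\<dots> = inner\<Omega> (\<lambda>z. h (s *v z)) (\<lambda>z. B (s *v z) (s *v w))"
      by (rule G_act_isometry(2)[OF s h mem[OF w], symmetric])
    also have "(\<lambda>z. h (s *v z)) = f" by (simp add: h_def s)
    finally show "f w = inner\<Omega> f (\<lambda>z. B (s *v z) (s *v w))" .
  qed
qed

text \<open>
  The inner product of the pullback of \<open>C(\<cdot>, \<theta> w)\<close> with \<open>S z\<close> is computed twice, by the reproducing
  property of \<open>S z\<close> among skew functions and by that of \<open>C\<close>.
\<close>

lemma kernel_transformation:
  assumes B: "is_bergman_kernel lborel \<Omega> \<omega> B" and C: "is_bergman_kernel lborel D \<omega>' C"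
    and z: "z \<in> \<Omega>" and w: "w \<in> \<Omega>"
  shows "J z * cnj (J w) * C (\<theta> z) (\<theta> w) = (\<Sum>s\<in>G. det s * B (s *v z) w)"
proof -
  define S where "S = (\<lambda>u x. \<Sum>s\<in>G. det s * B (s *v x) u)"
  have inv_\<Omega>: "matrix_inv s *v u \<in> \<Omega>" if "s \<in> G" "u \<in> \<Omega>" for s u
    using invariant_\<Omega>[OF G_inv] that by blast
  have memB: "(\<lambda>x. B x u) \<in> A2\<Omega>" if "u \<in> \<Omega>" for u using B that unfolding is_bergman_kernel_def by blast
  have rep: "f u = inner\<Omega> f (\<lambda>x. B x u)" if "f \<in> A2\<Omega>" "u \<in> \<Omega>" for f u
    using B that unfolding is_bergman_kernel_def by blast
  have memBs: "(\<lambda>x. B (s *v x) u) \<in> A2\<Omega>" if "s \<in> G" "u \<in> \<Omega>" for s u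
    by (rule G_act_isometry(1)[OF that(1) memB memB]) (rule that)+
  have zero: "(\<lambda>x. 0) \<in> A2\<Omega>" by (simp add: bergman_space_def holomorphic_Cn_const set_integrable_def)
  (* Sums over subsets of G, so that membership and pairing are proved in one induction. *)
  have sum_mem: "(\<lambda>x. \<Sum>s\<in>H. det s * B (s *v x) u) \<in> A2\<Omega> \<and>
      (\<forall>f\<in>A2\<Omega>. inner\<Omega> f (\<lambda>x. \<Sum>s\<in>H. det s * B (s *v x) u) = (\<Sum>s\<in>H. cnj (det s) * f (matrix_inv s *v u)))"
    if H: "H \<subseteq> G" and u: "u \<in> \<Omega>" for H u
    using finite_subset[OF H finite_G] H
  proof (induction H rule: finite_induct)
    case empty
    show ?case unfolding sum.empty
      by (intro conjI ballI zero) (simp add: bergman_inner_def)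
  next
    case (insert s H)
    have s: "s \<in> G" using insert.prems by blast
    have IHc: "(\<lambda>x. \<Sum>s\<in>H. det s * B (s *v x) u) \<in> A2\<Omega> \<and>
      (\<forall>f\<in>A2\<Omega>. inner\<Omega> f (\<lambda>x. \<Sum>s\<in>H. det s * B (s *v x) u) = (\<Sum>s\<in>H. cnj (det s) * f (matrix_inv s *v u)))"
      by (rule insert.IH) (use insert.prems in blast)
    then have IH: "(\<lambda>x. \<Sum>s\<in>H. det s * B (s *v x) u) \<in> A2\<Omega>"
      "\<And>f. f \<in> A2\<Omega> \<Longrightarrow> inner\<Omega> f (\<lambda>x. \<Sum>s\<in>H. det s * B (s *v x) u) = (\<Sum>s\<in>H. cnj (det s) * f (matrix_inv s *v u))"
      by blast+
    have m: "(\<lambda>x. det s * B (s *v x) u) \<in> A2\<Omega>"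
      by (rule bergman_space_cmult[OF A2\<Omega>_rules memBs[OF s u]])
    have sum: "(\<lambda>x. \<Sum>s\<in>insert s H. det s * B (s *v x) u) = (\<lambda>x. det s * B (s *v x) u + (\<Sum>s\<in>H. det s * B (s *v x) u))"
      using insert.hyps by simp
    have "inner\<Omega> f (\<lambda>x. \<Sum>s\<in>insert s H. det s * B (s *v x) u) = (\<Sum>s\<in>insert s H. cnj (det s) * f (matrix_inv s *v u))"
      if f: "f \<in> A2\<Omega>" for f
    proof -
      have "inner\<Omega> f (\<lambda>x. B (s *v x) u) = inner\<Omega> f (\<lambda>x. B x (matrix_inv s *v u))"
      proof (rule bergman_inner_cong[OF open_\<Omega> refl])
        show "B (s *v x) u = B x (matrix_inv s *v u)" if "x \<in> \<Omega>" for x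
          using kernel_invariant[OF B s that inv_\<Omega>[OF s u]] by (simp add: s)
      qed
      also have "\<dots> = f (matrix_inv s *v u)" by (rule rep[OF f inv_\<Omega>[OF s u], symmetric])
      finally have 1: "inner\<Omega> f (\<lambda>x. det s * B (s *v x) u) = cnj (det s) * f (matrix_inv s *v u)"
        unfolding bergman_inner_cmult_right by (simp only:)
      have "inner\<Omega> f (\<lambda>x. det s * B (s *v x) u + (\<Sum>s\<in>H. det s * B (s *v x) u))
          = inner\<Omega> f (\<lambda>x. det s * B (s *v x) u) + inner\<Omega> f (\<lambda>x. \<Sum>s\<in>H. det s * B (s *v x) u)"
        by (rule bergman_inner_add_right[OF A2\<Omega>_rules f m IH(1)])
      then show ?thesis unfolding sum 1 IH(2)[OF f] using insert.hyps by simp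
    qed
    moreover have "(\<lambda>x. \<Sum>s\<in>insert s H. det s * B (s *v x) u) \<in> A2\<Omega>"
      unfolding sum by (rule bergman_space_add(1)[OF A2\<Omega>_rules m IH(1)])
    ultimately show ?case by blast
  qed
  have S_mem: "S u \<in> A2\<Omega>" if "u \<in> \<Omega>" for u using sum_mem[OF order_refl that] unfolding S_def by blast
  have S_skew: "skew (S u)" for u
    unfolding skew_def
  proof (intro ballI)
    fix t x assume t: "t \<in> G"
    have "det t * S u (t *v x) = (\<Sum>s\<in>G. det (s ** t) * B ((s ** t) *v x) u)"
      unfolding S_def sum_distrib_left by (intro sum.cong) (simp_all add: det_mul matrix_vector_mul_assoc mult_ac)
    also have "\<dots> = S u x" unfolding S_def by (rule sum.reindex_bij_betw[OF bij_betw_G_mult[OF t]])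
    finally show "det t * S u (t *v x) = S u x" .
  qed
  (* On skew functions each of the card G terms of the pairing contributes f u. *)
  have S_rep: "inner\<Omega> f (S u) = of_nat (card G) * f u" if f: "f \<in> A2\<Omega>" "skew f" and u: "u \<in> \<Omega>" for f u
  proof -
    have "inner\<Omega> f (S u) = (\<Sum>s\<in>G. cnj (det s) * f (matrix_inv s *v u))"
      using sum_mem[OF order_refl u] f(1) unfolding S_def by blast
    also have "\<dots> = (\<Sum>s\<in>G. f u)"
    proof (rule sum.cong[OF refl])
      fix s assume s: "s \<in> G"
      have "f (matrix_inv s *v u) = det s * f u"
        using f(2) s inv_\<Omega>[OF s u] by (simp add: skew_def) (metis G_inv_act(2) s)
      moreover have "cnj (det s) * det s = 1" using cmod_det[OF s] complex_norm_square[of "det s"] by (simp add: mult.commute)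
      ultimately show "cnj (det s) * f (matrix_inv s *v u) = f u" by (simp add: mult.assoc[symmetric])
    qed
    finally show ?thesis by simp
  qed
  obtain k where k: "k \<in> A2D" "\<And>x. x \<in> \<Omega> \<Longrightarrow> S z x = pullback k x"
    using skew_imp_pullback[OF S_mem[OF z] S_skew] by blast
  have Cw: "(\<lambda>x. C x (\<theta> w)) \<in> A2D" using C w unfolding is_bergman_kernel_def by blast
  have "of_nat (card G) * pullback (\<lambda>x. C x (\<theta> w)) z = inner\<Omega> (pullback (\<lambda>x. C x (\<theta> w))) (S z)"
    by (rule S_rep[OF pullback_isometry(1)[OF Cw Cw] pullback_skew z, symmetric])
  also have "\<dots> = inner\<Omega> (pullback (\<lambda>x. C x (\<theta> w))) (pullback k)"
    by (rule bergman_inner_cong[OF open_\<Omega> refl k(2)])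
  also have "\<dots> = of_nat (card G) * innerD (\<lambda>x. C x (\<theta> w)) k" by (rule pullback_isometry(2)[OF Cw k(1)])
  also have "innerD (\<lambda>x. C x (\<theta> w)) k = cnj (innerD k (\<lambda>x. C x (\<theta> w)))"
    by (rule bergman_inner_cnj[symmetric])
  also have "innerD k (\<lambda>x. C x (\<theta> w)) = k (\<theta> w)"
    using C k(1) w unfolding is_bergman_kernel_def by (metis imageI)
  finally have "pullback (\<lambda>x. C x (\<theta> w)) z = cnj (k (\<theta> w))" using card_G_pos by simp
  then have "cnj (J w) * pullback (\<lambda>x. C x (\<theta> w)) z = cnj (S z w)"
    by (simp add: k(2)[OF w] pullback_def)
  also have "cnj (S z w) = (\<Sum>s\<in>G. det (matrix_inv s) * B (matrix_inv s *v z) w)"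
    unfolding S_def cnj_sum
  proof (rule sum.cong[OF refl])
    fix s assume s: "s \<in> G"
    have "det (matrix_inv s) * det s = 1" by (metis det_mul det_I matrix_inv_mult(2) G_invertible[OF s])
    moreover have "cnj (det s) * det s = 1" using cmod_det[OF s] complex_norm_square[of "det s"] by (simp add: mult.commute)
    moreover have "det s \<noteq> 0" using cmod_det[OF s] by auto
    ultimately have "cnj (det s) = det (matrix_inv s)" by (metis mult_right_cancel)
    moreover have "cnj (B (s *v w) z) = B (matrix_inv s *v z) w"
    proof -
      have "cnj (B (s *v w) z) = B z (s *v w)"
        using bergman_kernel_hermitian[OF B z invariant_\<Omega>[OF s w]] by simp
      also have "\<dots> = B (matrix_inv s *v z) w"
        using kernel_invariant[OF B s inv_\<Omega>[OF s z] w] by (simp add: s)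
      finally show ?thesis .
    qed
    ultimately show "cnj (det s * B (s *v w) z) = det (matrix_inv s) * B (matrix_inv s *v z) w" by simp
  qed
  also have "\<dots> = (\<Sum>s\<in>G. det s * B (s *v z) w)"
  proof (rule sum.reindex_bij_betw)
    show "bij_betw matrix_inv G G"
      by (rule bij_betw_byWitness[where f' = matrix_inv]) (auto simp: matrix_inv_matrix_inv G_invertible G_inv)
  qed
  finally show ?thesis by (simp add: pullback_def mult_ac)
qed

end


section \<open>The quotient by the Jacobian\<close>

text \<open>
  Two quotients agree where \<open>J\<close> vanishes in neither variable; continuity extends this first to all
  \<open>z\<close> and then to all \<open>w\<close>.
\<close>

lemma sesquiholomorphic_quotient_unique:
  assumes D: "open D" and J: "polyfun J" "J a \<noteq> 0"
    and P: "sesquiholomorphic_quotient D J S P" and Q: "sesquiholomorphic_quotient D J S Q"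
    and z: "z \<in> D" and w: "w \<in> D"
  shows "P z w = Q z w"
proof -
  have null: "{z. J z = 0} \<in> null_sets lborel" by (rule polyfun_zeros_null[OF J])
  have 1: "P x y = Q x y" if x: "x \<in> D" and y: "y \<in> D" "J y \<noteq> 0" for x y
  proof (rule continuous_eq_off_null_set[OF D _ _ null _ x])
    show "continuous_on D (\<lambda>x. P x y)"
      by (rule holomorphic_Cn_continuous) (use P y(1) in \<open>simp add: sesquiholomorphic_quotient_def\<close>)
    show "continuous_on D (\<lambda>x. Q x y)"
      by (rule holomorphic_Cn_continuous) (use Q y(1) in \<open>simp add: sesquiholomorphic_quotient_def\<close>)
    show "P x y = Q x y" if "x \<in> D" "x \<notin> {z. J z = 0}" for x
      using P Q that y by (simp add: sesquiholomorphic_quotient_def)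
  qed
  have "cnj (P z w) = cnj (Q z w)"
  proof (rule continuous_eq_off_null_set[OF D _ _ null _ w])
    show "continuous_on D (\<lambda>y. cnj (P z y))"
      by (rule holomorphic_Cn_continuous) (use P z in \<open>simp add: sesquiholomorphic_quotient_def\<close>)
    show "continuous_on D (\<lambda>y. cnj (Q z y))"
      by (rule holomorphic_Cn_continuous) (use Q z in \<open>simp add: sesquiholomorphic_quotient_def\<close>)
    show "cnj (P z y) = cnj (Q z y)" if "y \<in> D" "y \<notin> {z. J z = 0}" for y
      using 1[OF z that(1)] that(2) by simp
  qed
  then show ?thesis by simp
qed

theorem corollary3p6:
  fixes G :: "(complex ^ 'n ^ 'n) set"
    and \<Omega> :: "(complex ^ 'n) set"
    and \<theta> :: "complex ^ 'n \<Rightarrow> complex ^ 'n"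
    and \<omega>' \<omega> :: "complex ^ 'n \<Rightarrow> real"
  assumes "finite_complex_reflection_group G"
    and "open \<Omega>" and "connected \<Omega>" and "\<Omega> \<noteq> {}" and "bounded \<Omega>"
    and "group_invariant G \<Omega>"
    and "basic_polynomial_map G \<theta>"
    and "continuous_on (\<theta> ` \<Omega>) \<omega>'"
    and "\<And>x. x \<in> \<theta> ` \<Omega> \<Longrightarrow> 0 < \<omega>' x"
    and "\<omega> = \<omega>' \<circ> \<theta>"
  shows "let V = normalized_volume \<Omega>;
             quotient = sesquiholomorphic_quotient \<Omega> (complex_jacobian \<theta>)
               (\<lambda>z w. \<Sum>\<sigma>\<in>G. det \<sigma> * bergman_kernel V \<Omega> \<omega> (group_act (matrix_inv \<sigma>) z) w)
         in (\<exists>Q. quotient Q) \<and>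
            (\<forall>Q. quotient Q \<longrightarrow>
               (\<forall>z\<in>\<Omega>. \<forall>w\<in>\<Omega>. bergman_kernel V (\<theta> ` \<Omega>) \<omega>' (\<theta> z) (\<theta> w) = Q z w))"
proof -
  have "finite G" "subgroup G GL"
    using assms(1) unfolding finite_complex_reflection_group_def by blast+
  then interpret basic_polynomial_quotient G \<theta>
    using assms(7) by (rule basic_polynomial_quotient.intro)
  have inv: "s *v z \<in> \<Omega>" if "s \<in> G" "z \<in> \<Omega>" for s z
  proof -
    have "group_act (matrix_inv s) ` \<Omega> = \<Omega>"
      using assms(6) G_inv[OF that(1)] by (simp add: group_invariant_def)
    then show ?thesis
      using imageI[OF that(2), of "group_act (matrix_inv s)"] by (simp add: group_act_matrix_inv[OF that(1)])
  qed
  interpret weighted_basic_polynomial_domain G \<theta> \<Omega> \<omega>'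
  proof unfold_locales
    show "open \<Omega>" "bounded \<Omega>" by fact+
    show "continuous_on (\<theta> ` \<Omega>) \<omega>'" by fact
    show "s *v z \<in> \<Omega>" if "s \<in> G" "z \<in> \<Omega>" for s z by (rule inv[OF that])
    show "0 < \<omega>' x" if "x \<in> \<theta> ` \<Omega>" for x by (rule assms(9)[OF that])
  qed
  define c where "c = 1 / measure lborel \<Omega>"
  have c: "0 < c"
  proof -
    have "emeasure lborel \<Omega> \<noteq> 0"
    proof
      assume "emeasure lborel \<Omega> = 0"
      then have "\<Omega> \<in> null_sets lborel" using assms(2) by (simp add: null_sets_def)
      then have "negligible \<Omega>" by (simp add: negligible_iff_null_sets null_sets_completionI)
      then show False using open_not_negligible[OF assms(2,4)] by contradiction
    qed
    moreover have "emeasure lborel \<Omega> < \<infinity>" by (rule emeasure_bounded_finite[OF assms(5)])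
    ultimately show ?thesis unfolding c_def measure_def
      by (simp add: enn2real_positive_iff zero_less_iff_neq_zero)
  qed
  define V where "V = normalized_volume \<Omega>"
  have V: "V = scale_measure (ennreal c) lborel" by (simp add: V_def normalized_volume_def c_def)
  define B where "B = bergman_kernel V \<Omega> \<omega>"
  define C where "C = bergman_kernel V D \<omega>'"
  have B: "is_bergman_kernel lborel \<Omega> (\<omega>' \<circ> \<theta>) (\<lambda>z w. complex_of_real c * B z w)"
    unfolding B_def V assms(10) by (rule bergman_kernel_scale[OF A2\<Omega>_rules c])
  have C: "is_bergman_kernel lborel D \<omega>' (\<lambda>z w. complex_of_real c * C z w)"
    unfolding C_def V by (rule bergman_kernel_scale[OF A2D_rules c])
  define S where "S = (\<lambda>z w. \<Sum>\<sigma>\<in>G. det \<sigma> * B (group_act (matrix_inv \<sigma>) z) w)"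
  have eq: "J z * cnj (J w) * C (\<theta> z) (\<theta> w) = S z w" if z: "z \<in> \<Omega>" and w: "w \<in> \<Omega>" for z w
  proof -
    have "complex_of_real c * (J z * cnj (J w) * C (\<theta> z) (\<theta> w)) = J z * cnj (J w) * (complex_of_real c * C (\<theta> z) (\<theta> w))"
      by simp
    also have "\<dots> = (\<Sum>s\<in>G. det s * (complex_of_real c * B (s *v z) w))"
      by (rule kernel_transformation[OF B C z w])
    also have "\<dots> = complex_of_real c * S z w"
      unfolding S_def sum_distrib_left by (intro sum.cong) (simp_all add: group_act_matrix_inv)
    finally show ?thesis using c by simp
  qed
  have hermC: "C x y = cnj (C y x)" if "x \<in> D" "y \<in> D" for x y
    using bergman_kernel_hermitian[OF C that] c by simp
  have holC: "holomorphic_Cn (\<lambda>x. C x y) D" if "y \<in> D" for y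
  proof -
    have "holomorphic_Cn (\<lambda>x. complex_of_real c * C x y) D"
      using C that unfolding is_bergman_kernel_def bergman_space_def by blast
    from holomorphic_Cn_cmult[OF this, of "complex_of_real (1 / c)"] show ?thesis using c by simp
  qed
  have quot: "sesquiholomorphic_quotient \<Omega> J S (\<lambda>z w. C (\<theta> z) (\<theta> w))"
    unfolding sesquiholomorphic_quotient_def
  proof (intro conjI ballI impI)
    show "holomorphic_Cn (\<lambda>z. C (\<theta> z) (\<theta> w)) \<Omega>" if "w \<in> \<Omega>" for w
      using that by (intro holomorphic_compose_theta holC) simp
    show "holomorphic_Cn (\<lambda>w. cnj (C (\<theta> z) (\<theta> w))) \<Omega>" if z: "z \<in> \<Omega>" for z
    proof (rule holomorphic_Cn_cong[OF _ assms(2)])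
      show "holomorphic_Cn (\<lambda>w. C (\<theta> w) (\<theta> z)) \<Omega>" using z by (intro holomorphic_compose_theta holC) simp
      show "C (\<theta> w) (\<theta> z) = cnj (C (\<theta> z) (\<theta> w))" if "w \<in> \<Omega>" for w
        using hermC[of "\<theta> w" "\<theta> z"] z that by simp
    qed
    show "C (\<theta> z) (\<theta> w) = 1 / (J z * cnj (J w)) * S z w" if "z \<in> \<Omega>" "w \<in> \<Omega>" "J z \<noteq> 0" "J w \<noteq> 0" for z w
      unfolding eq[OF that(1,2), symmetric] using that(3,4) by simp
  qed
  obtain a where a: "J a \<noteq> 0" using exists_J_nonzero by blast
  have "C (\<theta> z) (\<theta> w) = Q z w" if "sesquiholomorphic_quotient \<Omega> J S Q" "z \<in> \<Omega>" "w \<in> \<Omega>" for Q z w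
    by (rule sesquiholomorphic_quotient_unique[OF assms(2) polyfun_J a quot that])
  then show ?thesis
    using quot unfolding Let_def S_def B_def C_def V_def by blast
qed

end
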